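(* Let $d\in\mathbb{N}$, $s_0\in(0,1)$, $1<p\le q$ and $c>0$. There exist constants $C>0$ and $\varepsilon\in(0,1)$ depending only on $d,s_0,p,q$ and $c$ such that the following holds. Let $s\in[s_0,1)$, let $\Omega\subset\mathbb{R}^d$ be open, and let $f:[0,\infty)\to[0,\infty)$ be convex, strictly increasing and differentiable with $f(0)=0$, $f(1)=1$ and $p f(t)\le t f'(t)\le q f(t)$ for all $t\ge0$. If $u\in G_-(\Omega;q,c,s,f)$ is nonnegative in a ball $B_R(x_0)\subset\Omega$, then $$\frac{1}{|B_R(x_0)|}\int_{B_R(x_0)}f^{\varepsilon}\left(\frac{u(x)}{R^s}\right)dx\le C f^{\varepsilon}\left(\inf_{B_{R/2}(x_0)}\frac{u}{R^s}\right)+C f^{\varepsilon}\left(\frac{\mathrm{Tail}_{f'}(u_-;x_0,R)}{R^s}\right).$$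
   Context: $a_\pm=\max\{\pm a,0\}$; $f^\varepsilon(t)=(f(t))^\varepsilon$; $\inf$ of measurable functions is essential. Generalized inverse: $(f')^{-1}(y)=\inf\{t\ge0: f'(t)\ge y\}$ for $y\ge 0$. Tail: $$\mathrm{Tail}_{f'}(u;x_0,R)=R^s (f')^{-1}\left((1-s)R^s\int_{\mathbb{R}^d\setminus B_R(x_0)}f'\left(\frac{|u(y)|}{|y-x_0|^s}\right)\frac{dy}{|y-x_0|^{d+s}}\right).$$ Modulars: $\Phi_{L^f(\Omega)}(u)=\int_\Omega f(|u(x)|)\,dx$, $\Phi_{W^{s,f}(\Omega)}(u)=(1-s)\int_\Omega\int_\Omega f\left(\frac{|u(x)-u(y)|}{|x-y|^s}\right)\frac{dy\,dx}{|x-y|^d}$, $\Phi_{V^{s,f}(\Omega|\mathbb{R}^d)}(u)=(1-s)\iint_{(\Omega^c\times\Omega^c)^c} f\left(\frac{|u(x)-u(y)|}{|x-y|^s}\right)\frac{dy\,dx}{|x-y|^d}$. The space $V^{s,f}(\Omega|\mathbb{R}^d)$ consists of the measurable $u:\mathbb{R}^d\to\mathbb{R}$ with $\Phi_{L^f(\Omega)}(u)<\infty$ and $\Phi_{V^{s,f}(\Omega|\mathbb{R}^d)}(u)<\infty$. De Giorgi class: $u\in G_-(\Omega;q,c,s,f)$ if $u\in V^{s,f}(\Omega|\mathbb{R}^d)$ and for every $x_0\in\Omega$, $0<r<R\le \mathrm{dist}(x_0,\partial\Omega)$ and $k\in\mathbb{R}$, with $w_\pm(x)=(u(x)-k)_\pm$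 and $A_k^+=\{y\in\mathbb{R}^d:u(y)>k\}$, $$\Phi_{W^{s,f}(B_r(x_0))}(w_-)+(1-s)\int_{B_r(x_0)}\int_{A_k^+}f'\left(\frac{w_+(y)}{|x-y|^s}\right)\frac{w_-(x)}{|x-y|^s}\frac{dy\,dx}{|x-y|^d}$$ $$\le c\left(\frac{R}{R-r}\right)^q\Phi_{L^f(B_R(x_0))}\left(\frac{w_-}{R^s}\right)+c\left(\frac{R}{R-r}\right)^{d+sq}\|w_-\|_{L^1(B_R(x_0))}(1-s)\int_{\mathbb{R}^d\setminus B_r(x_0)}f'\left(\frac{w_-(y)}{|y-x_0|^s}\right)\frac{dy}{|y-x_0|^{d+s}}.$$ *)

theory Defs
  imports "HOL-Probability.Essential_Supremum"
begin

text \<open>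
  A Young function \<open>f : [0,\<infinity>) \<rightarrow> [0,\<infinity>)\<close> is represented by a total function \<open>real \<Rightarrow> real\<close> that is
  only ever constrained and used on \<open>{0..}\<close> (up to null sets). In particular its derivative is
  taken relative to \<open>{0..}\<close>, i.e. at \<open>0\<close> it is the right derivative.
\<close>

definition deriv0 :: "(real \<Rightarrow> real) \<Rightarrow> real \<Rightarrow> real" where
  "deriv0 f t = vector_derivative f (at t within {0..})"

definition growth_function :: "real \<Rightarrow> real \<Rightarrow> (real \<Rightarrow> real) \<Rightarrow> bool" where
  "growth_function p q f \<longleftrightarrow>
     (\<forall>t\<ge>0. f t \<ge> 0) \<and> convex_on {0..} f \<and> strict_mono_on {0..} f \<and> f differentiable_on {0..} \<and>
     f 0 = 0 \<and> f 1 = 1 \<and> (\<forall>t\<ge>0. p * f t \<le> t * deriv0 f t \<and> t * deriv0 f t \<le> q * f t)"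

definition pos_part :: "real \<Rightarrow> real" where
  "pos_part a = max a 0"

definition neg_part :: "real \<Rightarrow> real" where
  "neg_part a = max (- a) 0"

text \<open>
  All integrals below have nonnegative integrands and are taken in \<^typ>\<open>ennreal\<close>, so that they may be
  infinite. On the diagonal \<open>x = y\<close> (a null set) the integrands are \<open>0\<close>, because \<open>a / 0 = 0\<close>.
\<close>

definition modular_L :: "(real \<Rightarrow> real) \<Rightarrow> 'a::euclidean_space set \<Rightarrow> ('a \<Rightarrow> real) \<Rightarrow> ennreal" where
  "modular_L f \<Omega> u = (\<integral>\<^sup>+x\<in>\<Omega>. ennreal (f \<bar>u x\<bar>) \<partial>lebesgue)"

definition modular_W :: "real \<Rightarrow> (real \<Rightarrow> real) \<Rightarrow> 'a::euclidean_space set \<Rightarrow> ('a \<Rightarrow> real) \<Rightarrow> ennreal" where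
  "modular_W s f \<Omega> u = ennreal (1 - s) *
     (\<integral>\<^sup>+x\<in>\<Omega>. (\<integral>\<^sup>+y\<in>\<Omega>.
        ennreal (f (\<bar>u x - u y\<bar> / norm (x - y) powr s) / norm (x - y) ^ DIM('a)) \<partial>lebesgue) \<partial>lebesgue)"

definition modular_V :: "real \<Rightarrow> (real \<Rightarrow> real) \<Rightarrow> 'a::euclidean_space set \<Rightarrow> ('a \<Rightarrow> real) \<Rightarrow> ennreal" where
  "modular_V s f \<Omega> u = ennreal (1 - s) *
     (\<integral>\<^sup>+x. (\<integral>\<^sup>+y.
        ennreal (f (\<bar>u x - u y\<bar> / norm (x - y) powr s) / norm (x - y) ^ DIM('a)) *
        indicator (- ((- \<Omega>) \<times> (- \<Omega>))) (x, y) \<partial>lebesgue) \<partial>lebesgue)"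

definition space_V :: "real \<Rightarrow> (real \<Rightarrow> real) \<Rightarrow> 'a::euclidean_space set \<Rightarrow> ('a \<Rightarrow> real) set" where
  "space_V s f \<Omega> =
     {u \<in> borel_measurable lebesgue. modular_L f \<Omega> u < \<infinity> \<and> modular_V s f \<Omega> u < \<infinity>}"

text \<open>
  The distance to a set is taken in \<^typ>\<open>ereal\<close>, so that the distance to the empty set (the boundary of
  the whole space) is \<open>\<infinity>\<close>; in contrast, \<^const>\<open>infdist\<close> would give \<open>0\<close>.
\<close>

definition edist_set :: "'a::euclidean_space \<Rightarrow> 'a set \<Rightarrow> ereal" where
  "edist_set x A = (INF z\<in>A. ereal (dist x z))"

definition De_Giorgi_minus ::
  "'a::euclidean_space set \<Rightarrow> real \<Rightarrow> real \<Rightarrow> real \<Rightarrow> (real \<Rightarrow> real) \<Rightarrow> ('a \<Rightarrow> real) set" where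
  "De_Giorgi_minus \<Omega> q c s f =
     {u \<in> space_V s f \<Omega>.
        \<forall>x0\<in>\<Omega>. \<forall>r R k. 0 < r \<and> r < R \<and> ereal R \<le> edist_set x0 (frontier \<Omega>) \<longrightarrow>
          (let wp = (\<lambda>x. pos_part (u x - k)); wm = (\<lambda>x. neg_part (u x - k)) in
             modular_W s f (ball x0 r) wm
             + ennreal (1 - s) *
               (\<integral>\<^sup>+x\<in>ball x0 r. (\<integral>\<^sup>+y\<in>{y. u y > k}.
                  ennreal (deriv0 f (wp y / norm (x - y) powr s) * (wm x / norm (x - y) powr s)
                           / norm (x - y) ^ DIM('a)) \<partial>lebesgue) \<partial>lebesgue)
             \<le> ennreal (c * (R / (R - r)) powr q) * modular_L f (ball x0 R) (\<lambda>x. wm x / R powr s)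
               + ennreal (c * (R / (R - r)) powr (real DIM('a) + s * q)) *
                 (\<integral>\<^sup>+x\<in>ball x0 R. ennreal (wm x) \<partial>lebesgue) * ennreal (1 - s) *
                 (\<integral>\<^sup>+y\<in>- ball x0 r.
                    ennreal (deriv0 f (wm y / norm (y - x0) powr s)
                             / norm (y - x0) powr (real DIM('a) + s)) \<partial>lebesgue))}"

text \<open>The generalized inverse on \<open>[0,\<infinity>]\<close>, with \<open>inf {} = \<infinity>\<close>.\<close>

definition gen_inverse :: "(real \<Rightarrow> real) \<Rightarrow> ennreal \<Rightarrow> ennreal" where
  "gen_inverse g y = Inf {ennreal t | t. t \<ge> 0 \<and> ennreal (g t) \<ge> y}"

definition Tail :: "(real \<Rightarrow> real) \<Rightarrow> real \<Rightarrow> ('a::euclidean_space \<Rightarrow> real) \<Rightarrow> 'a \<Rightarrow> real \<Rightarrow> ennreal" where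
  "Tail g s u x0 R = ennreal (R powr s) *
     gen_inverse g (ennreal ((1 - s) * R powr s) *
       (\<integral>\<^sup>+y\<in>- ball x0 R.
          ennreal (g (\<bar>u y\<bar> / norm (y - x0) powr s)
                   / norm (y - x0) powr (real DIM('a) + s)) \<partial>lebesgue))"

definition essinf_on :: "'a::euclidean_space set \<Rightarrow> ('a \<Rightarrow> real) \<Rightarrow> ereal" where
  "essinf_on A u = - esssup (restrict_space lebesgue A) (\<lambda>x. ereal (- u x))"

text \<open>\<open>f\<^sup>\<epsilon>\<close> as a function on \<open>[0,\<infinity>]\<close>, with value \<open>\<infinity>\<close> at \<open>\<infinity>\<close>.\<close>

definition fpow :: "(real \<Rightarrow> real) \<Rightarrow> real \<Rightarrow> ennreal \<Rightarrow> ennreal" where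
  "fpow f \<epsilon> t = (if t = \<infinity> then \<infinity> else ennreal (f (enn2real t) powr \<epsilon>))"

end

theory Submission
  imports Defs
begin

text \<open>
  Write $\Psi(t) = \min(t^p, t^q)$, so that $f(\lambda t) \ge \Psi(\lambda) f(t)$. Dividing the De Giorgi
  inequality by $f(k/R^s)$ removes $f$ and leaves bounds for a $\Psi$-energy of $(u-k)_-/k$ and for a
  cross term. The difference quotients satisfy $L(z) \le n L(z/n)$ for
  $L(z) = \int |w(x+z)-w(x)|\,dx$ on a convex set; summing this over dyadic scales with the weight
  $(1-s)N^{-m(1-s)q}$ bounds $L$ at one scale by the energy, uniformly as $s \to 1$. This single
  estimate replaces the Sobolev and isoperimetric inequalities. It gives the De Giorgi iteration; the
  shrinking of $\{u < 2^{-J}M\}$, by applying it to the truncated logarithm of $u$, whose energy over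
  $J$ levels is $O(J)$ while its jumps are controlled by the cross terms (here $p>1$ enters); and the
  clustering of $\{u \ge M\}$ in some ball whose radius is a power of the density $\sigma$ of that set.
  Propagating positivity from this ball along a chain of growing balls costs a fixed factor per step,
  hence $u \ge c\,\sigma^N M$ in the half ball unless the tail dominates. This polynomial dependence on
  $\sigma$ is a decay estimate for the distribution function of $u$, which is then integrated.
\<close>

section \<open>Increments and energies\<close>

text \<open>The class gives inequalities for single truncations only: no equation can be tested with
  a negative power of \<open>u\<close>, so the logarithmic estimate is assembled from levels, pair
  of values by pair of values. \<open>f\<close> need not be homogeneous; each level k is therefore
  normalised by its own f(k/R^s). Constants may see s only through s0: the weights over the scales
  sum to at least 1/((1-s) q ln N), which is what the factor 1-s of the energy compensates. Since
  \<open>u\<close> is nonnegative in one ball only, a level is usable in a subball only if it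
  dominates the tail there, and close to the boundary this costs a power of the distance. All
  centres hence stay at a distance proportional to \<sigma> R from the boundary, and every loss
  (clustering radius, number of propagation steps, tail) is a power of \<sigma>. The outcome is a
  weak type bound: {u/R^s \<ge> t} has density at most C (m/t)^(1/N), with m the larger of infimum
  and tail; \<epsilon> is chosen with \<epsilon> q at most half of 1/N.\<close>

definition Psi :: "real \<Rightarrow> real \<Rightarrow> real \<Rightarrow> real" where
  "Psi p q t = min (t powr p) (t powr q)"

lemma Psi_nonneg [simp]: "0 \<le> Psi p q t"
  by (simp add: Psi_def)

lemma Psi_0 [simp]: "Psi p q 0 = 0"
  by (simp add: Psi_def)

lemma Psi_pos: "0 < t \<Longrightarrow> 0 < Psi p q t"
  by (simp add: Psi_def)

lemma Psi_1 [simp]: "Psi p q 1 = 1"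
  by (simp add: Psi_def)

lemma borel_measurable_Psi [measurable]: "Psi p q \<in> borel_measurable borel"
  unfolding Psi_def[abs_def] by measurable

lemma Psi_mono: "0 \<le> a \<Longrightarrow> a \<le> b \<Longrightarrow> 0 \<le> p \<Longrightarrow> 0 \<le> q \<Longrightarrow> Psi p q a \<le> Psi p q b"
  unfolding Psi_def by (intro min.mono powr_mono2) auto

lemma Psi_mult: "0 \<le> a \<Longrightarrow> 0 \<le> b \<Longrightarrow> Psi p q a * Psi p q b \<le> Psi p q (a * b)"
  unfolding Psi_def by (auto simp: powr_mult intro!: mult_mono)

lemma Psi_le_1: "0 \<le> a \<Longrightarrow> a \<le> 1 \<Longrightarrow> p \<le> q \<Longrightarrow> Psi p q a = a powr q"
  unfolding Psi_def
  by (cases "a = 0") (auto simp: min_def intro: powr_mono' antisym)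

lemma Psi_ge_1: "1 \<le> a \<Longrightarrow> p \<le> q \<Longrightarrow> Psi p q a = a powr p"
  unfolding Psi_def by (auto simp: min_def intro: powr_mono antisym)

text \<open>A Young-type inequality: above \<delta> the quotient \<open>Psi p q t / t\<close> is
  \<open>Psi (p - 1) (q - 1) t\<close>, which is monotone because the exponents are at least 1. It
  trades a linear quantity for energy plus a small constant.\<close>

lemma le_Psi:
  assumes "1 \<le> p" "1 \<le> q" "0 < \<delta>" "0 \<le> t"
  shows "t \<le> \<delta> + Psi p q t / Psi (p - 1) (q - 1) \<delta>"
proof (cases "t \<le> \<delta>")
  case True
  then show ?thesis by (simp add: add_increasing2)
next
  case False
  have pos: "0 < Psi (p - 1) (q - 1) \<delta>" using assms by (intro Psi_pos)
  have "Psi p q t = t * Psi (p - 1) (q - 1) t"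
    using False assms unfolding Psi_def
    by (auto simp: powr_diff min_def field_simps)
  moreover have "Psi (p - 1) (q - 1) \<delta> \<le> Psi (p - 1) (q - 1) t"
    using False assms by (intro Psi_mono) auto
  ultimately have "t * Psi (p - 1) (q - 1) \<delta> \<le> Psi p q t"
    using assms by (simp add: mult_left_mono)
  then have "t \<le> Psi p q t / Psi (p - 1) (q - 1) \<delta>"
    using pos by (simp add: field_simps)
  then show ?thesis using assms by simp
qed

lemma nn_integral_lborel_translate:
  fixes a :: "'a::euclidean_space"
  assumes "f \<in> borel_measurable borel"
  shows "(\<integral>\<^sup>+x. f (a + x) \<partial>lborel) = (\<integral>\<^sup>+x. f x \<partial>lborel)"
  using assms by (subst (2) lborel_distr_plus[of a, symmetric]) (simp add: nn_integral_distr)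

lemma nn_integral_lborel_scale:
  fixes f :: "'a::euclidean_space \<Rightarrow> ennreal"
  assumes "f \<in> borel_measurable borel" "0 < c"
  shows "(\<integral>\<^sup>+x. f x \<partial>lborel) = ennreal (c ^ DIM('a)) * (\<integral>\<^sup>+x. f (c *\<^sub>R x) \<partial>lborel)"
  using assms
  by (subst lborel_affine[of c 0])
     (simp_all add: nn_integral_density nn_integral_distr nn_integral_cmult)

section \<open>Integrated increments and their control by the energy\<close>

definition incr :: "'a::euclidean_space set \<Rightarrow> ('a \<Rightarrow> real) \<Rightarrow> 'a \<Rightarrow> ennreal" where
  "incr G w z = (\<integral>\<^sup>+x. indicator G x * indicator G (z + x) * ennreal \<bar>w (z + x) - w x\<bar> \<partial>lborel)"

definition Psi_incr ::
  "real \<Rightarrow> real \<Rightarrow> real \<Rightarrow> real \<Rightarrow> 'a::euclidean_space set \<Rightarrow> ('a \<Rightarrow> real) \<Rightarrow> 'a \<Rightarrow> ennreal" where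
  "Psi_incr p q s R G w z = (\<integral>\<^sup>+x. indicator G x * indicator G (z + x) *
     ennreal (Psi p q (\<bar>w (z + x) - w x\<bar> * (R / norm z) powr s)) \<partial>lborel)"

text \<open>The shape of \<open>modular_W\<close> after division by f(k/R^s). The ratio R/|x-y| is
  dimensionless, so bounds for the energy carry no power of R except the volume.\<close>

definition energy ::
  "real \<Rightarrow> real \<Rightarrow> real \<Rightarrow> real \<Rightarrow> 'a::euclidean_space set \<Rightarrow> ('a \<Rightarrow> real) \<Rightarrow> ennreal" where
  "energy p q s R G w = ennreal (1 - s) * (\<integral>\<^sup>+x. (\<integral>\<^sup>+y. indicator G x * indicator G y *
     ennreal (Psi p q (\<bar>w x - w y\<bar> * (R / norm (x - y)) powr s) / norm (x - y) ^ DIM('a)) \<partial>lborel) \<partial>lborel)"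

text \<open>Half-open, so that its dilates by N^(-m) are pairwise disjoint.\<close>

definition shell :: "nat \<Rightarrow> real \<Rightarrow> 'a::euclidean_space set" where
  "shell N h = {z. h / N \<le> norm z \<and> norm z < h}"

lemma sets_shell [measurable]: "shell N h \<in> sets borel"
  unfolding shell_def by measurable

lemma shell_norm_pos:
  assumes "z \<in> shell N h" "0 < h" "0 < N"
  shows "0 < norm z"
proof -
  have "0 < h / real N" using assms by simp
  then show ?thesis using assms(1) unfolding shell_def by (auto intro: less_le_trans)
qed

text \<open>Walk from x to z + x in n equal steps. Convexity keeps the intermediate points in
  \<open>G\<close>, and by translation invariance each step contributes at most the increment for
  z/n.\<close>

lemma incr_le_scale:
  fixes G :: "'a::euclidean_space set"
  assumes [measurable]: "G \<in> sets borel" "w \<in> borel_measurable borel" and "convex G" "0 < n"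
  shows "incr G w z \<le> of_nat n * incr G w ((1 / real n) *\<^sub>R z)"
proof -
  define d where "d = (1 / real n) *\<^sub>R z"
  define t where "t = (\<lambda>x. indicator G x * indicator G (d + x) * ennreal \<bar>w (d + x) - w x\<bar>)"
  have [measurable]: "t \<in> borel_measurable borel" unfolding t_def by measurable
  have nd: "real n *\<^sub>R d = z" using assms by (simp add: d_def)
  have "indicator G x * indicator G (z + x) * ennreal \<bar>w (z + x) - w x\<bar>
      \<le> (\<Sum>i<n. t (real i *\<^sub>R d + x))" for x
  proof (cases "x \<in> G \<and> z + x \<in> G")
    case True
    have inG: "real i *\<^sub>R d + x \<in> G" if "i \<le> n" for i
    proof -
      have "(1 - i / n) *\<^sub>R x + (i / n) *\<^sub>R (z + x) \<in> G"
        using True that assms by (intro convexD) auto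
      moreover have "(1 - i / n) *\<^sub>R x + (i / n) *\<^sub>R (z + x) = real i *\<^sub>R d + x"
        by (simp add: d_def algebra_simps)
      ultimately show ?thesis by simp
    qed
    have "w (z + x) - w x = (\<Sum>i<n. w (real (Suc i) *\<^sub>R d + x) - w (real i *\<^sub>R d + x))"
      by (subst sum_lessThan_telescope) (simp add: nd)
    then have "\<bar>w (z + x) - w x\<bar> \<le> (\<Sum>i<n. \<bar>w (real (Suc i) *\<^sub>R d + x) - w (real i *\<^sub>R d + x)\<bar>)"
      by simp
    then have "ennreal \<bar>w (z + x) - w x\<bar>
        \<le> (\<Sum>i<n. ennreal \<bar>w (real (Suc i) *\<^sub>R d + x) - w (real i *\<^sub>R d + x)\<bar>)"
      by (simp add: sum_ennreal ennreal_leI)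
    also have "\<dots> = (\<Sum>i<n. t (real i *\<^sub>R d + x))"
    proof (intro sum.cong refl)
      fix i assume "i \<in> {..<n}"
      moreover have eq: "d + (real i *\<^sub>R d + x) = real (Suc i) *\<^sub>R d + x"
        by (simp add: algebra_simps)
      ultimately show "ennreal \<bar>w (real (Suc i) *\<^sub>R d + x) - w (real i *\<^sub>R d + x)\<bar> = t (real i *\<^sub>R d + x)"
        using inG[of i] inG[of "Suc i"] unfolding t_def eq by (simp del: of_nat_Suc)
    qed
    finally show ?thesis using True by simp
  qed auto
  then have "incr G w z \<le> (\<integral>\<^sup>+x. (\<Sum>i<n. t (real i *\<^sub>R d + x)) \<partial>lborel)"
    unfolding incr_def by (intro nn_integral_mono)
  also have "\<dots> = (\<Sum>i<n. (\<integral>\<^sup>+x. t (real i *\<^sub>R d + x) \<partial>lborel))"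
    by (rule nn_integral_sum) measurable
  also have "\<dots> = of_nat n * incr G w d"
    by (subst nn_integral_lborel_translate) (measurable, simp add: incr_def t_def)
  finally show ?thesis by (simp add: d_def)
qed

lemma borel_measurable_incr [measurable]:
  fixes G :: "'a::euclidean_space set"
  assumes [measurable]: "G \<in> sets borel" "w \<in> borel_measurable borel"
  shows "incr G w \<in> borel_measurable borel"
  unfolding incr_def[abs_def] by measurable

lemma borel_measurable_Psi_incr [measurable]:
  fixes G :: "'a::euclidean_space set"
  assumes [measurable]: "G \<in> sets borel" "w \<in> borel_measurable borel"
  shows "Psi_incr p q s R G w \<in> borel_measurable borel"
  unfolding Psi_incr_def[abs_def] by measurable

text \<open>\<open>le_Psi\<close> under the integral. The constant \<delta> is charged only where
  the difference is nonzero, hence where one of the two points lies in the support of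
  \<open>w\<close>; so the error is proportional to the measure of the support, as the De Giorgi
  iteration requires.\<close>

lemma incr_le_Psi_incr:
  fixes G :: "'a::euclidean_space set"
  assumes [measurable]: "G \<in> sets borel" "w \<in> borel_measurable borel"
    and "1 \<le> p" "1 \<le> q" "0 < \<delta>"
  shows "ennreal ((R / norm z) powr s) * incr G w z
    \<le> ennreal (2 * \<delta>) * emeasure lborel {x \<in> G. w x \<noteq> 0}
      + ennreal (1 / Psi (p - 1) (q - 1) \<delta>) * Psi_incr p q s R G w z"
proof -
  define S where "S = {x \<in> G. w x \<noteq> 0}"
  have [measurable]: "S \<in> sets borel" unfolding S_def by measurable
  let ?r = "(R / norm z) powr s" and ?g = "Psi (p - 1) (q - 1) \<delta>"
  have "ennreal ?r * (indicator G x * indicator G (z + x) * ennreal \<bar>w (z + x) - w x\<bar>)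
     \<le> ennreal \<delta> * indicator S (z + x) + ennreal \<delta> * indicator S x + ennreal (1 / ?g) * (indicator G x * indicator G (z + x) *
     ennreal (Psi p q (\<bar>w (z + x) - w x\<bar> * ?r)))" for x
  proof (cases "x \<in> G \<and> z + x \<in> G \<and> w (z + x) \<noteq> w x")
    case True
    have "ennreal ?r * ennreal \<bar>w (z + x) - w x\<bar> = ennreal (\<bar>w (z + x) - w x\<bar> * ?r)"
      by (simp add: ennreal_mult[symmetric] mult.commute)
    also have "\<dots> \<le> ennreal (\<delta> + Psi p q (\<bar>w (z + x) - w x\<bar> * ?r) / ?g)"
      using assms by (intro ennreal_leI le_Psi) auto
    also have "\<dots> = ennreal \<delta> + ennreal (1 / ?g) * ennreal (Psi p q (\<bar>w (z + x) - w x\<bar> * ?r))"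
      using assms by (subst ennreal_plus) (auto simp: ennreal_mult[symmetric])
    also have "ennreal \<delta> \<le> ennreal \<delta> * indicator S (z + x) + ennreal \<delta> * indicator S x"
      using True by (auto simp: S_def indicator_def)
    finally show ?thesis using True by (simp add: add_right_mono)
  qed auto
  then have "(\<integral>\<^sup>+x. ennreal ?r * (indicator G x * indicator G (z + x) * ennreal \<bar>w (z + x) - w x\<bar>) \<partial>lborel)
     \<le> (\<integral>\<^sup>+x. ennreal \<delta> * indicator S (z + x) + ennreal \<delta> * indicator S x + ennreal (1 / ?g) * (indicator G x * indicator G (z + x) *
     ennreal (Psi p q (\<bar>w (z + x) - w x\<bar> * ?r))) \<partial>lborel)"
    by (intro nn_integral_mono)
  also have "\<dots> = ennreal \<delta> * (\<integral>\<^sup>+x. indicator S (z + x) \<partial>lborel) + ennreal \<delta> * emeasure lborel S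
     + ennreal (1 / ?g) * Psi_incr p q s R G w z"
    unfolding Psi_incr_def
    by (subst nn_integral_add, measurable)+ (simp add: nn_integral_cmult)
  also have "(\<integral>\<^sup>+x. indicator S (z + x) \<partial>lborel) = emeasure lborel S"
    by (subst nn_integral_lborel_translate[where f = "indicator S"]) auto
  also have "ennreal \<delta> * emeasure lborel S + ennreal \<delta> * emeasure lborel S = ennreal (2 * \<delta>) * emeasure lborel S"
    using assms by (simp add: distrib_right[symmetric] ennreal_plus[symmetric] del: ennreal_plus)
  finally show ?thesis
    unfolding incr_def S_def by (simp add: nn_integral_cmult)
qed

text \<open>Every scale z/N^m bounds the increment at z. A weighted average of these bounds uses all
  scales at once, and the weights decay so slowly as s tends to 1 that dividing by their sum
  produces the factor 1-s.\<close>

lemma incr_le_sum_Psi_incr: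
  fixes G :: "'a::euclidean_space set"
  assumes [measurable]: "G \<in> sets borel" "w \<in> borel_measurable borel"
    and "convex G" "1 \<le> p" "p \<le> q" "0 < \<delta>" "2 \<le> N" "0 < s" "s < 1" "0 < R" "z \<noteq> 0"
  shows "ennreal ((R / norm z) powr s) * incr G w z
    \<le> ennreal (2 * \<delta>) * emeasure lborel {x \<in> G. w x \<noteq> 0}
      + ennreal (q * ln N / Psi (p - 1) (q - 1) \<delta>) *
        (ennreal (1 - s) * (\<Sum>m. Psi_incr p q s R G w ((1 / real N ^ m) *\<^sub>R z)))"
proof -
  let ?X = "ennreal ((R / norm z) powr s) * incr G w z"
  let ?A = "emeasure lborel {x \<in> G. w x \<noteq> 0}"
  let ?g = "Psi (p - 1) (q - 1) \<delta>"
  let ?H = "\<lambda>m. Psi_incr p q s R G w ((1 / real N ^ m) *\<^sub>R z)"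
  \<comment> \<open>The weight of scale m is \<rho>^m = a^q, with a as in the step below; it cancels
    the factor a^(-q) that the energy term picks up there.\<close>
  define \<rho> where "\<rho> = real N powr (- (1 - s) * q)"
  have N: "1 < real N" using assms by simp
  have g: "0 < ?g" using assms by (intro Psi_pos)
  have \<rho>: "0 < \<rho>" "\<rho> < 1"
    using N assms by (auto simp: \<rho>_def intro!: powr_less_one mult_neg_pos)
  have step: "ennreal (\<rho> ^ m) * ?X \<le> ennreal (\<rho> ^ m) * (ennreal (2 * \<delta>) * ?A) + ennreal (1 / ?g) * ?H m" for m
  proof -
    \<comment> \<open>1/a = N^(m(1-s)) is the loss in passing to scale m: N^m from the subdivision
      against N^(-ms) from the kernel.\<close>
    define a where "a = real N powr (- (1 - s) * m)"
    let ?z = "(1 / real N ^ m) *\<^sub>R z"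
    have a: "0 < a" "a \<le> 1"
      using N assms powr_mono[of "- (1 - s) * m" 0 "real N"]
      by (auto simp: a_def mult_nonpos_nonneg)
    have \<rho>m: "\<rho> ^ m = a powr q"
      using N by (simp add: \<rho>_def a_def powr_powr powr_power mult_ac)
    have Xm: "?X \<le> ennreal (1 / a) * (ennreal ((R / norm ?z) powr s) * incr G w ?z)"
    proof -
      have "incr G w z \<le> of_nat (N ^ m) * incr G w ?z"
        using incr_le_scale[of G w "N ^ m" z] assms by simp
      then have "?X \<le> ennreal ((R / norm z) powr s) * (of_nat (N ^ m) * incr G w ?z)"
        by (rule mult_left_mono) simp
      also have "of_nat (N ^ m) = ennreal (real N ^ m)"
        by (simp add: ennreal_of_nat_eq_real_of_nat[of "N ^ m"] del: of_nat_power)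
      also have "ennreal ((R / norm z) powr s) * (ennreal (real N ^ m) * incr G w ?z)
        = ennreal ((R / norm z) powr s * real N ^ m) * incr G w ?z"
        by (simp add: ennreal_mult mult.assoc)
      also have "(R / norm z) powr s * real N ^ m = 1 / a * (R / norm ?z) powr s"
      proof -
        have "R / norm ?z = R / norm z * real N ^ m" using N by (simp add: power_divide)
        then have "(R / norm ?z) powr s = (R / norm z) powr s * (real N ^ m) powr s"
          using assms powr_mult[of "R / norm z" "real N ^ m" s] by simp
        moreover have "(real N ^ m) powr s = real N powr (m * s)"
          using N by (simp add: powr_realpow[symmetric] powr_powr mult.commute)
        moreover have "1 / a = real N powr ((1 - s) * m)"
          by (simp add: a_def divide_inverse powr_minus[symmetric] algebra_simps)
        moreover have "real N ^ m = real N powr ((1 - s) * m) * real N powr (m * s)"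
          using N by (simp add: powr_realpow[symmetric] powr_add[symmetric] algebra_simps)
        ultimately show ?thesis by simp
      qed
      also have "ennreal (1 / a * (R / norm ?z) powr s) * incr G w ?z
          = ennreal (1 / a) * (ennreal ((R / norm ?z) powr s) * incr G w ?z)"
        using a by (subst ennreal_mult) (simp, simp, simp only: mult.assoc)
      finally show ?thesis .
    qed
    \<comment> \<open>The Young parameter is \<delta> a rather than \<delta>: multiplied by the loss
      1/a, the measure term returns to 2 \<delta> at every scale.\<close>
    have "ennreal ((R / norm ?z) powr s) * incr G w ?z
       \<le> ennreal (2 * (\<delta> * a)) * ?A + ennreal (1 / Psi (p - 1) (q - 1) (\<delta> * a)) * ?H m"
      using assms a by (intro incr_le_Psi_incr) auto
    also have "\<dots> \<le> ennreal (2 * (\<delta> * a)) * ?A + ennreal (1 / (?g * a powr (q - 1))) * ?H m"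
    proof -
      have "?g * a powr (q - 1) \<le> Psi (p - 1) (q - 1) (\<delta> * a)"
        using Psi_mult[of \<delta> a "p - 1" "q - 1"] Psi_le_1[of a "p - 1" "q - 1"] a assms by simp
      then have "1 / Psi (p - 1) (q - 1) (\<delta> * a) \<le> 1 / (?g * a powr (q - 1))"
        using g a by (intro divide_left_mono mult_pos_pos Psi_pos) (auto simp: assms)
      then show ?thesis by (intro add_left_mono mult_right_mono ennreal_leI) auto
    qed
    finally have Y: "ennreal ((R / norm ?z) powr s) * incr G w ?z \<le> \<dots>" .
    have "?X \<le> ennreal (1 / a) * (ennreal (2 * (\<delta> * a)) * ?A + ennreal (1 / (?g * a powr (q - 1))) * ?H m)"
      using Xm mult_left_mono[OF Y, of "ennreal (1 / a)"] by (auto intro: order_trans)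
    also have "\<dots> = ennreal (2 * \<delta>) * ?A + ennreal (1 / (?g * a powr q)) * ?H m"
    proof -
      have "1 / a * (1 / (?g * a powr (q - 1))) = 1 / (?g * a powr q)"
        using a by (simp add: powr_diff)
      then have "ennreal (1 / a) * ennreal (1 / (?g * a powr (q - 1))) = ennreal (1 / (?g * a powr q))"
        using a g by (subst ennreal_mult[symmetric]) auto
      moreover have "ennreal (1 / a) * ennreal (2 * (\<delta> * a)) = ennreal (2 * \<delta>)"
        using a assms by (subst ennreal_mult[symmetric]) auto
      ultimately show ?thesis
        by (simp only: distrib_left mult.assoc[symmetric])
    qed
    finally have Z: "ennreal (\<rho> ^ m) * ?X \<le> ennreal (\<rho> ^ m) * (ennreal (2 * \<delta>) * ?A + ennreal (1 / (?g * a powr q)) * ?H m)"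
      by (rule mult_left_mono) simp
    have "ennreal (\<rho> ^ m) * (ennreal (1 / (?g * a powr q)) * ?H m) = ennreal (1 / ?g) * ?H m"
      using a g by (simp add: \<rho>m mult.assoc[symmetric] ennreal_mult[symmetric])
    with Z show ?thesis by (simp only: distrib_left)
  qed
  have sum\<rho>: "(\<Sum>m. ennreal (\<rho> ^ m)) = ennreal (1 / (1 - \<rho>))"
    using \<rho> by (intro suminf_ennreal_eq geometric_sums) auto
  have "ennreal (1 / (1 - \<rho>)) * ?X = (\<Sum>m. ennreal (\<rho> ^ m) * ?X)"
    by (simp add: sum\<rho>[symmetric])
  also have "\<dots> \<le> (\<Sum>m. ennreal (\<rho> ^ m) * (ennreal (2 * \<delta>) * ?A) + ennreal (1 / ?g) * ?H m)"
    by (intro suminf_le step) auto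
  also have "\<dots> = ennreal (1 / (1 - \<rho>)) * (ennreal (2 * \<delta>) * ?A) + ennreal (1 / ?g) * (\<Sum>m. ?H m)"
    by (subst suminf_add[symmetric]) (auto simp: sum\<rho>[symmetric])
  finally have "ennreal (1 - \<rho>) * (ennreal (1 / (1 - \<rho>)) * ?X)
     \<le> ennreal (1 - \<rho>) * (ennreal (1 / (1 - \<rho>)) * (ennreal (2 * \<delta>) * ?A) + ennreal (1 / ?g) * (\<Sum>m. ?H m))"
    by (rule mult_left_mono) simp
  then have X: "?X \<le> ennreal (2 * \<delta>) * ?A + ennreal ((1 - \<rho>) / ?g) * (\<Sum>m. ?H m)"
    using \<rho> g by (simp add: distrib_left mult.assoc[symmetric] ennreal_mult[symmetric])
  \<comment> \<open>From 1 - exp(-x) \<le> x. The factor 1-s of the energy appears here with a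
    constant that does not degenerate as s tends to 1.\<close>
  have "ennreal ((1 - \<rho>) / ?g) \<le> ennreal (q * ln N / ?g * (1 - s))"
  proof -
    have "1 - \<rho> \<le> (1 - s) * q * ln N"
      using exp_ge_add_one_self[of "(s - 1) * q * ln N"] N
      by (simp add: \<rho>_def powr_def algebra_simps)
    then have "(1 - \<rho>) / ?g \<le> (1 - s) * q * ln N / ?g"
      using g by (intro divide_right_mono) auto
    then show ?thesis by (intro ennreal_leI) (simp add: mult_ac)
  qed
  then have "?X \<le> ennreal (2 * \<delta>) * ?A + ennreal (q * ln N / ?g * (1 - s)) * (\<Sum>m. ?H m)"
    using X by (meson add_left_mono mult_right_mono order_trans zero_le)
  also have "ennreal (q * ln N / ?g * (1 - s)) = ennreal (q * ln N / ?g) * ennreal (1 - s)"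
    using N assms g by (intro ennreal_mult) auto
  finally show ?thesis by (simp only: mult.assoc)
qed

lemma Psi_incr_eq_energy:
  fixes G :: "'a::euclidean_space set"
  assumes [measurable]: "G \<in> sets borel" "w \<in> borel_measurable borel"
  shows "ennreal (1 - s) * (\<integral>\<^sup>+z. Psi_incr p q s R G w z * ennreal (1 / norm z ^ DIM('a)) \<partial>lborel)
    = energy p q s R G w"
proof -
  have "(\<integral>\<^sup>+z. Psi_incr p q s R G w z * ennreal (1 / norm z ^ DIM('a)) \<partial>lborel)
    = (\<integral>\<^sup>+z. (\<integral>\<^sup>+x. indicator G x * indicator G (z + x) *
       ennreal (Psi p q (\<bar>w (z + x) - w x\<bar> * (R / norm z) powr s) / norm z ^ DIM('a)) \<partial>lborel) \<partial>lborel)"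
    unfolding Psi_incr_def
    by (subst nn_integral_multc[symmetric], measurable)
       (simp add: mult.assoc ennreal_mult'[symmetric])
  also have "\<dots> = (\<integral>\<^sup>+x. (\<integral>\<^sup>+z. indicator G x * indicator G (z + x) *
       ennreal (Psi p q (\<bar>w (z + x) - w x\<bar> * (R / norm z) powr s) / norm z ^ DIM('a)) \<partial>lborel) \<partial>lborel)"
    by (rule lborel_pair.Fubini') measurable
  also have "\<dots> = (\<integral>\<^sup>+x. (\<integral>\<^sup>+y. indicator G x * indicator G y *
       ennreal (Psi p q (\<bar>w y - w x\<bar> * (R / norm (y - x)) powr s) / norm (y - x) ^ DIM('a)) \<partial>lborel) \<partial>lborel)"
  proof (rule nn_integral_cong)
    fix x :: 'a
    let ?f = "\<lambda>y. indicator G x * indicator G y *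
       ennreal (Psi p q (\<bar>w y - w x\<bar> * (R / norm (y - x)) powr s) / norm (y - x) ^ DIM('a))"
    have "(\<integral>\<^sup>+z. ?f (x + z) \<partial>lborel) = (\<integral>\<^sup>+y. ?f y \<partial>lborel)"
      by (rule nn_integral_lborel_translate) measurable
    then show "(\<integral>\<^sup>+z. indicator G x * indicator G (z + x) *
       ennreal (Psi p q (\<bar>w (z + x) - w x\<bar> * (R / norm z) powr s) / norm z ^ DIM('a)) \<partial>lborel)
       = (\<integral>\<^sup>+y. indicator G x * indicator G y *
       ennreal (Psi p q (\<bar>w y - w x\<bar> * (R / norm (y - x)) powr s) / norm (y - x) ^ DIM('a)) \<partial>lborel)"
      by (simp add: add.commute)
  qed
  finally show ?thesis
    by (simp add: energy_def norm_minus_commute abs_minus_commute)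
qed

text \<open>The measure dz/|z|^d is invariant under dilations, so the m-th term is an integral over
  the m-th dilated shell; these are disjoint and together cost at most the full integral. The factor
  h^d bounds |z|^d on the original shell.\<close>

lemma Psi_incr_shell_scale:
  fixes G :: "'a::euclidean_space set"
  assumes [measurable]: "G \<in> sets borel" "w \<in> borel_measurable borel" and "2 \<le> N" "0 < h"
  shows "(\<integral>\<^sup>+z\<in>shell N h. (\<Sum>m. Psi_incr p q s R G w ((1 / real N ^ m) *\<^sub>R z)) \<partial>lborel)
    \<le> ennreal (h ^ DIM('a)) * (\<integral>\<^sup>+z. Psi_incr p q s R G w z * ennreal (1 / norm z ^ DIM('a)) \<partial>lborel)"
proof -
  let ?H = "Psi_incr p q s R G w"
  have N: "1 < real N" using assms by simp
  define sh :: "nat \<Rightarrow> 'a set" where "sh m = {z. h / N ^ Suc m \<le> norm z \<and> norm z < h / N ^ m}" for m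
  have [measurable]: "sh m \<in> sets borel" for m unfolding sh_def by measurable
  have disj: "(\<Sum>m. indicator (sh m) z) \<le> (1::ennreal)" for z
  proof -
    have "disjoint_family sh"
      unfolding disjoint_family_on_def
    proof (intro ballI impI)
      have aux: "sh m \<inter> sh n = {}" if "m < n" for m n
      proof -
        have "h / N ^ n \<le> h / N ^ Suc m"
          using power_increasing[of "Suc m" n "real N"] that N assms
          by (intro divide_left_mono) (auto simp del: power_Suc)
        then show ?thesis unfolding sh_def by fastforce
      qed
      fix m n :: nat assume "m \<noteq> n"
      then show "sh m \<inter> sh n = {}" using aux[of m n] aux[of n m] by (metis Int_commute linorder_neqE_nat)
    qed
    then have "(\<Sum>m. indicator (sh m) z) = (indicator (\<Union>m. sh m) z :: ennreal)"
      by (rule suminf_indicator)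
    then show ?thesis by (simp add: indicator_def)
  qed
  have one: "(\<integral>\<^sup>+z\<in>shell N h. ?H ((1 / real N ^ m) *\<^sub>R z) \<partial>lborel)
     \<le> ennreal (h ^ DIM('a)) * (\<integral>\<^sup>+z. indicator (sh m) z * (?H z * ennreal (1 / norm z ^ DIM('a))) \<partial>lborel)" for m
  proof -
    let ?a = "1 / real N ^ m"
    let ?f = "\<lambda>z. indicator (sh m) z * (?H z * ennreal (1 / norm z ^ DIM('a)))"
    have a: "0 < ?a" using N by simp
    have "?H (?a *\<^sub>R z) * indicator (shell N h) z \<le> ennreal (h ^ DIM('a)) * (ennreal (?a ^ DIM('a)) * ?f (?a *\<^sub>R z))" for z :: 'a
    proof (cases "z \<in> shell N h")
      case True
      have nz: "norm z > 0" using True assms by (intro shell_norm_pos[of z N h]) auto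
      have in_sh: "?a *\<^sub>R z \<in> sh m"
        using True N by (auto simp: shell_def sh_def field_simps)
      have "1 \<le> h ^ DIM('a) * (?a ^ DIM('a) * (1 / norm (?a *\<^sub>R z) ^ DIM('a)))"
      proof -
        have "norm z ^ DIM('a) \<le> h ^ DIM('a)" using True by (intro power_mono) (auto simp: shell_def)
        then show ?thesis using nz N by (simp add: power_divide divide_simps)
      qed
      then have "?H (?a *\<^sub>R z) * 1 \<le> ?H (?a *\<^sub>R z) * ennreal (h ^ DIM('a) * (?a ^ DIM('a) * (1 / norm (?a *\<^sub>R z) ^ DIM('a))))"
        by (intro mult_left_mono) auto
      also have "\<dots> = ennreal (h ^ DIM('a)) * (ennreal (?a ^ DIM('a)) * ?f (?a *\<^sub>R z))"
        using in_sh assms a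
        by (subst ennreal_mult, simp, simp)+ (simp only: indicator_simps mult_1 mult_ac)
      finally show ?thesis using True by simp
    qed auto
    then have "(\<integral>\<^sup>+z\<in>shell N h. ?H (?a *\<^sub>R z) \<partial>lborel)
      \<le> (\<integral>\<^sup>+z. ennreal (h ^ DIM('a)) * (ennreal (?a ^ DIM('a)) * ?f (?a *\<^sub>R z)) \<partial>lborel)"
      by (intro nn_integral_mono)
    also have "\<dots> = ennreal (h ^ DIM('a)) * (ennreal (?a ^ DIM('a)) * (\<integral>\<^sup>+z. ?f (?a *\<^sub>R z) \<partial>lborel))"
      by (simp add: nn_integral_cmult)
    also have "ennreal (?a ^ DIM('a)) * (\<integral>\<^sup>+z. ?f (?a *\<^sub>R z) \<partial>lborel) = (\<integral>\<^sup>+z. ?f z \<partial>lborel)"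
      using a by (intro nn_integral_lborel_scale[symmetric]) measurable
    finally show ?thesis .
  qed
  have "(\<integral>\<^sup>+z\<in>shell N h. (\<Sum>m. ?H ((1 / real N ^ m) *\<^sub>R z)) \<partial>lborel)
     = (\<Sum>m. \<integral>\<^sup>+z\<in>shell N h. ?H ((1 / real N ^ m) *\<^sub>R z) \<partial>lborel)"
    by (subst nn_integral_suminf[symmetric]) (auto simp: ennreal_suminf_multc)
  also have "\<dots> \<le> (\<Sum>m. ennreal (h ^ DIM('a)) * (\<integral>\<^sup>+z. indicator (sh m) z * (?H z * ennreal (1 / norm z ^ DIM('a))) \<partial>lborel))"
    by (intro suminf_le one) auto
  also have "\<dots> = ennreal (h ^ DIM('a)) * (\<integral>\<^sup>+z. (\<Sum>m. indicator (sh m) z) * (?H z * ennreal (1 / norm z ^ DIM('a))) \<partial>lborel)"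
    by (subst ennreal_suminf_cmult) (simp add: nn_integral_suminf[symmetric] ennreal_suminf_multc)
  also have "\<dots> \<le> ennreal (h ^ DIM('a)) * (\<integral>\<^sup>+z. 1 * (?H z * ennreal (1 / norm z ^ DIM('a))) \<partial>lborel)"
    by (intro mult_left_mono nn_integral_mono mult_right_mono disj) auto
  finally show ?thesis by simp
qed

lemma emeasure_shell_le:
  "0 < h \<Longrightarrow> emeasure lborel (shell N h :: 'a::euclidean_space set) \<le> ennreal (unit_ball_vol (real DIM('a)) * h ^ DIM('a))"
  by (subst emeasure_ball[of h 0, symmetric]) (auto simp: shell_def intro!: emeasure_mono)

text \<open>Averaging over a shell turns the sum over the scales of one z into the whole energy.
  Both parameters stay free: the De Giorgi step and the clustering take \<delta> = 1 and N = 2,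
  while the shrinking of sublevel sets takes both large.\<close>

lemma incr_shell_le_energy:
  fixes G :: "'a::euclidean_space set"
  assumes [measurable]: "G \<in> sets borel" "w \<in> borel_measurable borel"
    and "convex G" "1 \<le> p" "p \<le> q" "0 < \<delta>" "2 \<le> N" "0 < s" "s < 1" "0 < R" "0 < h"
  shows "(\<integral>\<^sup>+z\<in>shell N h. incr G w z \<partial>lborel) \<le> ennreal (h ^ DIM('a) * (h / R) powr s) *
    (ennreal (2 * \<delta> * unit_ball_vol (real DIM('a))) * emeasure lborel {x \<in> G. w x \<noteq> 0}
      + ennreal (q * ln N / Psi (p - 1) (q - 1) \<delta>) * energy p q s R G w)"
proof -
  let ?X = "\<lambda>z. ennreal ((R / norm z) powr s) * incr G w z"
  let ?A = "emeasure lborel {x \<in> G. w x \<noteq> 0}"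
  let ?c = "ennreal (q * ln N / Psi (p - 1) (q - 1) \<delta>)"
  let ?V = "unit_ball_vol (real DIM('a))"
  let ?H = "\<lambda>z. \<Sum>m. Psi_incr p q s R G w ((1 / real N ^ m) *\<^sub>R z)"
  have N: "1 < real N" using assms by simp
  have nz: "norm z > 0" if "z \<in> shell N h" for z :: 'a
    using that assms by (intro shell_norm_pos[of z N h]) auto
  have "incr G w z * indicator (shell N h) z \<le> ennreal ((h / R) powr s) *
      ((ennreal (2 * \<delta>) * ?A + ?c * (ennreal (1 - s) * ?H z)) * indicator (shell N h) z)" for z
  proof (cases "z \<in> shell N h")
    case True
    have "1 \<le> (h / R) powr s * (R / norm z) powr s"
      using True nz[OF True] assms by (subst powr_mult[symmetric]) (auto simp: shell_def intro!: ge_one_powr_ge_zero)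
    then have "incr G w z * 1 \<le> incr G w z * ennreal ((h / R) powr s * (R / norm z) powr s)"
      by (intro mult_left_mono) auto
    also have "\<dots> = ennreal ((h / R) powr s) * ?X z"
      by (simp add: ennreal_mult mult_ac)
    also have "\<dots> \<le> ennreal ((h / R) powr s) * (ennreal (2 * \<delta>) * ?A + ?c * (ennreal (1 - s) * ?H z))"
      using nz[OF True] assms by (intro mult_left_mono incr_le_sum_Psi_incr) auto
    finally show ?thesis using True by simp
  qed auto
  then have "(\<integral>\<^sup>+z\<in>shell N h. incr G w z \<partial>lborel)
    \<le> (\<integral>\<^sup>+z. ennreal ((h / R) powr s) *
      ((ennreal (2 * \<delta>) * ?A + ?c * (ennreal (1 - s) * ?H z)) * indicator (shell N h) z) \<partial>lborel)"
    by (intro nn_integral_mono)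
  also have "\<dots> = ennreal ((h / R) powr s) * (ennreal (2 * \<delta>) * ?A * emeasure lborel (shell N h :: 'a set)
      + ?c * (ennreal (1 - s) * (\<integral>\<^sup>+z\<in>shell N h. ?H z \<partial>lborel)))"
    by (subst nn_integral_cmult, measurable)
       (simp add: distrib_right nn_integral_add nn_integral_cmult mult.assoc)
  also have "\<dots> \<le> ennreal ((h / R) powr s) * (ennreal (2 * \<delta>) * ?A * ennreal (?V * h ^ DIM('a))
      + ?c * (ennreal (1 - s) * (ennreal (h ^ DIM('a)) *
          (\<integral>\<^sup>+z. Psi_incr p q s R G w z * ennreal (1 / norm z ^ DIM('a)) \<partial>lborel))))"
    using assms by (intro mult_left_mono add_mono emeasure_shell_le Psi_incr_shell_scale) auto
  also have "\<dots> = ennreal (h ^ DIM('a) * (h / R) powr s) * (ennreal (2 * \<delta> * ?V) * ?A + ?c * energy p q s R G w)"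
  proof -
    have "energy p q s R G w = ennreal (1 - s) * (\<integral>\<^sup>+z. Psi_incr p q s R G w z * ennreal (1 / norm z ^ DIM('a)) \<partial>lborel)"
      by (rule Psi_incr_eq_energy[symmetric]) fact+
    then show ?thesis using assms by (simp add: ennreal_mult distrib_left mult_ac)
  qed
  finally show ?thesis .
qed

section \<open>De Giorgi iteration\<close>

text \<open>The mixed term of the De Giorgi inequality divided by f(k/R^s), after f'(t) has been
  bounded below by f(t)/t; this is the origin of the quotient of (u(x)-k)_- by (u(y)-k)_+. Only
  pairs inside \<open>G\<close> are kept, as in \<open>energy\<close>.\<close>

definition cross ::
  "real \<Rightarrow> real \<Rightarrow> real \<Rightarrow> real \<Rightarrow> 'a::euclidean_space set \<Rightarrow> ('a \<Rightarrow> real) \<Rightarrow> real \<Rightarrow> ennreal" where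
  "cross p q s R G u k = ennreal (1 - s) * (\<integral>\<^sup>+x. (\<integral>\<^sup>+y. indicator G x * indicator G y *
     (if k < u y then ennreal (Psi p q ((u y - k) / k * (R / norm (x - y)) powr s) *
        (max (k - u x) 0 / (u y - k)) / norm (x - y) ^ DIM('a)) else 0) \<partial>lborel) \<partial>lborel)"

text \<open>All that the iteration, the growth lemma and the propagation use about \<open>u\<close>
  at level \<open>k\<close>, free of \<open>f\<close> and of the tail. The bound is proportional to
  the measure of the sublevel set, and radii below R/2 are left out so that R alone fixes the
  scale.\<close>

definition caccioppoli ::
  "real \<Rightarrow> real \<Rightarrow> real \<Rightarrow> real \<Rightarrow> real \<Rightarrow> ('a::euclidean_space \<Rightarrow> real) \<Rightarrow> 'a \<Rightarrow> real \<Rightarrow> real \<Rightarrow> bool" where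
  "caccioppoli p q s \<Lambda> b u x0 R k \<longleftrightarrow> (\<forall>r r'. R / 2 \<le> r \<and> r < r' \<and> r' \<le> R \<longrightarrow>
     energy p q s R (ball x0 r) (\<lambda>x. max (k - u x) 0 / k)
       \<le> ennreal (\<Lambda> * (R / (r' - r)) powr b) * emeasure lborel {x \<in> ball x0 r'. u x < k} \<and>
     cross p q s R (ball x0 r) u k
       \<le> ennreal (\<Lambda> * (R / (r' - r)) powr b) * emeasure lborel {x \<in> ball x0 r'. u x < k})"

section \<open>Measures inside balls and lower bounds for averaged increments\<close>

lemma emeasure_in_ball:
  fixes S :: "'a::euclidean_space set"
  assumes "S \<subseteq> ball x r"
  shows "emeasure lborel S = ennreal (measure lborel S)"
proof -
  have "emeasure lborel S < \<infinity>"
    using assms bounded_subset[OF bounded_ball] by (intro emeasure_bounded_finite)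
  then show ?thesis by (intro emeasure_eq_ennreal_measure) auto
qed

lemma measure_mono_in_ball:
  fixes S :: "'a::euclidean_space set"
  assumes "S \<subseteq> T" "T \<subseteq> ball x r" "S \<in> sets borel" "T \<in> sets borel"
  shows "measure lborel S \<le> measure lborel T"
proof -
  have "emeasure lborel S \<le> emeasure lborel T" using assms by (intro emeasure_mono) auto
  then show ?thesis
    using emeasure_in_ball[of S x r] emeasure_in_ball[of T x r] assms by auto
qed

lemma shell_subset_ball: "shell N h \<subseteq> ball 0 h"
  by (auto simp: shell_def)

lemma measure_shell:
  assumes "0 < h" "0 < N"
  shows "measure lborel (shell N h :: 'a::euclidean_space set)
    = unit_ball_vol (real DIM('a)) * (h ^ DIM('a) - (h / N) ^ DIM('a))"
proof -
  have le: "h / N \<le> h" using assms by (simp add: divide_le_eq mult_le_cancel_left1)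
  have "shell N h = ball (0::'a) h - ball 0 (h / N)"
    by (auto simp: shell_def)
  also have "measure lborel \<dots> = measure lborel (ball (0::'a) h) - measure lborel (ball (0::'a) (h / N))"
    using le emeasure_in_ball[of "ball (0::'a) h" 0 h] by (intro measure_Diff) auto
  finally show ?thesis using assms by (simp add: content_ball right_diff_distrib)
qed

lemma measure_shell_2:
  assumes "0 < h"
  shows "unit_ball_vol (real DIM('a)) * h ^ DIM('a) / 2 \<le> measure lborel (shell 2 h :: 'a::euclidean_space set)"
proof -
  have "(h / 2) ^ DIM('a) \<le> h ^ DIM('a) / 2"
  proof -
    have "(1 / 2 :: real) ^ DIM('a) \<le> (1 / 2) ^ 1" by (intro power_decreasing) auto
    then have "h ^ DIM('a) * (1 / 2) ^ DIM('a) \<le> h ^ DIM('a) * (1 / 2)"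
      using assms by (intro mult_left_mono) auto
    then show ?thesis by (simp add: power_divide)
  qed
  then have "unit_ball_vol (real DIM('a)) * (h ^ DIM('a) / 2) \<le> unit_ball_vol (real DIM('a)) * (h ^ DIM('a) - (h / 2) ^ DIM('a))"
    by (intro mult_left_mono) (auto simp: unit_ball_vol_nonneg)
  then show ?thesis by (subst measure_shell) (auto simp: assms)
qed

text \<open>Fubini, integrating in z first. Every estimate of a sublevel or superlevel set below
  compares such a lower bound with \<open>incr_shell_le_energy\<close>.\<close>

lemma incr_shell_ge:
  fixes G :: "'a::euclidean_space set"
  assumes [measurable]: "G \<in> sets borel" "w \<in> borel_measurable borel" "Y \<in> sets borel" and "Y \<subseteq> G"
    and c: "\<And>x. x \<in> Y \<Longrightarrow> c \<le> (\<integral>\<^sup>+z\<in>shell N h. indicator G (z + x) * ennreal \<bar>w (z + x) - w x\<bar> \<partial>lborel)"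
  shows "c * emeasure lborel Y \<le> (\<integral>\<^sup>+z\<in>shell N h. incr G w z \<partial>lborel)"
proof -
  have "c * emeasure lborel Y = (\<integral>\<^sup>+x. c * indicator Y x \<partial>lborel)"
    by (simp add: nn_integral_cmult)
  also have "\<dots> \<le> (\<integral>\<^sup>+x. indicator G x * (\<integral>\<^sup>+z\<in>shell N h. indicator G (z + x) * ennreal \<bar>w (z + x) - w x\<bar> \<partial>lborel) \<partial>lborel)"
    using c \<open>Y \<subseteq> G\<close> by (intro nn_integral_mono) (auto simp: indicator_def)
  also have "\<dots> = (\<integral>\<^sup>+x. (\<integral>\<^sup>+z. indicator G x * indicator G (z + x) * ennreal \<bar>w (z + x) - w x\<bar> * indicator (shell N h) z \<partial>lborel) \<partial>lborel)"
    by (subst nn_integral_cmult[symmetric]) (auto simp: mult.assoc)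
  also have "\<dots> = (\<integral>\<^sup>+z. (\<integral>\<^sup>+x. indicator G x * indicator G (z + x) * ennreal \<bar>w (z + x) - w x\<bar> * indicator (shell N h) z \<partial>lborel) \<partial>lborel)"
    by (rule lborel_pair.Fubini') measurable
  also have "\<dots> = (\<integral>\<^sup>+z\<in>shell N h. incr G w z \<partial>lborel)"
    unfolding incr_def by (subst nn_integral_multc) auto
  finally show ?thesis .
qed

text \<open>At points of the smaller set w \<ge> \<theta>, whereas w vanishes off the sublevel set,
  whose measure A fills at most the fraction \<theta>/2 of a shell of radius \<rho>. Hence w drops
  on average by at least \<theta>/2 over the shell. The bound on \<rho> keeps the translates inside
  the ball of the middle radius (r0+r1)/2, and the other half of the gap is spent on the Caccioppoli
  inequality.\<close>

lemma degiorgi_step_at_scale: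
  fixes u :: "'a::euclidean_space \<Rightarrow> real"
  assumes [measurable]: "u \<in> borel_measurable borel"
    and par: "1 \<le> p" "p \<le> q" "0 < s" "s < 1" "0 \<le> \<Lambda>" "0 \<le> b"
    and "0 < R" "0 < k" and nn: "\<And>x. x \<in> ball x0 R \<Longrightarrow> 0 \<le> u x"
    and caccioppoli: "caccioppoli p q s \<Lambda> b u x0 R k"
    and r: "R / 2 \<le> r0" "r0 < r1" "r1 \<le> R" and \<theta>: "0 < \<theta>" "\<theta> < 1"
    and A: "A = measure lborel {x \<in> ball x0 r1. u x < k}"
    and \<rho>: "0 < \<rho>" "\<rho> \<le> (r1 - r0) / 2" "A \<le> \<theta> * unit_ball_vol (real DIM('a)) * \<rho> ^ DIM('a) / 4"
  shows "measure lborel {x \<in> ball x0 r0. u x < (1 - \<theta>) * k}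
    \<le> 4 * (2 * unit_ball_vol (real DIM('a)) + q * \<Lambda> * 2 powr b) / (unit_ball_vol (real DIM('a)) * \<theta>)
       * (\<rho> / R) powr s * (R / (r1 - r0)) powr b * A"
proof -
  let ?V = "unit_ball_vol (real DIM('a))"
  define r where "r = (r0 + r1) / 2"
  define G where "G = ball x0 r"
  define w where "w x = max (k - u x) 0 / k" for x
  define Y where "Y = {x \<in> ball x0 r0. u x < (1 - \<theta>) * k}"
  define S where "S = measure lborel (shell 2 \<rho> :: 'a set)"
  define T where "T = {x \<in> ball x0 r1. u x < k}"
  have [measurable]: "G \<in> sets borel" "w \<in> borel_measurable borel" "Y \<in> sets borel" "T \<in> sets borel"
    unfolding G_def w_def Y_def T_def by measurable
  have rr: "r0 < r" "r < r1" "r1 - r = (r1 - r0) / 2" using r by (auto simp: r_def field_simps)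
  have V: "0 < ?V" by simp
  have Apos: "0 \<le> A" by (simp add: A)
  have eT: "emeasure lborel T = ennreal A"
    unfolding A T_def by (rule emeasure_in_ball[of _ x0 r1]) auto
  have eY: "emeasure lborel Y = ennreal (measure lborel Y)"
    unfolding Y_def by (rule emeasure_in_ball[of _ x0 r0]) auto
  have eS: "emeasure lborel (shell 2 \<rho> :: 'a set) = ennreal S"
    unfolding S_def by (rule emeasure_in_ball[OF shell_subset_ball])
  have S: "?V * \<rho> ^ DIM('a) / 2 \<le> S" unfolding S_def using \<rho> by (intro measure_shell_2)
  have "\<theta> * (?V * \<rho> ^ DIM('a) / 2) \<le> \<theta> * S" using S \<theta> by (intro mult_left_mono) auto
  then have AS: "A \<le> \<theta> * S / 2" using \<rho> by simp
  let ?I = "\<integral>\<^sup>+z\<in>shell 2 \<rho>. incr G w z \<partial>lborel"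
  have low: "ennreal (\<theta> * S / 2) * emeasure lborel Y \<le> ?I"
  proof (rule incr_shell_ge)
    show "Y \<subseteq> G" using rr by (auto simp: Y_def G_def)
    fix x assume x: "x \<in> Y"
    let ?J = "\<integral>\<^sup>+z\<in>shell 2 \<rho>. indicator G (z + x) * ennreal \<bar>w (z + x) - w x\<bar> \<partial>lborel"
    have wx: "\<theta> \<le> w x" using x \<open>0 < k\<close> by (auto simp: Y_def w_def field_simps)
    have pt: "ennreal \<theta> * indicator (shell 2 \<rho>) z
       \<le> indicator G (z + x) * ennreal \<bar>w (z + x) - w x\<bar> * indicator (shell 2 \<rho>) z + indicator T (z + x)" for z
    proof (cases "z \<in> shell 2 \<rho>")
      case True
      have "dist x0 (z + x) \<le> dist x0 x + norm z"
        by (metis add.commute dist_norm dist_triangle2 norm_minus_commute add_diff_cancel_left' dist_commute dist_triangle)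
      then have in_G: "z + x \<in> G"
        using True x \<rho> r by (auto simp: shell_def Y_def G_def r_def field_simps)
      then have "0 \<le> u (z + x)" using rr r by (intro nn) (auto simp: G_def)
      \<comment> \<open>Nonnegativity of \<open>u\<close> enters here: it gives w \<le> 1 on the
        sublevel set.\<close>
      then have "w (z + x) \<le> (if z + x \<in> T then 1 else 0)"
        using in_G rr \<open>0 < k\<close> by (auto simp: w_def T_def G_def)
      moreover have "\<theta> \<le> \<bar>w (z + x) - w x\<bar> + w (z + x)" using wx by linarith
      ultimately have "ennreal \<theta> \<le> ennreal (\<bar>w (z + x) - w x\<bar> + (if z + x \<in> T then 1 else 0))"
        by (intro ennreal_leI) linarith
      also have "\<dots> = ennreal \<bar>w (z + x) - w x\<bar> + indicator T (z + x)"
        by (subst ennreal_plus) (auto simp: indicator_def)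
      finally show ?thesis using True in_G by simp
    qed auto
    have "ennreal \<theta> * ennreal S = (\<integral>\<^sup>+z. ennreal \<theta> * indicator (shell 2 \<rho> :: 'a set) z \<partial>lborel)"
      by (simp add: nn_integral_cmult eS)
    also have "\<dots> \<le> (\<integral>\<^sup>+z. indicator G (z + x) * ennreal \<bar>w (z + x) - w x\<bar> * indicator (shell 2 \<rho>) z + indicator T (x + z) \<partial>lborel)"
      using pt by (intro nn_integral_mono) (simp add: add.commute)
    also have "\<dots> = ?J + (\<integral>\<^sup>+z. indicator T (x + z) \<partial>lborel)"
      by (rule nn_integral_add) measurable
    also have "(\<integral>\<^sup>+z. indicator T (x + z) \<partial>lborel) = ennreal A"
      by (subst nn_integral_lborel_translate[where f = "indicator T"]) (auto simp: eT)
    finally have "ennreal (\<theta> * S) - ennreal A \<le> ?J"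
      using \<theta> by (simp add: ennreal_mult' ennreal_minus_le_iff add.commute)
    moreover have "ennreal (\<theta> * S / 2) \<le> ennreal (\<theta> * S) - ennreal A"
      using AS Apos by (subst ennreal_minus, simp, intro ennreal_leI) linarith
    ultimately show "ennreal (\<theta> * S / 2) \<le> ?J" by (rule order_trans[rotated])
  qed measurable
  have sub: "{x \<in> G. w x \<noteq> 0} \<subseteq> T" using rr \<open>0 < k\<close> by (auto simp: G_def w_def T_def)
  have "?I \<le> ennreal (\<rho> ^ DIM('a) * (\<rho> / R) powr s) *
    (ennreal (2 * 1 * ?V) * emeasure lborel {x \<in> G. w x \<noteq> 0}
      + ennreal (q * ln (real 2) / Psi (p - 1) (q - 1) 1) * energy p q s R G w)"
    using par \<rho> \<open>0 < R\<close> by (intro incr_shell_le_energy) (auto simp: G_def)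
  also have "\<dots> \<le> ennreal (\<rho> ^ DIM('a) * (\<rho> / R) powr s) *
    (ennreal (2 * ?V) * ennreal A + ennreal q * (ennreal (\<Lambda> * (R / (r1 - r)) powr b) * ennreal A))"
  proof (intro mult_left_mono add_mono mult_mono)
    show "emeasure lborel {x \<in> G. w x \<noteq> 0} \<le> ennreal A"
      using sub by (subst eT[symmetric]) (intro emeasure_mono, auto)
    show "energy p q s R G w \<le> ennreal (\<Lambda> * (R / (r1 - r)) powr b) * ennreal A"
      using caccioppoli rr r unfolding caccioppoli_def w_def G_def eT[symmetric] T_def by auto
    show "ennreal (q * ln (real 2) / Psi (p - 1) (q - 1) 1) \<le> ennreal q"
      using par ln2_le_25_over_36 by (intro ennreal_leI) (simp add: mult_left_le)
  qed auto
  also have "\<dots> = ennreal (\<rho> ^ DIM('a) * (\<rho> / R) powr s * ((2 * ?V + q * \<Lambda> * (R / (r1 - r)) powr b) * A))"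
    using par Apos \<rho> by (simp add: ennreal_mult distrib_right mult.assoc)
  finally have "ennreal (\<theta> * S / 2 * measure lborel Y)
     \<le> ennreal (\<rho> ^ DIM('a) * (\<rho> / R) powr s * ((2 * ?V + q * \<Lambda> * (R / (r1 - r)) powr b) * A))"
    using low \<theta> unfolding eY by (subst ennreal_mult) (auto simp: S_def intro: order_trans)
  moreover have "0 \<le> \<rho> ^ DIM('a) * (\<rho> / R) powr s * ((2 * ?V + q * \<Lambda> * (R / (r1 - r)) powr b) * A)"
    using par \<rho> Apos V by simp
  ultimately have 1: "\<theta> * S / 2 * measure lborel Y
     \<le> \<rho> ^ DIM('a) * (\<rho> / R) powr s * ((2 * ?V + q * \<Lambda> * (R / (r1 - r)) powr b) * A)"
    by simp
  have "(R / (r1 - r)) powr b = 2 powr b * (R / (r1 - r0)) powr b"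
  proof -
    have "R / (r1 - r) = 2 * (R / (r1 - r0))" by (simp add: rr(3))
    then show ?thesis using \<open>0 < R\<close> r by (simp only: powr_mult)
  qed
  moreover have "1 \<le> (R / (r1 - r0)) powr b"
    using r \<open>0 < R\<close> par by (intro ge_one_powr_ge_zero) (auto simp: field_simps)
  ultimately have "2 * ?V + q * \<Lambda> * (R / (r1 - r)) powr b \<le> (2 * ?V + q * \<Lambda> * 2 powr b) * (R / (r1 - r0)) powr b"
    using V by (simp add: algebra_simps)
  then have 2: "\<rho> ^ DIM('a) * (\<rho> / R) powr s * ((2 * ?V + q * \<Lambda> * (R / (r1 - r)) powr b) * A)
     \<le> \<rho> ^ DIM('a) * (\<rho> / R) powr s * (((2 * ?V + q * \<Lambda> * 2 powr b) * (R / (r1 - r0)) powr b) * A)"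
    using \<rho> Apos by (intro mult_left_mono mult_right_mono) auto
  have "\<theta> * (?V * \<rho> ^ DIM('a) / 2) / 2 * measure lborel Y \<le> \<theta> * S / 2 * measure lborel Y"
    using S \<theta> by (intro mult_right_mono divide_right_mono mult_left_mono) auto
  with 1 2 have "\<rho> ^ DIM('a) * (\<theta> * ?V / 4 * measure lborel Y) \<le>
     \<rho> ^ DIM('a) * ((\<rho> / R) powr s * (((2 * ?V + q * \<Lambda> * 2 powr b) * (R / (r1 - r0)) powr b) * A))"
    by (simp add: mult_ac)
  then have "\<theta> * ?V / 4 * measure lborel Y \<le> (\<rho> / R) powr s * (((2 * ?V + q * \<Lambda> * 2 powr b) * (R / (r1 - r0)) powr b) * A)"
    using \<rho> by (subst (asm) mult_le_cancel_left_pos) auto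
  then show ?thesis
    unfolding Y_def[symmetric] using \<theta> V by (simp add: field_simps)
qed

text \<open>The radius $\rho$ is taken as small as the previous lemma allows, which turns the factor
  $(\rho/R)^s$ into the gain $A^{s/d}$.\<close>

lemma degiorgi_step:
  fixes u :: "'a::euclidean_space \<Rightarrow> real"
  assumes [measurable]: "u \<in> borel_measurable borel"
    and par: "1 \<le> p" "p \<le> q" "0 < s0" "s0 \<le> s" "s < 1" "0 \<le> \<Lambda>" "1 \<le> b"
    and "0 < R" "0 < k" and nn: "\<And>x. x \<in> ball x0 R \<Longrightarrow> 0 \<le> u x"
    and caccioppoli: "caccioppoli p q s \<Lambda> b u x0 R k"
    and r: "R / 2 \<le> r0" "r0 < r1" "r1 \<le> R" and \<theta>: "0 < \<theta>" "\<theta> < 1"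
    and A: "A = measure lborel {x \<in> ball x0 r1. u x < k}"
  shows "measure lborel {x \<in> ball x0 r0. u x < (1 - \<theta>) * k}
    \<le> (16 * (2 * unit_ball_vol (real DIM('a)) + q * \<Lambda> * 2 powr b) / unit_ball_vol (real DIM('a)) + 8)
       * (1 / \<theta>) ^ 2 * (R / (r1 - r0)) powr b * A * (A / (unit_ball_vol (real DIM('a)) * R ^ DIM('a))) powr (s0 / DIM('a))"
proof -
  let ?V = "unit_ball_vol (real DIM('a))"
  let ?d = "real DIM('a)"
  let ?Y = "measure lborel {x \<in> ball x0 r0. u x < (1 - \<theta>) * k}"
  let ?a = "A / (?V * R ^ DIM('a))"
  let ?K = "2 * ?V + q * \<Lambda> * 2 powr b"
  have V: "0 < ?V" by simp
  have Apos: "0 \<le> A" by (simp add: A)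
  have YA: "?Y \<le> A"
  proof -
    have "(1 - \<theta>) * k \<le> 1 * k" using \<theta> \<open>0 < k\<close> by (intro mult_right_mono) auto
    then show ?thesis unfolding A using r
      by (intro measure_mono_in_ball[of _ _ x0 r1]) auto
  qed
  show ?thesis
  proof (cases "A = 0")
    case True
    then show ?thesis using YA by (simp add: measure_nonneg)
  next
    case False
    with Apos have A0: "0 < A" by simp
    define \<rho> where "\<rho> = (4 * A / (\<theta> * ?V)) powr (1 / ?d)"
    have pos: "0 < 4 * A / (\<theta> * ?V)" using A0 V \<theta> by (intro divide_pos_pos mult_pos_pos) auto
    have \<rho>: "0 < \<rho>" unfolding \<rho>_def using pos by (metis powr_gt_zero less_irrefl)
    have \<rho>d: "\<rho> ^ DIM('a) = 4 * A / (\<theta> * ?V)"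
    proof -
      have "\<rho> ^ DIM('a) = \<rho> powr ?d" using \<rho> by (simp add: powr_realpow)
      also have "\<dots> = (4 * A / (\<theta> * ?V)) powr (1 / ?d * ?d)" by (simp only: \<rho>_def powr_powr)
      also have "1 / ?d * ?d = 1" by simp
      also have "(4 * A / (\<theta> * ?V)) powr 1 = 4 * A / (\<theta> * ?V)" using pos by (intro powr_one) linarith
      finally show ?thesis .
    qed
    have a: "0 < ?a" "?a \<le> 1"
    proof -
      have "A \<le> measure lborel (ball x0 R)" unfolding A using r
        by (intro measure_mono_in_ball[of _ _ x0 R]) auto
      then show "?a \<le> 1" using \<open>0 < R\<close> V by (simp add: content_ball)
      show "0 < ?a" using A0 V \<open>0 < R\<close> by simp
    qed
    have R\<Delta>: "1 \<le> R / (r1 - r0)" using r \<open>0 < R\<close> by (simp add: field_simps)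
    have "(\<rho> / R) powr s = (4 / \<theta>) powr (s / ?d) * ?a powr (s / ?d)"
    proof -
      have "\<rho> / R = (4 / \<theta> * ?a) powr (1 / ?d)"
      proof -
        have "R = (R ^ DIM('a)) powr (1 / ?d)"
          using \<open>0 < R\<close> by (simp add: powr_realpow[symmetric] powr_powr)
        then have "\<rho> / R = (4 * A / (\<theta> * ?V)) powr (1 / ?d) / (R ^ DIM('a)) powr (1 / ?d)"
          by (simp add: \<rho>_def)
        also have "\<dots> = (4 * A / (\<theta> * ?V) / R ^ DIM('a)) powr (1 / ?d)"
          using A0 V \<theta> \<open>0 < R\<close> by (subst powr_divide) auto
        finally show ?thesis by (simp add: mult_ac)
      qed
      then have "(\<rho> / R) powr s = (4 / \<theta> * ?a) powr (s / ?d)" by (simp add: powr_powr)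
      also have "\<dots> = (4 / \<theta>) powr (s / ?d) * ?a powr (s / ?d)"
        by (rule powr_mult)
      finally show ?thesis .
    qed
    \<comment> \<open>The density \<open>?a\<close> is at most 1, so its exponent may be lowered
      from s/d to s0/d; the gain becomes independent of s.\<close>
    also have "\<dots> \<le> (4 / \<theta>) powr 1 * ?a powr (s0 / ?d)"
    proof (rule mult_mono)
      have "1 \<le> ?d" using DIM_positive[where 'a='a] by linarith
      then have "s \<le> ?d" using par by linarith
      then have "s / ?d \<le> 1" by (simp add: divide_le_eq)
      then show "(4 / \<theta>) powr (s / ?d) \<le> (4 / \<theta>) powr 1"
        using \<theta> by (intro powr_mono) auto
      show "?a powr (s / ?d) \<le> ?a powr (s0 / ?d)"
        using par a by (intro powr_mono' divide_right_mono) auto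
    qed auto
    finally have \<rho>R: "(\<rho> / R) powr s \<le> 4 / \<theta> * ?a powr (s0 / ?d)" using \<theta> by simp
    have main: "?Y \<le> (4 * ?K / ?V + 2) * (1 / \<theta>) * (\<rho> / R) powr s * (R / (r1 - r0)) powr b * A"
    proof (cases "\<rho> \<le> (r1 - r0) / 2")
      case True
      have "?Y \<le> 4 * ?K / (?V * \<theta>) * (\<rho> / R) powr s * (R / (r1 - r0)) powr b * A"
        using par \<open>0 < R\<close> \<open>0 < k\<close> nn caccioppoli r \<theta> A \<rho> True \<rho>d V
        by (intro degiorgi_step_at_scale) auto
      also have "4 * ?K / (?V * \<theta>) \<le> (4 * ?K / ?V + 2) * (1 / \<theta>)"
        using \<theta> V by (simp add: field_simps)
      finally show ?thesis using Apos by (simp add: mult_right_mono)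
    next
      \<comment> \<open>If \<rho> is too large for the gap, then 2 \<rho> / (r1 - r0) > 1 and the
        right-hand side already exceeds A, which bounds the left-hand side trivially.\<close>
      case False
      have "1 \<le> (2 * \<rho> / (r1 - r0)) powr s"
        using False r par by (intro ge_one_powr_ge_zero) (auto simp: field_simps)
      also have "\<dots> = 2 powr s * ((\<rho> / R) powr s * (R / (r1 - r0)) powr s)"
        using r \<rho> \<open>0 < R\<close> by (simp add: powr_mult[symmetric])
      also have "\<dots> \<le> 2 powr 1 * ((\<rho> / R) powr s * (R / (r1 - r0)) powr b)"
        using R\<Delta> par by (intro mult_mono powr_mono mult_left_mono) auto
      finally have "1 \<le> 2 * ((\<rho> / R) powr s * (R / (r1 - r0)) powr b)" by simp
      also have "\<dots> \<le> (4 * ?K / ?V + 2) * (1 / \<theta>) * ((\<rho> / R) powr s * (R / (r1 - r0)) powr b)"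
      proof (intro mult_right_mono)
        have "0 \<le> 4 * ?K / ?V" using par V by simp
        then have "2 * 1 \<le> (4 * ?K / ?V + 2) * (1 / \<theta>)"
          using \<theta> by (intro mult_mono) auto
        then show "2 \<le> (4 * ?K / ?V + 2) * (1 / \<theta>)" by simp
      qed auto
      finally have "1 * A \<le> (4 * ?K / ?V + 2) * (1 / \<theta>) * ((\<rho> / R) powr s * (R / (r1 - r0)) powr b) * A"
        using Apos by (intro mult_right_mono)
      then show ?thesis using YA by (simp add: mult.assoc)
    qed
    also have "\<dots> \<le> (4 * ?K / ?V + 2) * (1 / \<theta>) * (4 / \<theta> * ?a powr (s0 / ?d)) * (R / (r1 - r0)) powr b * A"
      using \<theta> V par Apos by (intro mult_right_mono mult_left_mono \<rho>R) auto
    finally show ?thesis by (simp add: power2_eq_square field_simps)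
  qed
qed

text \<open>The bound \<eta> \<mu>^i reproduces itself under the recursion, because \<eta> and \<mu>
  solve C \<eta>^\<alpha> = \<mu> and B \<mu>^\<alpha> = 1.\<close>

lemma fast_geometric_convergence:
  fixes a :: "nat \<Rightarrow> real"
  assumes "0 < C" "1 < B" "0 < \<alpha>" and a: "\<And>i. 0 \<le> a i"
    and step: "\<And>i. a (Suc i) \<le> C * B ^ i * a i powr (1 + \<alpha>)"
    and a0: "a 0 \<le> C powr (- 1 / \<alpha>) * B powr (- 1 / \<alpha>\<^sup>2)"
  shows "a \<longlonglongrightarrow> 0"
proof -
  define \<eta> where "\<eta> = C powr (- 1 / \<alpha>) * B powr (- 1 / \<alpha>\<^sup>2)"
  define \<mu> where "\<mu> = B powr (- 1 / \<alpha>)"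
  have \<mu>: "0 < \<mu>" "\<mu> < 1" using assms by (auto simp: \<mu>_def intro!: powr_less_one)
  have \<eta>: "0 < \<eta>" using assms by (simp add: \<eta>_def)
  have \<eta>\<alpha>: "C * \<eta> powr \<alpha> = \<mu>"
  proof -
    have "\<eta> powr \<alpha> = C powr (- 1) * B powr (- 1 / \<alpha>)"
      using assms by (simp only: \<eta>_def powr_mult powr_powr) (simp add: power2_eq_square powr_mult powr_powr)
    then show ?thesis using assms by (simp add: \<mu>_def powr_minus)
  qed
  have B\<mu>: "B * \<mu> powr \<alpha> = 1"
    using assms by (simp only: \<mu>_def powr_powr) (simp add: powr_minus)
  have bound: "a i \<le> \<eta> * \<mu> ^ i" for i
  proof (induction i)
    case 0
    then show ?case using a0 by (simp add: \<eta>_def)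
  next
    case (Suc i)
    have "a (Suc i) \<le> C * B ^ i * (\<eta> * \<mu> ^ i) powr (1 + \<alpha>)"
      using Suc a assms by (intro order_trans[OF step] mult_left_mono powr_mono2) auto
    also have "(\<eta> * \<mu> ^ i) powr (1 + \<alpha>) = \<eta> * \<mu> ^ i * (\<eta> powr \<alpha> * (\<mu> powr \<alpha>) ^ i)"
      using \<eta> \<mu> by (simp add: powr_add powr_mult powr_power mult.commute
          powr_realpow[symmetric] powr_powr)
    also have "C * B ^ i * \<dots> = (C * \<eta> powr \<alpha>) * (B * \<mu> powr \<alpha>) ^ i * (\<eta> * \<mu> ^ i)"
      by (simp add: power_mult_distrib mult_ac)
    also have "\<dots> = \<eta> * \<mu> ^ Suc i" by (simp add: \<eta>\<alpha> B\<mu>)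
    finally show ?case .
  qed
  have "(\<lambda>i. \<eta> * \<mu> ^ i) \<longlonglongrightarrow> \<eta> * 0"
    using \<mu> by (intro tendsto_mult tendsto_const LIMSEQ_power_zero) auto
  then show ?thesis
    using bound a by (intro tendsto_sandwich[of "\<lambda>_. 0" a _ "\<lambda>i. \<eta> * \<mu> ^ i"]) auto
qed

text \<open>Levels decrease from k to k/2 while radii decrease from 3R/4 to R/2, both geometrically.
  The densities of the sublevel sets satisfy a superlinear recursion, and \<eta> is the initial
  density from which it converges to zero.\<close>

lemma degiorgi_lemma:
  fixes s0 p q \<Lambda> b :: real
  assumes par: "0 < s0" "1 \<le> p" "p \<le> q" "0 \<le> \<Lambda>" "1 \<le> b"
  obtains \<eta> where "0 < \<eta>"
    "\<And>s (u :: 'a::euclidean_space \<Rightarrow> real) x0 R k. \<lbrakk>s0 \<le> s; s < 1; u \<in> borel_measurable borel; 0 < R; 0 < k;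
       \<And>x. x \<in> ball x0 R \<Longrightarrow> 0 \<le> u x; \<And>l. k / 2 \<le> l \<Longrightarrow> l \<le> k \<Longrightarrow> caccioppoli p q s \<Lambda> b u x0 R l;
       measure lborel {x \<in> ball x0 (3 / 4 * R). u x < k} \<le> \<eta> * R ^ DIM('a)\<rbrakk>
     \<Longrightarrow> AE x in lborel. x \<in> ball x0 (R / 2) \<longrightarrow> k / 2 \<le> u x"
proof -
  let ?V = "unit_ball_vol (real DIM('a))"
  let ?d = "real DIM('a)"
  define C0 where "C0 = 16 * (2 * ?V + q * \<Lambda> * 2 powr b) / ?V + 8"
  define C where "C = C0 * 16 * 8 powr b"
  define B where "B = 4 * 2 powr b"
  define \<alpha> where "\<alpha> = s0 / ?d"
  define \<eta> where "\<eta> = ?V * (C powr (- 1 / \<alpha>) * B powr (- 1 / \<alpha>\<^sup>2))"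
  have V: "0 < ?V" by simp
  have C0: "0 < C0" using par V by (simp add: C0_def add_nonneg_pos)
  then have C: "0 < C" by (simp add: C_def)
  have B: "1 < B"
    using ge_one_powr_ge_zero[of 2 b] par by (simp add: B_def)
  have \<alpha>: "0 < \<alpha>" using par by (simp add: \<alpha>_def)
  have \<eta>: "0 < \<eta>" unfolding \<eta>_def using V C B by (intro mult_pos_pos) auto
  show ?thesis
  proof (rule that[OF \<eta>])
    fix s R k :: real and u :: "'a \<Rightarrow> real" and x0 :: 'a
    assume s: "s0 \<le> s" "s < 1" and [measurable]: "u \<in> borel_measurable borel" and "0 < R" "0 < k"
      and nn: "\<And>x. x \<in> ball x0 R \<Longrightarrow> 0 \<le> u x"
      and caccioppoli: "\<And>l. k / 2 \<le> l \<Longrightarrow> l \<le> k \<Longrightarrow> caccioppoli p q s \<Lambda> b u x0 R l"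
      and small: "measure lborel {x \<in> ball x0 (3 / 4 * R). u x < k} \<le> \<eta> * R ^ DIM('a)"
    define r where "r i = R / 2 + R / 4 * (1 / 2) ^ i" for i :: nat
    define l where "l i = k / 2 + k / 2 * (1 / 2) ^ i" for i :: nat
    define m where "m i = measure lborel {x \<in> ball x0 (r i). u x < l i}" for i
    define a where "a i = m i / (?V * R ^ DIM('a))" for i
    have m0: "0 \<le> m i" for i by (simp add: m_def)
    have VR: "0 < ?V * R ^ DIM('a)" using V \<open>0 < R\<close> by simp
    have a0: "0 \<le> a i" for i unfolding a_def using m0[of i] VR by (intro divide_nonneg_pos)
    have ma: "m i = ?V * R ^ DIM('a) * a i" for i
      using VR unfolding a_def by (metis less_irrefl nonzero_mult_div_cancel_left times_divide_eq_right)
    have half: "0 < (1 / 2 :: real) ^ i" "(1 / 2 :: real) ^ i \<le> 1" for i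
      by (auto simp: power_le_one)
    have lb: "k / 2 \<le> l i" "l i \<le> k" for i
    proof -
      have "k / 2 * (1 / 2) ^ i \<le> k / 2 * 1" "0 < k / 2 * (1 / 2) ^ i"
        using half[of i] \<open>0 < k\<close> by (auto intro!: mult_left_mono)
      then show "k / 2 \<le> l i" "l i \<le> k" unfolding l_def by linarith+
    qed
    have step: "a (Suc i) \<le> C * B ^ i * a i powr (1 + \<alpha>)" for i
    proof -
      \<comment> \<open>The relative gap between consecutive levels, so that (1 - \<theta>) l_i =
        l_(i+1). It is at least 2^(-i)/4, whence the factor 16 * 4^i below.\<close>
      define \<theta> where "\<theta> = (k / 4 * (1 / 2) ^ i) / l i"
      have l0: "0 < l i" using lb[of i] \<open>0 < k\<close> by linarith
      have \<theta>: "0 < \<theta>" "\<theta> < 1"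
      proof -
        have "k / 4 * (1 / 2) ^ i \<le> k / 4 * 1" "0 < k / 4 * (1 / 2) ^ i"
          using half[of i] \<open>0 < k\<close> by (auto intro!: mult_left_mono)
        then have "k / 4 * (1 / 2) ^ i < l i" "0 < k / 4 * (1 / 2) ^ i"
          using lb[of i] \<open>0 < k\<close> by linarith+
        then show "0 < \<theta>" "\<theta> < 1"
          unfolding \<theta>_def using l0 by (simp_all add: divide_less_eq)
      qed
      have l_Suc: "(1 - \<theta>) * l i = l (Suc i)"
        using l0 by (simp add: \<theta>_def left_diff_distrib) (simp add: l_def)
      have r\<Delta>: "R / (r i - r (Suc i)) = 8 * 2 ^ i"
        using \<open>0 < R\<close> by (simp add: r_def field_simps power_divide)
      have "m (Suc i) \<le> C0 * (1 / \<theta>) ^ 2 * (R / (r i - r (Suc i))) powr b * m i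
          * (m i / (?V * R ^ DIM('a))) powr (s0 / ?d)"
        unfolding m_def l_Suc[symmetric] C0_def
      proof (rule degiorgi_step)
        show "caccioppoli p q s \<Lambda> b u x0 R (l i)" using lb by (intro caccioppoli)
        show "R / 2 \<le> r (Suc i)" "r (Suc i) < r i" "r i \<le> R"
        proof -
          have "R / 4 * (1 / 2) ^ i \<le> R / 4 * 1" "0 < R / 4 * (1 / 2) ^ i"
            using half[of i] \<open>0 < R\<close> by (auto intro!: mult_left_mono)
          then show "R / 2 \<le> r (Suc i)" "r (Suc i) < r i" "r i \<le> R"
            using \<open>0 < R\<close> unfolding r_def power_Suc by (simp_all, linarith?)
        qed
      qed (use par s \<open>0 < R\<close> l0 nn \<theta> in auto)
      also have "(R / (r i - r (Suc i))) powr b = 8 powr b * (2 powr b) ^ i"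
        by (simp add: r\<Delta> powr_mult powr_realpow[symmetric] powr_powr mult.commute)
      also have "m i / (?V * R ^ DIM('a)) = a i" by (simp add: a_def)
      also have "C0 * (1 / \<theta>) ^ 2 * (8 powr b * (2 powr b) ^ i) * m i * a i powr (s0 / ?d)
          \<le> C0 * (16 * 4 ^ i) * (8 powr b * (2 powr b) ^ i) * m i * a i powr (s0 / ?d)"
      proof (intro mult_right_mono mult_left_mono)
        have "1 / \<theta> \<le> 4 * 2 ^ i"
          using l0 lb[of i] \<open>0 < k\<close> by (simp add: \<theta>_def field_simps power_divide)
        then have "(1 / \<theta>) ^ 2 \<le> (4 * 2 ^ i) ^ 2" using \<theta> by (intro power_mono) auto
        then show "(1 / \<theta>) ^ 2 \<le> 16 * 4 ^ i"
          by (simp add: power_mult_distrib power2_eq_square[of "2 ^ i"] power_mult_distrib[symmetric])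
      qed (use C0 m0 in auto)
      also have "\<dots> = (C * B ^ i * a i powr (1 + \<alpha>)) * (?V * R ^ DIM('a))"
        using a0[of i] by (simp add: ma C_def B_def \<alpha>_def powr_add power_mult_distrib)
      finally show ?thesis using VR by (simp add: a_def divide_le_eq)
    qed
    have "a \<longlonglongrightarrow> 0"
    proof (rule fast_geometric_convergence[OF C B \<alpha> a0 step])
      have 0: "r 0 = 3 / 4 * R" "l 0 = k" by (auto simp: r_def l_def)
      show "a 0 \<le> C powr (- 1 / \<alpha>) * B powr (- 1 / \<alpha>\<^sup>2)"
        using small VR unfolding a_def m_def \<eta>_def 0
        by (simp only: pos_divide_le_eq) (simp only: mult_ac)
    qed
    then have "(\<lambda>i. ?V * R ^ DIM('a) * a i) \<longlonglongrightarrow> ?V * R ^ DIM('a) * 0"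
      by (intro tendsto_intros)
    moreover define Z where "Z = {x \<in> ball x0 (R / 2). u x < k / 2}"
    have [measurable]: "Z \<in> sets borel" unfolding Z_def by measurable
    have "measure lborel Z \<le> ?V * R ^ DIM('a) * a i" for i
      unfolding ma[symmetric] m_def
    proof (rule measure_mono_in_ball)
      have "0 < R / 4 * (1 / 2) ^ i" using half[of i] \<open>0 < R\<close> by simp
      then have "R / 2 < r i" unfolding r_def by linarith
      then show "Z \<subseteq> {x \<in> ball x0 (r i). u x < l i}"
        using lb[of i] by (auto simp: Z_def)
    qed auto
    ultimately have "measure lborel Z \<le> 0"
      using tendsto_lowerbound by fastforce
    moreover have "Z \<subseteq> ball x0 (R / 2)" by (auto simp: Z_def)
    ultimately have "emeasure lborel Z = 0"
      using emeasure_in_ball[of Z x0 "R / 2"] by (simp add: ennreal_neg)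
    then have "AE x in lborel. x \<notin> Z" by (intro AE_not_in) (auto simp: null_sets_def)
    then show "AE x in lborel. x \<in> ball x0 (R / 2) \<longrightarrow> k / 2 \<le> u x"
      by eventually_elim (auto simp: Z_def)
  qed
qed

section \<open>The energy of a truncated logarithm\<close>

lemma ex_dyadic:
  assumes "1 \<le> (t::real)"
  obtains j :: nat where "2 ^ j \<le> t" "t < 2 ^ Suc j"
proof -
  obtain n where n: "t < 2 ^ n" using real_arch_pow[of 2 t] by auto
  define m where "m = (LEAST n. t < 2 ^ n)"
  have m: "t < 2 ^ m" unfolding m_def using n by (rule LeastI)
  have "m \<noteq> 0"
  proof
    assume "m = 0"
    then show False using m assms by simp
  qed
  then obtain j where j: "m = Suc j" by (cases m) auto
  have "\<not> t < 2 ^ j" using not_less_Least[of j "\<lambda>n. t < 2 ^ n"] j by (simp add: m_def)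
  then show ?thesis using that[of j] m j by simp
qed

text \<open>The logarithm of M/t to base 2, truncated to [0, J]. The truncation acts on t, so for M
  > 0 the argument of the logarithm stays positive whatever the sign of t.\<close>

definition log_clamp :: "real \<Rightarrow> nat \<Rightarrow> real \<Rightarrow> real" where
  "log_clamp M J t = log 2 (M / min M (max (M / 2 ^ J) t))"

lemma borel_measurable_log_clamp [measurable]: "log_clamp M J \<in> borel_measurable borel"
  unfolding log_clamp_def[abs_def] by measurable

lemma log_clamp_ge: "0 < M \<Longrightarrow> M \<le> t \<Longrightarrow> log_clamp M J t = 0"
  by (simp add: log_clamp_def min_def max_def)

lemma log_clamp_le: "0 < M \<Longrightarrow> t \<le> M / 2 ^ J \<Longrightarrow> log_clamp M J t = J"
proof -
  assume "0 < M" "t \<le> M / 2 ^ J"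
  moreover have "M / 2 ^ J \<le> M" using \<open>0 < M\<close> by (simp add: divide_le_eq)
  ultimately have "log_clamp M J t = log 2 (M / (M / 2 ^ J))"
    by (simp add: log_clamp_def max_absorb1 min_absorb2)
  also have "M / (M / 2 ^ J) = 2 ^ J" using \<open>0 < M\<close> by simp
  finally show ?thesis by (simp add: log_nat_power)
qed

text \<open>Together with \<open>cross_kernel\<close>, the integrand of \<open>energy\<close> and
  \<open>cross\<close> for one pair of values a = u(x), b = u(y), with \<tau> = (R/|x-y|)^s and
  without the weight |x-y|^(-d). The logarithmic estimate is a pointwise inequality between
  these.\<close>

definition level_kernel :: "real \<Rightarrow> real \<Rightarrow> real \<Rightarrow> real \<Rightarrow> real \<Rightarrow> real \<Rightarrow> real" where
  "level_kernel p q \<tau> k a b = Psi p q (\<bar>max (k - a) 0 / k - max (k - b) 0 / k\<bar> * \<tau>)"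

definition cross_kernel :: "real \<Rightarrow> real \<Rightarrow> real \<Rightarrow> real \<Rightarrow> real \<Rightarrow> real \<Rightarrow> real" where
  "cross_kernel p q \<tau> k a b =
     (if k < b then Psi p q ((b - k) / k * \<tau>) * (max (k - a) 0 / (b - k)) else 0)"

lemma level_kernel_nonneg: "0 \<le> level_kernel p q \<tau> k a b"
  by (simp add: level_kernel_def)

lemma cross_kernel_nonneg: "0 \<le> cross_kernel p q \<tau> k a b"
  by (simp add: cross_kernel_def)

definition log_const :: "real \<Rightarrow> real \<Rightarrow> real" where
  "log_const p q = max (32 powr q) (2 * (3 + 2 / ((p - 1) / p)) powr q)"

lemma log_const_pos: "0 < log_const p q"
  by (simp add: log_const_def less_max_iff_disj)

text \<open>A pair of values $a < b$ is charged to one level $k = M/2^j$. If $b \le 8a$, a level just above $b$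
  sees the difference $b - a$. If $b > 8a$, the cross term at a level comparable to $a$ pays: it is
  larger than the energy at that level by a factor $(b/a)^{p-1}$, which beats every power of $\log(b/a)$.\<close>

lemma log_near:
  assumes pq: "1 < p" "p \<le> q" and "0 < M" "0 \<le> \<tau>"
    and AB: "M / 2 ^ J \<le> A" "A < B" "B \<le> M" "a \<le> A" "B \<le> b" and near: "B \<le> 8 * A"
  shows "\<exists>j\<le>J. Psi p q (log 2 (B / A) * \<tau>) \<le> 32 powr q * level_kernel p q \<tau> (M / 2 ^ j) a b"
proof -
  have "0 < M / 2 ^ J" using \<open>0 < M\<close> by simp
  then have A: "0 < A" using AB by linarith
  have B: "0 < B" using A AB by linarith
  \<comment> \<open>The level k = M/2^j lies in [B, 2B], so it sees the whole difference B - A. The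
    bound M/2^J \<le> A < B gives j \<le> J.\<close>
  obtain j where j: "2 ^ j \<le> M / B" "M / B < 2 ^ Suc j"
    using ex_dyadic[of "M / B"] AB B by auto
  define k where "k = M / 2 ^ j"
  have k: "0 < k" "B \<le> k" "k \<le> 2 * B"
    using j B \<open>0 < M\<close> by (auto simp: k_def field_simps)
  have "M / B \<le> 2 ^ J" using AB B by (simp add: field_simps) (smt (verit) mult_right_mono zero_le_power)
  with j have "(2::real) ^ j \<le> 2 ^ J" by linarith
  then have "j \<le> J" by simp
  define n where "n = log 2 (B / A)"
  have n0: "0 \<le> n" using A AB by (simp add: n_def)
  \<comment> \<open>The logarithm is at most (B - A)/(A ln 2), and k \<le> 2B \<le> 16A replaces A
    by k. With ln 2 \<ge> 1/2 this gives the constant 32.\<close>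
  have "ln (B / A) \<le> B / A - 1" using A B by (intro ln_le_minus_one) auto
  then have "A * (n * ln 2) \<le> B - A"
    using A by (simp add: n_def log_def field_simps)
  moreover have "n * (1 / 2) \<le> n * ln 2"
    using ln2_ge_two_thirds n0 by (intro mult_left_mono) auto
  then have "A * (n * (1 / 2)) \<le> A * (n * ln 2)" by (rule mult_left_mono) (use A in simp)
  moreover have "k / 16 * (n * (1 / 2)) \<le> A * (n * (1 / 2))"
    using k near n0 by (intro mult_right_mono) auto
  ultimately have "k * (n / 32) \<le> B - A" by simp
  also have "B - A \<le> max (k - a) 0 - max (k - b) 0" using AB k by auto
  finally have "n / 32 \<le> (max (k - a) 0 - max (k - b) 0) / k"
    using k by (simp add: le_divide_eq mult.commute)
  also have "\<dots> \<le> \<bar>max (k - a) 0 / k - max (k - b) 0 / k\<bar>" by (simp add: diff_divide_distrib)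
  finally have "1 / 32 * (n * \<tau>) \<le> \<bar>max (k - a) 0 / k - max (k - b) 0 / k\<bar> * \<tau>"
    using mult_right_mono[OF _ \<open>0 \<le> \<tau>\<close>] by fastforce
  then have le1: "Psi p q (1 / 32 * (n * \<tau>)) \<le> level_kernel p q \<tau> k a b"
    unfolding level_kernel_def using n0 \<open>0 \<le> \<tau>\<close> pq by (intro Psi_mono) auto
  have le2: "Psi p q (1 / 32) * Psi p q (n * \<tau>) \<le> Psi p q (1 / 32 * (n * \<tau>))"
    using n0 \<open>0 \<le> \<tau>\<close> by (intro Psi_mult) auto
  have "Psi p q (1 / 32) = 1 / 32 powr q"
    using pq by (simp add: Psi_le_1 powr_divide)
  then have "1 / 32 powr q * Psi p q (n * \<tau>) \<le> level_kernel p q \<tau> k a b"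
    using order_trans[OF le2 le1] by metis
  then have "Psi p q (n * \<tau>) \<le> 32 powr q * level_kernel p q \<tau> k a b"
    by (simp add: divide_le_eq mult.commute)
  then show ?thesis using \<open>j \<le> J\<close> unfolding n_def k_def by auto
qed

text \<open>Write \<beta> = (b-k)/k. The logarithm n is at most K \<beta>^\<gamma> with \<gamma> = 1
  - 1/p, which is positive only because p > 1. Therefore \<beta>/n \<ge> \<beta>^(1/p)/K, and
  \<open>Psi\<close> of it is at least \<beta> K^(-q): the whole factor \<beta> that the quotient in
  the cross term has removed is recovered. K comes from log_2(8\<beta>) \<le> 3 + (2/\<gamma>)
  \<beta>^\<gamma>.\<close>

lemma log_far:
  assumes pq: "1 < p" "p \<le> q" and "0 < M" "0 \<le> \<tau>"
    and AB: "M / 2 ^ J \<le> A" "A < B" "B \<le> M" "a \<le> A" "B \<le> b" and far: "8 * A < B"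
  shows "\<exists>j\<le>J. Psi p q (log 2 (B / A) * \<tau>)
    \<le> 2 * (3 + 2 / ((p - 1) / p)) powr q * cross_kernel p q \<tau> (M / 2 ^ j) a b"
proof -
  have "0 < M / 2 ^ J" using \<open>0 < M\<close> by simp
  then have A: "0 < A" using AB by linarith
  have B: "0 < B" using A AB by linarith
  \<comment> \<open>The level k = M/2^j lies in [2A, 4A): far enough above a that k - a \<ge> k/2,
    and, since B > 8A, far enough below b that b - k \<ge> B/2.\<close>
  have "1 \<le> M / (2 * A)" using A AB far by (simp add: le_divide_eq)
  then obtain j where j: "2 ^ j \<le> M / (2 * A)" "M / (2 * A) < 2 ^ Suc j"
    using ex_dyadic by blast
  define k where "k = M / 2 ^ j"
  have k: "0 < k" "2 * A \<le> k" "k < 4 * A"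
    using j A \<open>0 < M\<close> by (auto simp: k_def field_simps)
  have "M / (2 * A) \<le> M / A" using A \<open>0 < M\<close> by (intro divide_left_mono) auto
  also have "M / A \<le> 2 ^ J" using AB A by (simp add: field_simps)
  finally have "(2::real) ^ j \<le> 2 ^ J" using j by linarith
  then have "j \<le> J" by simp
  define n where "n = log 2 (B / A)"
  define \<gamma> where "\<gamma> = (p - 1) / p"
  define K where "K = 3 + 2 / \<gamma>"
  define \<beta> where "\<beta> = (b - k) / k"
  have \<gamma>: "0 < \<gamma>" "\<gamma> < 1" using pq by (auto simp: \<gamma>_def)
  have K: "1 \<le> K" using \<gamma> by (simp add: K_def)
  have bk: "B / 2 \<le> b - k" "k \<le> b - k" using k far AB by linarith+
  have \<beta>: "1 \<le> \<beta>" using bk k by (simp add: \<beta>_def)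
  have n0: "0 < n" using A AB by (simp add: n_def)
  have BA: "B / A \<le> 8 * \<beta>"
  proof -
    have "B / A \<le> B / (k / 4)" using k A B by (intro divide_left_mono) auto
    also have "\<dots> = 8 * ((B / 2) / k)" by simp
    also have "\<dots> \<le> 8 * \<beta>" unfolding \<beta>_def using bk k by (intro mult_left_mono divide_right_mono) auto
    finally show ?thesis .
  qed
  have n_le: "n \<le> K * \<beta> powr \<gamma>"
  proof -
    have "\<gamma> * ln \<beta> = ln (\<beta> powr \<gamma>)" using \<beta> by (simp add: ln_powr)
    also have "\<dots> \<le> \<beta> powr \<gamma>" using \<beta> ln_le_minus_one[of "\<beta> powr \<gamma>"] by simp
    finally have ln\<beta>: "ln \<beta> \<le> \<beta> powr \<gamma> / \<gamma>" using \<gamma> by (simp add: le_divide_eq mult.commute)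
    have "n \<le> log 2 (8 * \<beta>)" unfolding n_def using BA A B \<beta> by (subst log_le_cancel_iff) auto
    also have "\<dots> = 3 + ln \<beta> / ln 2"
      using \<beta> log_pow_cancel[of 2 3] by (simp add: log_def ln_mult add_divide_distrib)
    also have "ln \<beta> / ln 2 \<le> 2 * ln \<beta>"
    proof -
      have "ln \<beta> * 1 \<le> ln \<beta> * (2 * ln 2)"
        using \<beta> ln2_ge_two_thirds by (intro mult_left_mono) auto
      then show ?thesis by (simp add: divide_le_eq mult_ac)
    qed
    also have "2 * ln \<beta> \<le> 2 * (\<beta> powr \<gamma> / \<gamma>)" using ln\<beta> by simp
    also have "3 \<le> 3 * \<beta> powr \<gamma>" using \<beta> \<gamma> ge_one_powr_ge_zero[of \<beta> \<gamma>] by simp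
    finally show ?thesis by (simp add: K_def distrib_right)
  qed
  have "\<beta> * (1 / K) powr q \<le> Psi p q (\<beta> / n)"
  proof -
    have "\<beta> powr (1 / p) * (1 / K) \<le> \<beta> / n"
    proof -
      have "\<beta> powr (1 / p) * (1 / K) = \<beta> / (K * \<beta> powr \<gamma>)"
      proof -
        have "\<beta> powr (1 / p) * \<beta> powr \<gamma> = \<beta>"
          using \<beta> pq by (simp add: powr_add[symmetric] \<gamma>_def add_divide_distrib[symmetric])
        then show ?thesis using \<beta> K by (simp add: divide_simps mult_ac)
      qed
      also have "\<dots> \<le> \<beta> / n" using n_le n0 \<beta> K by (intro divide_left_mono) auto
      finally show ?thesis .
    qed
    then have "Psi p q (\<beta> powr (1 / p) * (1 / K)) \<le> Psi p q (\<beta> / n)"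
      using pq K by (intro Psi_mono) auto
    moreover have "Psi p q (\<beta> powr (1 / p)) * Psi p q (1 / K) \<le> Psi p q (\<beta> powr (1 / p) * (1 / K))"
      using K by (intro Psi_mult) auto
    moreover have "Psi p q (\<beta> powr (1 / p)) = \<beta>"
      using \<beta> pq ge_one_powr_ge_zero[of \<beta> "1 / p"] by (simp add: Psi_ge_1 powr_powr)
    moreover have "Psi p q (1 / K) = (1 / K) powr q" using K pq by (intro Psi_le_1) auto
    ultimately show ?thesis by simp
  qed
  then have "\<beta> * (1 / K) powr q * Psi p q (n * \<tau>) \<le> Psi p q (\<beta> / n) * Psi p q (n * \<tau>)"
    by (intro mult_right_mono) auto
  also have "\<dots> \<le> Psi p q (\<beta> / n * (n * \<tau>))" using n0 \<beta> \<open>0 \<le> \<tau>\<close> by (intro Psi_mult) auto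
  also have "\<beta> / n * (n * \<tau>) = \<beta> * \<tau>" using n0 by simp
  finally have "\<beta> * ((1 / K) powr q * Psi p q (n * \<tau>)) \<le> Psi p q (\<beta> * \<tau>)" by (simp add: mult.assoc)
  then have "(1 / K) powr q * Psi p q (n * \<tau>) \<le> Psi p q (\<beta> * \<tau>) / \<beta>"
    using \<beta> by (simp add: le_divide_eq mult.commute)
  also have "\<dots> \<le> 2 * cross_kernel p q \<tau> k a b"
  proof -
    have "1 / \<beta> = k / (b - k)" by (simp add: \<beta>_def)
    also have "k / (b - k) = 2 * ((k / 2) / (b - k))" by (simp only: times_divide_eq_right)
    also have "\<dots> \<le> 2 * (max (k - a) 0 / (b - k))"
      using bk k AB by (intro mult_left_mono divide_right_mono) auto
    finally have "Psi p q (\<beta> * \<tau>) * (1 / \<beta>) \<le> Psi p q (\<beta> * \<tau>) * (2 * (max (k - a) 0 / (b - k)))"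
      by (intro mult_left_mono) auto
    then show ?thesis using bk k by (simp add: cross_kernel_def \<beta>_def mult_ac)
  qed
  finally have "Psi p q (n * \<tau>) \<le> 2 * K powr q * cross_kernel p q \<tau> k a b"
    using K by (simp add: powr_divide divide_le_eq mult_ac)
  then show ?thesis using \<open>j \<le> J\<close> unfolding n_def k_def K_def \<gamma>_def by auto
qed

text \<open>Clamping both values to [M/2^J, M] leaves the truncated logarithms unchanged and
  confines the paying level to j \<le> J. A single j suffices; the sum over j only makes the bound
  uniform over pairs.\<close>

lemma log_clamp_kernel:
  assumes pq: "1 < p" "p \<le> q" and "0 < M" "0 \<le> \<tau>" and ab: "a \<le> b"
  shows "Psi p q (\<bar>log_clamp M J a - log_clamp M J b\<bar> * \<tau>)
    \<le> log_const p q * (\<Sum>j\<le>J. level_kernel p q \<tau> (M / 2 ^ j) a b + cross_kernel p q \<tau> (M / 2 ^ j) a b)"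
proof -
  let ?f = "\<lambda>j. level_kernel p q \<tau> (M / 2 ^ j) a b + cross_kernel p q \<tau> (M / 2 ^ j) a b"
  define A where "A = min M (max (M / 2 ^ J) a)"
  define B where "B = min M (max (M / 2 ^ J) b)"
  have f0: "0 \<le> ?f j" for j by (simp add: level_kernel_nonneg cross_kernel_nonneg)
  have MJ: "0 < M / 2 ^ J" "M / 2 ^ J \<le> M" using \<open>0 < M\<close> by (auto simp: divide_le_eq)
  have A: "0 < A" "A \<le> B" unfolding A_def B_def using MJ \<open>0 < M\<close> ab by (auto simp: less_max_iff_disj)
  have g: "\<bar>log_clamp M J a - log_clamp M J b\<bar> = log 2 (B / A)"
    using A \<open>0 < M\<close> by (simp add: log_clamp_def A_def[symmetric] B_def[symmetric] log_divide)
  show ?thesis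
  proof (cases "A = B")
    case True
    then show ?thesis unfolding g using A log_const_pos[of p q] f0
      by (simp add: sum_nonneg zero_le_mult_iff)
  next
    case False
    have AB: "M / 2 ^ J \<le> A" "A < B" "B \<le> M" "a \<le> A" "B \<le> b"
      using False A MJ ab unfolding A_def B_def by (auto simp: min_def max_def split: if_splits)
    have "\<exists>j\<le>J. Psi p q (log 2 (B / A) * \<tau>) \<le> log_const p q * ?f j"
    proof (cases "B \<le> 8 * A")
      case True
      from log_near[OF pq \<open>0 < M\<close> \<open>0 \<le> \<tau>\<close> AB True] obtain j where
        "j \<le> J" "Psi p q (log 2 (B / A) * \<tau>) \<le> 32 powr q * level_kernel p q \<tau> (M / 2 ^ j) a b" by blast
      moreover have "32 powr q * level_kernel p q \<tau> (M / 2 ^ j) a b \<le> log_const p q * ?f j"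
        using level_kernel_nonneg cross_kernel_nonneg
        by (intro mult_mono) (auto simp: log_const_def le_max_iff_disj)
      ultimately show ?thesis by (intro exI[of _ j]) auto
    next
      case False
      then have "8 * A < B" by simp
      from log_far[OF pq \<open>0 < M\<close> \<open>0 \<le> \<tau>\<close> AB this] obtain j where
        "j \<le> J" "Psi p q (log 2 (B / A) * \<tau>)
          \<le> 2 * (3 + 2 / ((p - 1) / p)) powr q * cross_kernel p q \<tau> (M / 2 ^ j) a b" by blast
      moreover have "2 * (3 + 2 / ((p - 1) / p)) powr q * cross_kernel p q \<tau> (M / 2 ^ j) a b \<le> log_const p q * ?f j"
        using level_kernel_nonneg cross_kernel_nonneg
        by (intro mult_mono) (auto simp: log_const_def le_max_iff_disj)
      ultimately show ?thesis by (intro exI[of _ j]) auto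
    qed
    then obtain j where j: "j \<le> J" "Psi p q (log 2 (B / A) * \<tau>) \<le> log_const p q * ?f j" by blast
    have "?f j \<le> (\<Sum>j\<le>J. ?f j)" using j f0 by (intro member_le_sum) auto
    then have "log_const p q * ?f j \<le> log_const p q * (\<Sum>j\<le>J. ?f j)"
      using log_const_pos[of p q] by (intro mult_left_mono) auto
    then show ?thesis unfolding g using j by linarith
  qed
qed

text \<open>The pointwise bound is oriented, the cross term taking the smaller value first. Adding
  both orientations covers every pair, and Fubini identifies their integrals, which explains the
  factor 2.\<close>

lemma energy_log_clamp:
  fixes u :: "'a::euclidean_space \<Rightarrow> real"
  assumes [measurable]: "G \<in> sets borel" "u \<in> borel_measurable borel"
    and pq: "1 < p" "p \<le> q" and "0 < M"
  shows "energy p q s R G (\<lambda>x. log_clamp M J (u x)) \<le> ennreal (log_const p q) *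
    (\<Sum>j\<le>J. energy p q s R G (\<lambda>x. max (M / 2 ^ j - u x) 0 / (M / 2 ^ j)) + 2 * cross p q s R G u (M / 2 ^ j))"
proof -
  let ?L = "log_const p q"
  define \<tau> where "\<tau> x y = (R / norm (x - y)) powr s" for x y :: 'a
  define E where "E j x y = indicator G x * indicator G y *
      ennreal (level_kernel p q (\<tau> x y) (M / 2 ^ j) (u x) (u y) / norm (x - y) ^ DIM('a))" for j x y
  define X where "X j x y = indicator G x * indicator G y *
      ennreal (cross_kernel p q (\<tau> x y) (M / 2 ^ j) (u x) (u y) / norm (x - y) ^ DIM('a))" for j x y
  have [measurable]: "(\<lambda>(x, y). E j x y) \<in> borel_measurable (borel \<Otimes>\<^sub>M borel)" for j
    unfolding E_def level_kernel_def \<tau>_def by measurable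
  have mX [measurable]: "(\<lambda>(x, y). X j x y) \<in> borel_measurable (borel \<Otimes>\<^sub>M borel)" for j
    unfolding X_def cross_kernel_def \<tau>_def by measurable
  have \<tau>: "\<tau> y x = \<tau> x y" "0 \<le> \<tau> x y" for x y by (simp_all add: \<tau>_def norm_minus_commute)
  have pt: "indicator G x * indicator G y *
     ennreal (Psi p q (\<bar>log_clamp M J (u x) - log_clamp M J (u y)\<bar> * \<tau> x y) / norm (x - y) ^ DIM('a))
     \<le> ennreal ?L * (\<Sum>j\<le>J. E j x y + X j x y + X j y x)" for x y
  proof (cases "x \<in> G \<and> y \<in> G")
    case True
    let ?n = "norm (x - y) ^ DIM('a)" and ?P = "Psi p q (\<bar>log_clamp M J (u x) - log_clamp M J (u y)\<bar> * \<tau> x y)"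
    let ?l = "\<lambda>j. level_kernel p q (\<tau> x y) (M / 2 ^ j) (u x) (u y)" and ?c = "\<lambda>j. cross_kernel p q (\<tau> x y) (M / 2 ^ j) (u x) (u y)"
      and ?d = "\<lambda>j. cross_kernel p q (\<tau> x y) (M / 2 ^ j) (u y) (u x)"
    have sym: "level_kernel p q (\<tau> x y) k (u y) (u x) = level_kernel p q (\<tau> x y) k (u x) (u y)" for k
      by (simp add: level_kernel_def abs_minus_commute)
    have "?P
      \<le> ?L * (\<Sum>j\<le>J. ?l j
          + ?c j + ?d j)"
    proof (cases "u x \<le> u y")
      case True
      have "?P
        \<le> ?L * (\<Sum>j\<le>J. ?l j
          + ?c j)"
        using pq \<open>0 < M\<close> \<tau> True by (intro log_clamp_kernel) auto
      also have "\<dots> \<le> ?L * (\<Sum>j\<le>J. ?l j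
          + ?c j + ?d j)"
        using log_const_pos[of p q] cross_kernel_nonneg by (intro mult_left_mono sum_mono) auto
      finally show ?thesis .
    next
      case False
      have "Psi p q (\<bar>log_clamp M J (u y) - log_clamp M J (u x)\<bar> * \<tau> x y)
        \<le> ?L * (\<Sum>j\<le>J. level_kernel p q (\<tau> x y) (M / 2 ^ j) (u y) (u x)
          + ?d j)"
        using pq \<open>0 < M\<close> \<tau> False by (intro log_clamp_kernel) auto
      also have "\<dots> \<le> ?L * (\<Sum>j\<le>J. ?l j
          + ?c j + ?d j)"
        using log_const_pos[of p q] cross_kernel_nonneg by (intro mult_left_mono sum_mono) (auto simp: sym)
      finally show ?thesis by (simp add: abs_minus_commute)
    qed
    then have "?P / ?n
      \<le> ?L * (\<Sum>j\<le>J. ?l j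
          + ?c j + ?d j) / ?n"
      by (intro divide_right_mono) auto
    also have "\<dots> = ?L * (\<Sum>j\<le>J. ?l j / ?n
          + ?c j / ?n + ?d j / ?n)"
      by (simp only: times_divide_eq_right[symmetric] sum_divide_distrib add_divide_distrib)
    finally have "ennreal (?P / ?n)
      \<le> ennreal (?L * (\<Sum>j\<le>J. ?l j / ?n
          + ?c j / ?n + ?d j / ?n))"
      by (rule ennreal_leI)
    also have "\<dots> = ennreal ?L * (\<Sum>j\<le>J. E j x y + X j x y + X j y x)"
    proof -
      have "E j x y + X j x y + X j y x = ennreal (?l j / ?n
          + ?c j / ?n + ?d j / ?n)" for j
        using True unfolding E_def X_def
        by (simp add: \<tau>(1)[of y x] norm_minus_commute[of y x] level_kernel_nonneg cross_kernel_nonneg)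
      then show ?thesis
        using log_const_pos[of p q]
        by (simp add: ennreal_mult sum_nonneg level_kernel_nonneg cross_kernel_nonneg sum_ennreal del: ennreal_plus)
    qed
    finally show ?thesis using True by simp
  qed auto
  have swap: "(\<integral>\<^sup>+x. (\<integral>\<^sup>+y. X j y x \<partial>lborel) \<partial>lborel) = (\<integral>\<^sup>+x. (\<integral>\<^sup>+y. X j x y \<partial>lborel) \<partial>lborel)" for j
    by (rule lborel_pair.Fubini') measurable
  have "energy p q s R G (\<lambda>x. log_clamp M J (u x)) \<le> ennreal (1 - s) *
      (\<integral>\<^sup>+x. (\<integral>\<^sup>+y. ennreal ?L * (\<Sum>j\<le>J. E j x y + X j x y + X j y x) \<partial>lborel) \<partial>lborel)"
    unfolding energy_def using pt unfolding \<tau>_def by (intro mult_left_mono nn_integral_mono) auto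
  also have "\<dots> = ennreal (1 - s) * (ennreal ?L * (\<Sum>j\<le>J. (\<integral>\<^sup>+x. (\<integral>\<^sup>+y. E j x y \<partial>lborel) \<partial>lborel)
      + (\<integral>\<^sup>+x. (\<integral>\<^sup>+y. X j x y \<partial>lborel) \<partial>lborel) + (\<integral>\<^sup>+x. (\<integral>\<^sup>+y. X j y x \<partial>lborel) \<partial>lborel)))"
    by (simp add: nn_integral_cmult nn_integral_sum nn_integral_add)
  also have "\<dots> = ennreal ?L * (\<Sum>j\<le>J. ennreal (1 - s) * (\<integral>\<^sup>+x. (\<integral>\<^sup>+y. E j x y \<partial>lborel) \<partial>lborel)
      + 2 * (ennreal (1 - s) * (\<integral>\<^sup>+x. (\<integral>\<^sup>+y. X j x y \<partial>lborel) \<partial>lborel)))"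
    unfolding swap by (simp add: sum_distrib_left algebra_simps mult_2)
  also have "\<dots> = ennreal ?L * (\<Sum>j\<le>J. energy p q s R G (\<lambda>x. max (M / 2 ^ j - u x) 0 / (M / 2 ^ j)) + 2 * cross p q s R G u (M / 2 ^ j))"
  proof -
    have "ennreal (1 - s) * (\<integral>\<^sup>+x. (\<integral>\<^sup>+y. E j x y \<partial>lborel) \<partial>lborel) = energy p q s R G (\<lambda>x. max (M / 2 ^ j - u x) 0 / (M / 2 ^ j))" for j
      unfolding energy_def E_def level_kernel_def \<tau>_def ..
    moreover have "ennreal (1 - s) * (\<integral>\<^sup>+x. (\<integral>\<^sup>+y. X j x y \<partial>lborel) \<partial>lborel) = cross p q s R G u (M / 2 ^ j)" for j
      unfolding cross_def X_def cross_kernel_def \<tau>_def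
      by (intro arg_cong2[where f = "(*)"] nn_integral_cong refl) auto
    ultimately show ?thesis by simp
  qed
  finally show ?thesis .
qed

section \<open>Growth lemma\<close>

text \<open>The parameter $\delta = J^{1/p}$ balances the two terms in the bound for the increments.\<close>

lemma sublevel_measure_shrinks:
  fixes u :: "'a::euclidean_space \<Rightarrow> real" and N J :: nat
  assumes [measurable]: "u \<in> borel_measurable borel"
    and par: "1 < p" "p \<le> q" "0 < s" "s < 1" "0 \<le> \<Lambda>" "0 \<le> b" and "0 < R" "0 < M" "0 < \<sigma>" "1 \<le> J"
    and caccioppoli: "\<And>j. j \<le> J \<Longrightarrow> caccioppoli p q s \<Lambda> b u x0 R (M / 2 ^ j)"
    and N: "2 \<le> N" "unit_ball_vol (real DIM('a)) * 3 / N \<le> \<sigma>"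
    and dens: "\<sigma> * R ^ DIM('a) \<le> measure lborel {x \<in> ball x0 (3 / 4 * R). M \<le> u x}"
  shows "measure lborel {x \<in> ball x0 (3 / 4 * R). u x < M / 2 ^ J} \<le>
    2 / \<sigma> * (2 ^ DIM('a) * 2 * (2 * unit_ball_vol (real DIM('a)) * unit_ball_vol (real DIM('a)) +
      q * ln N * (log_const p q * (6 * (\<Lambda> * 4 powr b * unit_ball_vol (real DIM('a))))))) * real J powr (1 / p - 1) * R ^ DIM('a)"
proof -
  let ?V = "unit_ball_vol (real DIM('a))"
  let ?d = "DIM('a)"
  define G where "G = ball x0 (3 / 4 * R)"
  define g where "g x = log_clamp M J (u x)" for x
  define Y where "Y = {x \<in> G. u x < M / 2 ^ J}"
  define Z where "Z = {x \<in> G. M \<le> u x}"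
  \<comment> \<open>The diameter of \<open>G\<close>, so that any two points of \<open>G\<close>
    differ by less than h and the shell misses only differences shorter than h/N.\<close>
  define h where "h = 3 / 2 * R"
  define \<delta> where "\<delta> = real J powr (1 / p)"
  define E where "E = \<Lambda> * 4 powr b * ?V"
  define K where "K = 2 * ?V * ?V + q * ln N * (log_const p q * (6 * E))"
  have [measurable]: "G \<in> sets borel" "g \<in> borel_measurable borel" "Y \<in> sets borel" "Z \<in> sets borel"
    unfolding G_def g_def Y_def Z_def by measurable
  have V: "0 < ?V" by simp
  have h: "0 < h" using \<open>0 < R\<close> by (simp add: h_def)
  have NN: "2 \<le> real N" using N by simp
  have \<delta>: "1 \<le> \<delta>" using \<open>1 \<le> J\<close> par by (auto simp: \<delta>_def intro!: ge_one_powr_ge_zero)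
  have E0: "0 \<le> E" using par V by (simp add: E_def)
  have Rd: "0 < R ^ ?d" using \<open>0 < R\<close> by simp
  have eY: "emeasure lborel Y = ennreal (measure lborel Y)"
    unfolding Y_def G_def by (rule emeasure_in_ball[of _ x0 "3 / 4 * R"]) auto
  have eZ: "emeasure lborel Z = ennreal (measure lborel Z)"
    unfolding Z_def G_def by (rule emeasure_in_ball[of _ x0 "3 / 4 * R"]) auto
  have Z: "\<sigma> * R ^ ?d \<le> measure lborel Z" using dens by (simp add: Z_def G_def)
  have bG: "emeasure lborel S \<le> ennreal (?V * R ^ ?d)" if "S \<subseteq> ball x0 R" for S :: "'a set"
    using emeasure_mono[of S "ball x0 R" lborel] that \<open>0 < R\<close> by (simp add: emeasure_ball)
  have G_sub: "G \<subseteq> ball x0 R" using \<open>0 < R\<close> by (auto simp: G_def)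
  let ?I = "\<integral>\<^sup>+z\<in>shell N h. incr G g z \<partial>lborel"
  have low: "ennreal (J * (\<sigma> * R ^ ?d / 2)) * emeasure lborel Y \<le> ?I"
  proof (rule incr_shell_ge)
    show "Y \<subseteq> G" by (auto simp: Y_def)
    fix x assume x: "x \<in> Y"
    let ?B = "ball (0::'a) (h / N)"
    let ?J = "\<integral>\<^sup>+z\<in>shell N h. indicator G (z + x) * ennreal \<bar>g (z + x) - g x\<bar> \<partial>lborel"
    have gx: "g x = J" using x \<open>0 < M\<close> by (auto simp: Y_def g_def intro!: log_clamp_le)
    have pt: "ennreal J * indicator Z (x + z)
       \<le> indicator G (z + x) * ennreal \<bar>g (z + x) - g x\<bar> * indicator (shell N h) z + ennreal J * indicator ?B z" for z
    proof (cases "x + z \<in> Z \<and> z \<notin> ?B")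
      case True
      then have in_G: "x + z \<in> G" by (simp add: Z_def)
      have "norm z \<le> dist x0 (x + z) + dist x0 x"
        by (metis add.commute add_diff_cancel_right' dist_commute dist_norm dist_triangle2 dist_triangle)
      then have "norm z < h" using in_G x by (auto simp: G_def Y_def h_def)
      then have "z \<in> shell N h" using True by (auto simp: shell_def)
      moreover have "g (x + z) = 0" using True \<open>0 < M\<close> by (auto simp: Z_def g_def intro!: log_clamp_ge)
      ultimately show ?thesis using True in_G by (simp add: gx add.commute)
    qed (auto simp: indicator_def)
    \<comment> \<open>N is chosen so that the small ball left out of the shell hides at most half of
      the guaranteed measure of \<open>Z\<close>.\<close>
    have Bm: "ennreal J * emeasure lborel ?B \<le> ennreal (J * (\<sigma> * R ^ ?d / 2))"
    proof -
      have "(h / N) ^ ?d \<le> (3 / 2 / N) * R ^ ?d"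
      proof -
        have "(3 / 2 / N) ^ ?d \<le> (3 / 2 / N) ^ 1"
          using NN DIM_positive[where 'a='a] by (intro power_decreasing) (auto simp: field_simps)
        then have "(3 / 2 / N) ^ ?d * R ^ ?d \<le> (3 / 2 / N) * R ^ ?d"
          using Rd by (intro mult_right_mono) auto
        then show ?thesis by (simp add: h_def power_mult_distrib[symmetric])
      qed
      then have "?V * (h / N) ^ ?d \<le> ?V * ((3 / 2 / N) * R ^ ?d)" using V by (intro mult_left_mono) auto
      also have "\<dots> = (?V * 3 / N) * (R ^ ?d / 2)" by simp
      also have "\<dots> \<le> \<sigma> * (R ^ ?d / 2)" using N Rd by (intro mult_right_mono) auto
      finally have "emeasure lborel ?B \<le> ennreal (\<sigma> * R ^ ?d / 2)"
        using h NN by (subst emeasure_ball) (auto intro!: ennreal_leI)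
      then have "ennreal J * emeasure lborel ?B \<le> ennreal J * ennreal (\<sigma> * R ^ ?d / 2)"
        by (intro mult_left_mono) auto
      then show ?thesis using \<open>0 < \<sigma>\<close> Rd by (subst ennreal_mult) auto
    qed
    have "ennreal (J * measure lborel Z) = ennreal J * (\<integral>\<^sup>+z. indicator Z (x + z) \<partial>lborel)"
      by (subst nn_integral_lborel_translate[where f = "indicator Z"]) (auto simp: eZ ennreal_mult)
    also have "\<dots> = (\<integral>\<^sup>+z. ennreal J * indicator Z (x + z) \<partial>lborel)"
      by (rule nn_integral_cmult[symmetric]) measurable
    also have "\<dots> \<le> (\<integral>\<^sup>+z. indicator G (z + x) * ennreal \<bar>g (z + x) - g x\<bar> * indicator (shell N h) z + ennreal J * indicator ?B z \<partial>lborel)"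
      by (intro nn_integral_mono pt)
    also have "\<dots> = ?J + ennreal J * emeasure lborel ?B"
    proof -
      have "(\<integral>\<^sup>+z. ennreal J * indicator ?B z \<partial>lborel) = ennreal J * emeasure lborel ?B"
        by (rule nn_integral_cmult_indicator) simp
      moreover have "(\<lambda>z. ennreal J * indicator ?B z) \<in> borel_measurable lborel"
        by (intro borel_measurable_times_ennreal borel_measurable_indicator borel_measurable_const) simp
      moreover have "(\<lambda>z. indicator G (z + x) * ennreal \<bar>g (z + x) - g x\<bar> * indicator (shell N h) z) \<in> borel_measurable lborel"
        by measurable
      ultimately show ?thesis by (simp only: nn_integral_add)
    qed
    also have "\<dots> \<le> ?J + ennreal (J * (\<sigma> * R ^ ?d / 2))" by (intro add_left_mono Bm)
    finally have "ennreal (J * measure lborel Z) - ennreal (J * (\<sigma> * R ^ ?d / 2)) \<le> ?J"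
      by (simp add: ennreal_minus_le_iff add.commute)
    moreover have "ennreal (J * (\<sigma> * R ^ ?d / 2)) \<le> ennreal (J * measure lborel Z) - ennreal (J * (\<sigma> * R ^ ?d / 2))"
    proof -
      have "J * (\<sigma> * R ^ ?d) \<le> J * measure lborel Z" using Z by (intro mult_left_mono) auto
      then show ?thesis using \<open>0 < \<sigma>\<close> Rd by (subst ennreal_minus, simp, intro ennreal_leI) linarith
    qed
    ultimately show "ennreal (J * (\<sigma> * R ^ ?d / 2)) \<le> ?J" by (rule order_trans[rotated])
  qed measurable
  \<comment> \<open>Each of the J+1 \<le> 2J levels contributes one energy and two cross terms, each
    at most E R^d; hence 6E J. The sublevel sets are bounded by the full ball, so smallness has to
    come from the growth of J alone.\<close>
  have en: "energy p q s R G g \<le> ennreal (log_const p q * (6 * E) * J * R ^ ?d)"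
  proof -
    have 4: "R / (R - 3 / 4 * R) = 4" using \<open>0 < R\<close> by (simp add: field_simps)
    have lev: "energy p q s R G (\<lambda>x. max (M / 2 ^ j - u x) 0 / (M / 2 ^ j)) \<le> ennreal (E * R ^ ?d)"
      "cross p q s R G u (M / 2 ^ j) \<le> ennreal (E * R ^ ?d)" if "j \<le> J" for j
    proof -
      have rr: "R / 2 \<le> 3 / 4 * R" "3 / 4 * R < R" "R \<le> R" using \<open>0 < R\<close> by auto
      have "ennreal (\<Lambda> * (R / (R - 3 / 4 * R)) powr b) * emeasure lborel {x \<in> ball x0 R. u x < M / 2 ^ j}
          \<le> ennreal (\<Lambda> * 4 powr b) * ennreal (?V * R ^ ?d)"
        unfolding 4 by (intro mult_left_mono bG) auto
      also have "\<dots> = ennreal (E * R ^ ?d)"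
        using par V Rd by (subst ennreal_mult[symmetric]) (auto simp: E_def mult_ac)
      finally have *: "ennreal (\<Lambda> * (R / (R - 3 / 4 * R)) powr b) * emeasure lborel {x \<in> ball x0 R. u x < M / 2 ^ j}
          \<le> ennreal (E * R ^ ?d)" .
      show "energy p q s R G (\<lambda>x. max (M / 2 ^ j - u x) 0 / (M / 2 ^ j)) \<le> ennreal (E * R ^ ?d)"
        "cross p q s R G u (M / 2 ^ j) \<le> ennreal (E * R ^ ?d)"
        using caccioppoli[OF that] rr * unfolding caccioppoli_def G_def by (blast intro: order_trans)+
    qed
    have "energy p q s R G g \<le> ennreal (log_const p q) *
      (\<Sum>j\<le>J. energy p q s R G (\<lambda>x. max (M / 2 ^ j - u x) 0 / (M / 2 ^ j)) + 2 * cross p q s R G u (M / 2 ^ j))"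
      unfolding g_def using par \<open>0 < M\<close> by (intro energy_log_clamp) auto
    also have "\<dots> \<le> ennreal (log_const p q) * (\<Sum>j\<le>J. ennreal (E * R ^ ?d) + 2 * ennreal (E * R ^ ?d))"
      by (intro mult_left_mono sum_mono add_mono lev) auto
    also have "\<dots> = ennreal (log_const p q * ((J + 1) * (3 * (E * R ^ ?d))))"
    proof -
      have "ennreal (E * R ^ ?d) + 2 * ennreal (E * R ^ ?d) = ennreal (3 * (E * R ^ ?d))"
      proof -
        have t: "0 \<le> E * R ^ ?d" using E0 Rd by simp
        then have "ennreal (3 * (E * R ^ ?d)) = ennreal (E * R ^ ?d + (E * R ^ ?d + E * R ^ ?d))" by simp
        also have "\<dots> = ennreal (E * R ^ ?d) + (ennreal (E * R ^ ?d) + ennreal (E * R ^ ?d))"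
          using t by (simp only: ennreal_plus add_nonneg_nonneg)
        finally show ?thesis by (simp add: mult_2)
      qed
      then show ?thesis
        using log_const_pos[of p q] E0 Rd
        by (simp only: sum_constant card_atMost ennreal_of_nat_eq_real_of_nat)
          (subst ennreal_mult[symmetric], simp_all add: less_imp_le ennreal_mult[symmetric] mult_ac)
    qed
    also have "\<dots> \<le> ennreal (log_const p q * (6 * E) * J * R ^ ?d)"
    proof (rule ennreal_leI)
      have "(J + 1) * (3 * (E * R ^ ?d)) \<le> (2 * J) * (3 * (E * R ^ ?d))"
        using \<open>1 \<le> J\<close> E0 Rd by (intro mult_right_mono) auto
      then have "log_const p q * ((J + 1) * (3 * (E * R ^ ?d))) \<le> log_const p q * ((2 * J) * (3 * (E * R ^ ?d)))"
        using log_const_pos[of p q] by (intro mult_left_mono) auto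
      then show "log_const p q * ((J + 1) * (3 * (E * R ^ ?d))) \<le> log_const p q * (6 * E) * J * R ^ ?d"
        by (simp add: mult_ac)
    qed
    finally show ?thesis .
  qed
  have "?I \<le> ennreal (h ^ ?d * (h / R) powr s) * (ennreal (2 * \<delta> * ?V) * emeasure lborel {x \<in> G. g x \<noteq> 0}
      + ennreal (q * ln N / Psi (p - 1) (q - 1) \<delta>) * energy p q s R G g)"
    using par \<delta> N \<open>0 < R\<close> h by (intro incr_shell_le_energy) (auto simp: G_def)
  also have "\<dots> \<le> ennreal (h ^ ?d * 2) * (ennreal (2 * \<delta> * ?V) * ennreal (?V * R ^ ?d)
      + ennreal (q * ln N / Psi (p - 1) (q - 1) \<delta>) * ennreal (log_const p q * (6 * E) * J * R ^ ?d))"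
  proof (intro mult_mono add_mono mult_left_mono en bG ennreal_leI)
    have hR: "h / R = 3 / 2" using \<open>0 < R\<close> by (simp add: h_def)
    have "(h / R) powr s \<le> (3 / 2) powr 1"
      unfolding hR using par by (intro powr_mono) auto
    then show "(h / R) powr s \<le> 2" by simp
  qed (use G_sub h \<delta> in auto)
  also have "Psi (p - 1) (q - 1) \<delta> = \<delta> powr (p - 1)" using \<delta> par by (simp add: Psi_ge_1)
  also have "ennreal (h ^ ?d * 2) * (ennreal (2 * \<delta> * ?V) * ennreal (?V * R ^ ?d)
      + ennreal (q * ln N / \<delta> powr (p - 1)) * ennreal (log_const p q * (6 * E) * J * R ^ ?d))
      = ennreal (h ^ ?d * 2 * (2 * \<delta> * ?V * (?V * R ^ ?d) + q * ln N / \<delta> powr (p - 1) * (log_const p q * (6 * E) * J * R ^ ?d)))"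
    using h \<delta> V Rd par NN log_const_pos[of p q] E0
    by (simp add: ennreal_mult[symmetric] less_imp_le flip: ennreal_plus)
  also have "h ^ ?d * 2 * (2 * \<delta> * ?V * (?V * R ^ ?d) + q * ln N / \<delta> powr (p - 1) * (log_const p q * (6 * E) * J * R ^ ?d))
      = h ^ ?d * 2 * (K * \<delta> * R ^ ?d)"
  proof -
    have "J / \<delta> powr (p - 1) = \<delta>"
    proof -
      have "\<delta> powr (p - 1) = \<delta> powr p / \<delta>" using \<delta> by (simp add: powr_diff)
      also have "\<delta> powr p = J" using par by (simp add: \<delta>_def powr_powr)
      finally show ?thesis using \<open>1 \<le> J\<close> \<delta> by simp
    qed
    moreover have "q * ln N / \<delta> powr (p - 1) * (log_const p q * (6 * E) * J * R ^ ?d)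
        = q * ln N * (log_const p q * (6 * E)) * R ^ ?d * (J / \<delta> powr (p - 1))"
      by simp
    ultimately show ?thesis by (simp only: K_def distrib_left distrib_right mult_ac)
  qed
  finally have "ennreal (J * (\<sigma> * R ^ ?d / 2)) * ennreal (measure lborel Y) \<le> ennreal (h ^ ?d * 2 * (K * \<delta> * R ^ ?d))"
    using low unfolding eY by (rule order_trans[rotated])
  moreover have K0: "0 \<le> K" using V par NN E0 log_const_pos[of p q] by (simp add: K_def)
  ultimately have "J * (\<sigma> * R ^ ?d / 2) * measure lborel Y \<le> h ^ ?d * 2 * (K * \<delta> * R ^ ?d)"
    using \<open>0 < \<sigma>\<close> Rd \<delta> h by (subst (asm) ennreal_mult[symmetric]) auto
  also have "\<dots> \<le> (2 ^ ?d * R ^ ?d) * 2 * (K * \<delta> * R ^ ?d)"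
  proof -
    have "h ^ ?d \<le> (2 * R) ^ ?d" using \<open>0 < R\<close> by (intro power_mono) (auto simp: h_def)
    then show ?thesis using K0 \<delta> Rd by (intro mult_right_mono) (auto simp: power_mult_distrib)
  qed
  finally have "R ^ ?d * (J * (\<sigma> / 2) * measure lborel Y) \<le> R ^ ?d * (2 ^ ?d * 2 * K * \<delta> * R ^ ?d)"
    by (simp add: mult_ac)
  then have "J * (\<sigma> / 2) * measure lborel Y \<le> 2 ^ ?d * 2 * K * \<delta> * R ^ ?d"
    using Rd by (rule mult_left_le_imp_le)
  then have "measure lborel Y \<le> 2 ^ ?d * 2 * K * \<delta> * R ^ ?d / (J * (\<sigma> / 2))"
    using \<open>1 \<le> J\<close> \<open>0 < \<sigma>\<close> by (subst pos_le_divide_eq) (auto simp: mult_ac)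
  also have "\<dots> = 2 / \<sigma> * (2 ^ ?d * 2 * K) * (\<delta> / J) * R ^ ?d" by (simp add: mult_ac)
  also have "\<delta> / J = real J powr (1 / p - 1)" using \<open>1 \<le> J\<close> by (simp add: \<delta>_def powr_diff)
  finally show ?thesis unfolding Y_def G_def K_def E_def .
qed

text \<open>J is taken so large that the shrunken sublevel set falls below the critical density of
  \<open>degiorgi_lemma\<close>; this is possible because J^(1/p-1) tends to 0 for p > 1. The
  constant \<delta> = 2^(-J)/2 records the J levels and the final halving.\<close>

lemma growth_lemma:
  fixes s0 p q \<Lambda> b \<sigma> :: real
  assumes par: "0 < s0" "1 < p" "p \<le> q" "0 \<le> \<Lambda>" "1 \<le> b" "0 < \<sigma>"
  obtains \<delta> where "0 < \<delta>" "\<delta> < 1"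
    "\<And>s (u :: 'a::euclidean_space \<Rightarrow> real) x0 R M. \<lbrakk>s0 \<le> s; s < 1; u \<in> borel_measurable borel; 0 < R; 0 < M;
       \<And>x. x \<in> ball x0 R \<Longrightarrow> 0 \<le> u x; \<And>l. \<delta> * M \<le> l \<Longrightarrow> caccioppoli p q s \<Lambda> b u x0 R l;
       \<sigma> * R ^ DIM('a) \<le> measure lborel {x \<in> ball x0 (3 / 4 * R). M \<le> u x}\<rbrakk>
     \<Longrightarrow> AE x in lborel. x \<in> ball x0 (R / 2) \<longrightarrow> \<delta> * M \<le> u x"
proof -
  let ?V = "unit_ball_vol (real DIM('a))"
  have "1 \<le> p" using par by simp
  obtain \<eta> where \<eta>: "0 < \<eta>"
    and DG: "\<And>s (u :: 'a \<Rightarrow> real) x0 R k. \<lbrakk>s0 \<le> s; s < 1; u \<in> borel_measurable borel; 0 < R; 0 < k;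
       \<And>x. x \<in> ball x0 R \<Longrightarrow> 0 \<le> u x; \<And>l. k / 2 \<le> l \<Longrightarrow> l \<le> k \<Longrightarrow> caccioppoli p q s \<Lambda> b u x0 R l;
       measure lborel {x \<in> ball x0 (3 / 4 * R). u x < k} \<le> \<eta> * R ^ DIM('a)\<rbrakk>
     \<Longrightarrow> AE x in lborel. x \<in> ball x0 (R / 2) \<longrightarrow> k / 2 \<le> u x"
    using degiorgi_lemma[OF par(1) \<open>1 \<le> p\<close> par(3,4,5), where 'a = 'a] by blast
  define N where "N = nat \<lceil>?V * 3 / \<sigma>\<rceil> + 2"
  have "?V * 3 / \<sigma> \<le> real N" unfolding N_def by linarith
  moreover have N2: "2 \<le> N" by (simp add: N_def)
  ultimately have N: "2 \<le> N" "?V * 3 / N \<le> \<sigma>"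
    using par by (simp_all add: pos_divide_le_eq mult.commute)
  define D where "D = 2 / \<sigma> * (2 ^ DIM('a) * 2 * (2 * ?V * ?V + q * ln N * (log_const p q * (6 * (\<Lambda> * 4 powr b * ?V)))))"
  have "(\<lambda>J. D * real J powr (1 / p - 1)) \<longlonglongrightarrow> D * 0"
    using par by (intro tendsto_mult tendsto_const tendsto_neg_powr filterlim_real_sequentially) auto
  then have "eventually (\<lambda>J. D * real J powr (1 / p - 1) < \<eta>) sequentially"
    using \<eta> by (intro order_tendstoD) auto
  then obtain J0 where "\<And>J. J0 \<le> J \<Longrightarrow> D * real J powr (1 / p - 1) < \<eta>"
    by (auto simp: eventually_sequentially)
  then obtain J where J: "1 \<le> J" "D * real J powr (1 / p - 1) \<le> \<eta>"
    by (metis less_imp_le max.cobounded1 max.cobounded2)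
  define \<delta> where "\<delta> = (1 / 2 ^ J) / (2::real)"
  have "(1::real) \<le> 2 ^ J" by simp
  then have "(1::real) < 2 ^ J * 2" by linarith
  then have \<delta>: "0 < \<delta>" "\<delta> < 1" by (auto simp: \<delta>_def divide_less_eq)
  show ?thesis
  proof (rule that[OF \<delta>])
    fix s R M :: real and u :: "'a \<Rightarrow> real" and x0 :: 'a
    assume s: "s0 \<le> s" "s < 1" and u: "u \<in> borel_measurable borel" and "0 < R" "0 < M"
      and nn: "\<And>x. x \<in> ball x0 R \<Longrightarrow> 0 \<le> u x"
      and caccioppoli: "\<And>l. \<delta> * M \<le> l \<Longrightarrow> caccioppoli p q s \<Lambda> b u x0 R l"
      and dens: "\<sigma> * R ^ DIM('a) \<le> measure lborel {x \<in> ball x0 (3 / 4 * R). M \<le> u x}"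
    have lev: "\<delta> * M \<le> M / 2 ^ j" if "j \<le> J" for j
    proof -
      have "M / 2 ^ J \<le> M / 2 ^ j"
        using that \<open>0 < M\<close> by (intro divide_left_mono power_increasing) auto
      moreover have "\<delta> * M \<le> M / 2 ^ J" using \<open>0 < M\<close> by (simp add: \<delta>_def field_simps)
      ultimately show ?thesis by linarith
    qed
    have "measure lborel {x \<in> ball x0 (3 / 4 * R). u x < M / 2 ^ J} \<le> D * real J powr (1 / p - 1) * R ^ DIM('a)"
      unfolding D_def
      using par s u \<open>0 < R\<close> \<open>0 < M\<close> J caccioppoli lev N dens by (intro sublevel_measure_shrinks) auto
    also have "\<dots> \<le> \<eta> * R ^ DIM('a)" using J \<open>0 < R\<close> by (intro mult_right_mono) auto
    finally have small: "measure lborel {x \<in> ball x0 (3 / 4 * R). u x < M / 2 ^ J} \<le> \<eta> * R ^ DIM('a)" .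
    have "AE x in lborel. x \<in> ball x0 (R / 2) \<longrightarrow> M / 2 ^ J / 2 \<le> u x"
    proof (rule DG[OF s u \<open>0 < R\<close> _ nn _ small])
      fix l assume "M / 2 ^ J / 2 \<le> l"
      then have "\<delta> * M \<le> l" by (simp add: \<delta>_def mult.commute)
      then show "caccioppoli p q s \<Lambda> b u x0 R l" by (rule caccioppoli)
    qed (use \<open>0 < M\<close> in auto)
    then show "AE x in lborel. x \<in> ball x0 (R / 2) \<longrightarrow> \<delta> * M \<le> u x"
      by (simp add: \<delta>_def mult.commute)
  qed
qed

section \<open>Clustering and propagation of positivity\<close>

text \<open>If no such ball existed, then around every point where u \<ge> M at least half of the
  shell of radius h would meet {u < M/2}, and w would rise there from 0 to at least 1/2. This forces
  an averaged increment that the energy at level M excludes once h satisfies the stated smallness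
  condition. The centre keeps the distance 2 \<tau> R from the boundary, which the propagation
  uses.\<close>

lemma clustering:
  fixes u :: "'a::euclidean_space \<Rightarrow> real"
  assumes [measurable]: "u \<in> borel_measurable borel"
    and par: "1 \<le> p" "p \<le> q" "0 < s" "s < 1" "0 \<le> \<Lambda>" "0 \<le> b" and "0 < R" "0 < M"
    and nn: "\<And>x. x \<in> ball x0 R \<Longrightarrow> 0 \<le> u x"
    and caccioppoli: "caccioppoli p q s \<Lambda> b u x0 R M"
    and \<sigma>: "0 < \<sigma>" "\<sigma> \<le> 1" and \<tau>: "\<tau> = \<sigma> / (4 * real DIM('a))"
    and dens: "\<sigma> * (unit_ball_vol (real DIM('a)) * R ^ DIM('a)) \<le> measure lborel {x \<in> ball x0 R. M \<le> u x}"
    and h: "0 < h" "h \<le> \<tau> * R"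
      "16 * (h / R) powr s * (2 * unit_ball_vol (real DIM('a)) + q * \<Lambda> * (1 / \<tau>) powr b) < \<sigma> * unit_ball_vol (real DIM('a))"
  shows "\<exists>x. dist x0 x < (1 - 2 * \<tau>) * R \<and>
    unit_ball_vol (real DIM('a)) * h ^ DIM('a) / 4 \<le> measure lborel {y \<in> ball x h. M / 2 \<le> u y}"
proof (rule ccontr)
  assume contra: "\<not> ?thesis"
  let ?V = "unit_ball_vol (real DIM('a))"
  let ?d = "DIM('a)"
  define G where "G = ball x0 ((1 - \<tau>) * R)"
  define w where "w x = max (M - u x) 0 / M" for x
  define X where "X = {x \<in> ball x0 ((1 - 2 * \<tau>) * R). M \<le> u x}"
  define S where "S = measure lborel (shell 2 h :: 'a set)"
  have [measurable]: "G \<in> sets borel" "w \<in> borel_measurable borel" "X \<in> sets borel"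
    unfolding G_def w_def X_def by measurable
  have V: "0 < ?V" by simp
  have d: "1 \<le> real ?d" using DIM_positive[where 'a='a] by linarith
  have \<tau>': "0 < \<tau>" "\<tau> \<le> 1 / 4"
  proof -
    show "0 < \<tau>" using \<sigma> d by (simp add: \<tau>)
    have "\<sigma> / (4 * real ?d) \<le> 1 / (4 * 1)" using \<sigma> d by (intro frac_le) auto
    then show "\<tau> \<le> 1 / 4" by (simp add: \<tau>)
  qed
  have Rd: "0 < R ^ ?d" using \<open>0 < R\<close> by simp
  have eS: "emeasure lborel (shell 2 h :: 'a set) = ennreal S"
    unfolding S_def by (rule emeasure_in_ball[OF shell_subset_ball])
  have S: "?V * h ^ ?d / 2 \<le> S" unfolding S_def using h by (intro measure_shell_2)
  have eX: "emeasure lborel X = ennreal (measure lborel X)"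
    unfolding X_def by (rule emeasure_in_ball[of _ x0 "(1 - 2 * \<tau>) * R"]) auto
  \<comment> \<open>The choice of \<tau> makes the boundary layer of width 2 \<tau> R small: by
    Bernoulli (1 - 2\<tau>)^d \<ge> 1 - \<sigma>/2, so the layer removes at most half of the measure
    guaranteed by \<open>dens\<close>.\<close>
  have Xm: "\<sigma> / 2 * (?V * R ^ ?d) \<le> measure lborel X"
  proof -
    let ?A = "ball x0 R - ball x0 ((1 - 2 * \<tau>) * R)"
    have sub: "ball x0 ((1 - 2 * \<tau>) * R) \<subseteq> ball x0 R"
      using \<tau>' \<open>0 < R\<close> by (intro subset_ball) (simp add: mult_le_cancel_right1)
    have "measure lborel {x \<in> ball x0 R. M \<le> u x} \<le> measure lborel (X \<union> ?A)"
      using sub by (intro measure_mono_in_ball[of _ _ x0 R]) (auto simp: X_def)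
    also have "\<dots> \<le> measure lborel X + measure lborel ?A"
      by (rule measure_Un_le) auto
    also have "measure lborel ?A = ?V * R ^ ?d - ?V * ((1 - 2 * \<tau>) * R) ^ ?d"
      using sub \<tau>' \<open>0 < R\<close> emeasure_in_ball[of "ball x0 R" x0 R]
      by (subst measure_Diff) (auto simp: content_ball)
    also have "\<dots> \<le> \<sigma> / 2 * (?V * R ^ ?d)"
    proof -
      have "1 + real ?d * (- 2 * \<tau>) \<le> (1 + (- 2 * \<tau>)) ^ ?d"
        using \<tau>' by (intro Bernoulli_inequality) auto
      then have "1 - \<sigma> / 2 \<le> (1 - 2 * \<tau>) ^ ?d" using d by (simp add: \<tau>)
      then have "(1 - \<sigma> / 2) * (?V * R ^ ?d) \<le> (1 - 2 * \<tau>) ^ ?d * (?V * R ^ ?d)"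
        using V Rd by (intro mult_right_mono) auto
      then show ?thesis unfolding power_mult_distrib by (simp add: algebra_simps)
    qed
    finally show ?thesis using dens by simp
  qed
  let ?I = "\<integral>\<^sup>+z\<in>shell 2 h. incr G w z \<partial>lborel"
  have low: "ennreal (S / 4) * emeasure lborel X \<le> ?I"
  proof (rule incr_shell_ge)
    have "(1 - 2 * \<tau>) * R \<le> (1 - \<tau>) * R" using \<tau>' \<open>0 < R\<close> by (intro mult_right_mono) auto
    then show "X \<subseteq> G" unfolding X_def G_def by auto
    fix x assume x: "x \<in> X"
    \<comment> \<open>\<open>P\<close> translates into the superlevel set in
      \<open>ball x h\<close>. By the negated claim its measure is below a quarter of the ball,
      hence at most half of the shell, and \<open>Q\<close> has at least the other half.\<close>
    define P where "P = {z \<in> shell 2 h. M / 2 \<le> u (x + z)}"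
    define Q where "Q = {z \<in> shell 2 h. u (x + z) < M / 2}"
    have [measurable]: "P \<in> sets borel" "Q \<in> sets borel"
      unfolding P_def Q_def by measurable
    have PQ: "shell 2 h = P \<union> Q" "P \<inter> Q = {}" by (auto simp: P_def Q_def)
    have Ph: "P \<subseteq> ball 0 h" "Q \<subseteq> ball 0 h" by (auto simp: P_def Q_def shell_def)
    have "measure lborel P \<le> measure lborel {y \<in> ball x h. M / 2 \<le> u y}"
    proof -
      let ?T = "{y \<in> ball x h. M / 2 \<le> u y}"
      have "emeasure lborel P = (\<integral>\<^sup>+z. indicator P z \<partial>lborel)" by simp
      also have "\<dots> \<le> (\<integral>\<^sup>+z. indicator ?T (x + z) \<partial>lborel)"
        by (intro nn_integral_mono) (auto simp: P_def shell_def indicator_def dist_norm)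
      also have "\<dots> = emeasure lborel ?T"
        by (subst nn_integral_lborel_translate[where f = "indicator ?T"]) auto
      finally have "emeasure lborel P \<le> emeasure lborel ?T" .
      moreover have "?T \<subseteq> ball x h" by auto
      ultimately show ?thesis
        using emeasure_in_ball[OF Ph(1)] emeasure_in_ball[of ?T x h] by simp
    qed
    moreover have "measure lborel {y \<in> ball x h. M / 2 \<le> u y} < ?V * h ^ ?d / 4"
      using contra x by (auto simp: X_def not_le)
    ultimately have P: "measure lborel P \<le> S / 2" using S by linarith
    have "S = measure lborel P + measure lborel Q"
      unfolding S_def PQ(1) using Ph PQ emeasure_in_ball[of P 0 h] emeasure_in_ball[of Q 0 h]
      by (intro measure_Union) auto
    with P have "S / 2 \<le> measure lborel Q" by linarith
    then have "ennreal (S / 4) \<le> ennreal (1 / 2 * measure lborel Q)" by (intro ennreal_leI) simp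
    also have "\<dots> = ennreal (1 / 2) * emeasure lborel Q"
      unfolding emeasure_in_ball[OF Ph(2)] by (rule ennreal_mult) auto
    also have "\<dots> = (\<integral>\<^sup>+z. ennreal (1 / 2) * indicator Q z \<partial>lborel)"
      by (rule nn_integral_cmult_indicator[symmetric]) simp
    also have "\<dots> \<le> (\<integral>\<^sup>+z\<in>shell 2 h. indicator G (z + x) * ennreal \<bar>w (z + x) - w x\<bar> \<partial>lborel)"
    proof (rule nn_integral_mono)
      fix z :: 'a
      show "ennreal (1 / 2) * indicator Q z \<le> indicator G (z + x) * ennreal \<bar>w (z + x) - w x\<bar> * indicator (shell 2 h) z"
      proof (cases "z \<in> Q")
        case True
        have "norm z < \<tau> * R" using True h by (auto simp: Q_def shell_def)
        moreover have "dist x0 (z + x) \<le> dist x0 x + norm z"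
          using norm_triangle_ineq4[of "x0 - x" z] by (simp add: dist_norm algebra_simps)
        ultimately have "z + x \<in> G" using x by (auto simp: X_def G_def algebra_simps)
        moreover have "w x = 0" using x by (auto simp: X_def w_def)
        moreover have "1 / 2 \<le> w (z + x)"
          using True \<open>0 < M\<close> by (auto simp: Q_def w_def add.commute field_simps)
        then have "ennreal (1 / 2) \<le> ennreal \<bar>w (z + x)\<bar>" by (intro ennreal_leI) linarith
        ultimately show ?thesis using True by (auto simp: Q_def)
      qed auto
    qed
    finally show "ennreal (S / 4) \<le> (\<integral>\<^sup>+z\<in>shell 2 h. indicator G (z + x) * ennreal \<bar>w (z + x) - w x\<bar> \<partial>lborel)" .
  qed measurable
  have bG: "emeasure lborel T \<le> ennreal (?V * R ^ ?d)" if "T \<subseteq> ball x0 R" for T :: "'a set"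
    using emeasure_mono[of T "ball x0 R" lborel] that \<open>0 < R\<close> by (simp add: emeasure_ball)
  have "?I \<le> ennreal (h ^ ?d * (h / R) powr s) *
    (ennreal (2 * 1 * ?V) * emeasure lborel {x \<in> G. w x \<noteq> 0}
      + ennreal (q * ln (real 2) / Psi (p - 1) (q - 1) 1) * energy p q s R G w)"
    using par h \<open>0 < R\<close> by (intro incr_shell_le_energy) (auto simp: G_def)
  also have "\<dots> \<le> ennreal (h ^ ?d * (h / R) powr s) *
    (ennreal (2 * ?V) * ennreal (?V * R ^ ?d) + ennreal q * (ennreal (\<Lambda> * (1 / \<tau>) powr b) * ennreal (?V * R ^ ?d)))"
  proof (intro mult_left_mono[of "_ + _"] add_mono mult_mono[of "ennreal _"])
    have "{x \<in> G. w x \<noteq> 0} \<subseteq> ball x0 ((1 - \<tau>) * R)" by (auto simp: G_def)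
    also have "\<dots> \<subseteq> ball x0 R"
      using \<tau>' \<open>0 < R\<close> by (intro subset_ball) (simp add: mult_le_cancel_right1)
    finally show "emeasure lborel {x \<in> G. w x \<noteq> 0} \<le> ennreal (?V * R ^ ?d)" by (rule bG)
    have "1 / 2 * R \<le> (1 - \<tau>) * R" using \<tau>' \<open>0 < R\<close> by (intro mult_right_mono) auto
    moreover have "(1 - \<tau>) * R < 1 * R" using \<tau>' \<open>0 < R\<close> by (intro mult_strict_right_mono) auto
    ultimately have "R / 2 \<le> (1 - \<tau>) * R" "(1 - \<tau>) * R < R" "R \<le> R" by simp_all
    then have "energy p q s R G w \<le> ennreal (\<Lambda> * (R / (R - (1 - \<tau>) * R)) powr b) * emeasure lborel {x \<in> ball x0 R. u x < M}"
      using caccioppoli unfolding caccioppoli_def w_def G_def by blast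
    also have "\<dots> = ennreal (\<Lambda> * (1 / \<tau>) powr b) * emeasure lborel {x \<in> ball x0 R. u x < M}"
    proof -
      have "R / (R - (1 - \<tau>) * R) = 1 / \<tau>" using \<open>0 < R\<close> by (simp add: left_diff_distrib)
      then show ?thesis by (simp only:)
    qed
    also have "\<dots> \<le> ennreal (\<Lambda> * (1 / \<tau>) powr b) * ennreal (?V * R ^ ?d)"
      by (intro mult_left_mono bG) auto
    finally show "energy p q s R G w \<le> ennreal (\<Lambda> * (1 / \<tau>) powr b) * ennreal (?V * R ^ ?d)" .
    show "ennreal (q * ln (real 2) / Psi (p - 1) (q - 1) 1) \<le> ennreal q"
      using par ln2_le_25_over_36 by (intro ennreal_leI) (simp add: mult_left_le)
  qed auto
  also have "\<dots> = ennreal (h ^ ?d * (h / R) powr s * ((2 * ?V + q * (\<Lambda> * (1 / \<tau>) powr b)) * (?V * R ^ ?d)))"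
  proof -
    have "ennreal c * (ennreal (2 * ?V) * ennreal B + ennreal q * (ennreal L * ennreal B))
        = ennreal (c * ((2 * ?V + q * L) * B))" if "0 \<le> c" "0 \<le> B" "0 \<le> L" for c B L
      using that par by (simp add: ennreal_mult distrib_right mult.assoc)
    from this[of "h ^ ?d * (h / R) powr s" "?V * R ^ ?d" "\<Lambda> * (1 / \<tau>) powr b"]
    show ?thesis using par h Rd by simp
  qed
  finally have "ennreal (S / 4 * measure lborel X)
      \<le> ennreal (h ^ ?d * (h / R) powr s * ((2 * ?V + q * (\<Lambda> * (1 / \<tau>) powr b)) * (?V * R ^ ?d)))"
    using low unfolding eX by (subst ennreal_mult) (auto simp: S_def intro: order_trans)
  moreover have "0 \<le> h ^ ?d * (h / R) powr s * ((2 * ?V + q * (\<Lambda> * (1 / \<tau>) powr b)) * (?V * R ^ ?d))"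
    using par h V Rd \<open>0 < R\<close> \<tau>' by simp
  ultimately have "S / 4 * measure lborel X
      \<le> h ^ ?d * (h / R) powr s * ((2 * ?V + q * (\<Lambda> * (1 / \<tau>) powr b)) * (?V * R ^ ?d))"
    by simp
  moreover have "(?V * h ^ ?d / 2) / 4 * (\<sigma> / 2 * (?V * R ^ ?d)) \<le> S / 4 * measure lborel X"
    using S Xm V h \<sigma> Rd by (intro mult_mono divide_right_mono) (auto simp: S_def)
  ultimately have "(h ^ ?d * (?V * R ^ ?d)) * (\<sigma> * ?V)
      \<le> (h ^ ?d * (?V * R ^ ?d)) * (16 * (h / R) powr s * (2 * ?V + q * (\<Lambda> * (1 / \<tau>) powr b)))"
    by (simp add: algebra_simps)
  then have "\<sigma> * ?V \<le> 16 * (h / R) powr s * (2 * ?V + q * (\<Lambda> * (1 / \<tau>) powr b))"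
    using h V Rd by (subst (asm) mult_le_cancel_left_pos) auto
  then show False using h by (simp add: mult.assoc)
qed

section \<open>Propagation of positivity from a small ball\<close>

lemma measure_ball_le_AE:
  fixes u :: "'a::euclidean_space \<Rightarrow> real"
  assumes [measurable]: "u \<in> borel_measurable borel" and "0 \<le> \<rho>"
    and "AE x in lborel. x \<in> ball y \<rho> \<longrightarrow> l \<le> u x" and sub: "ball y \<rho> \<subseteq> ball y' r"
  shows "unit_ball_vol (real DIM('a)) * \<rho> ^ DIM('a) \<le> measure lborel {x \<in> ball y' r. l \<le> u x}"
proof -
  let ?T = "{x \<in> ball y' r. l \<le> u x}"
  have "emeasure lborel (ball y \<rho>) \<le> emeasure lborel ?T"
  proof (rule emeasure_mono_AE)
    show "AE x in lborel. x \<in> ball y \<rho> \<longrightarrow> x \<in> ?T"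
      using assms(3) by (rule eventually_mono) (use sub in blast)
  qed measurable
  moreover have "?T \<subseteq> ball y' r" by auto
  ultimately show ?thesis
    using emeasure_in_ball[of ?T y' r] \<open>0 \<le> \<rho>\<close> by (simp add: emeasure_ball)
qed

text \<open>The centres move towards \<open>x0\<close> while the radii grow geometrically, so that every ball
  stays inside \<open>ball x0 R\<close>, where \<open>u\<close> is known to be nonnegative.\<close>

lemma expansion_chain:
  fixes u :: "'a::euclidean_space \<Rightarrow> real"
  assumes growth: "\<And>y \<rho> l. \<lbrakk>0 < \<rho>; 0 < l; dist x0 y + \<rho> \<le> R; dist x0 y \<le> D; \<kappa> \<le> \<delta> * l;
      unit_ball_vol (real DIM('a)) / (4 * 5 ^ DIM('a)) * \<rho> ^ DIM('a) \<le> measure lborel {x \<in> ball y (3 / 4 * \<rho>). l \<le> u x}\<rbrakk>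
      \<Longrightarrow> AE x in lborel. x \<in> ball y (\<rho> / 2) \<longrightarrow> \<delta> * l \<le> u x"
    and u: "u \<in> borel_measurable borel" and \<delta>: "0 < \<delta>" "\<delta> < 1" and "0 \<le> D"
    and "R / 5 \<le> (5 / 4) ^ n * \<rho>" "0 < \<rho>" "0 < l" "dist x0 y + 4 * \<rho> \<le> R" "dist x0 y \<le> D"
    and "AE x in lborel. x \<in> ball y \<rho> \<longrightarrow> l \<le> u x" "\<kappa> \<le> \<delta> ^ (n + 1) * l"
  shows "AE x in lborel. x \<in> ball x0 (R / 2) \<longrightarrow> \<delta> ^ (n + 1) * l \<le> u x"
  using assms(6-)
proof (induction n arbitrary: y \<rho> l)
  case hyp: 0
  let ?V = "unit_ball_vol (real DIM('a))"
  have R: "0 < R" using hyp zero_le_dist[of x0 y] by linarith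
  \<comment> \<open>With \<rho> \<ge> R/5 the invariant gives dist x0 y + \<rho> \<le> R - 3\<rho>
    \<le> 2R/5, so one application of the growth lemma in the full ball finishes.\<close>
  have "ball y \<rho> \<subseteq> ball x0 (3 / 4 * R)"
  proof
    fix z assume "z \<in> ball y \<rho>"
    then have "dist x0 z < dist x0 y + \<rho>" using dist_triangle[of x0 z y] by (auto simp: dist_commute)
    also have "\<dots> \<le> 3 / 4 * R" using hyp by simp
    finally show "z \<in> ball x0 (3 / 4 * R)" by simp
  qed
  then have "?V * \<rho> ^ DIM('a) \<le> measure lborel {x \<in> ball x0 (3 / 4 * R). l \<le> u x}"
    using hyp u by (intro measure_ball_le_AE) auto
  moreover have "?V / (4 * 5 ^ DIM('a)) * R ^ DIM('a) \<le> ?V * \<rho> ^ DIM('a)"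
  proof -
    have "(R / 5) ^ DIM('a) \<le> \<rho> ^ DIM('a)" using hyp R by (intro power_mono) auto
    moreover have "0 \<le> (R / 5) ^ DIM('a)" using R by simp
    ultimately have "(R / 5) ^ DIM('a) / 4 \<le> \<rho> ^ DIM('a)" by linarith
    then have "?V * ((R / 5) ^ DIM('a) / 4) \<le> ?V * \<rho> ^ DIM('a)"
      by (rule mult_left_mono) simp
    then show ?thesis by (simp add: power_divide mult.commute)
  qed
  ultimately show ?case using hyp R \<open>0 \<le> D\<close> growth[of R l x0] by simp
next
  case (Suc n)
  note hyp = Suc.prems
  let ?V = "unit_ball_vol (real DIM('a))"
  have R: "0 < R" using hyp zero_le_dist[of x0 y] by linarith
  show ?case
  proof (cases "R / 5 \<le> \<rho>")
    case True
    have le: "\<delta> ^ (Suc n + 1) * l \<le> \<delta> ^ (n + 1) * l"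
      using \<delta> hyp by (intro mult_right_mono power_decreasing) auto
    have "1 \<le> (5 / 4 :: real) ^ n" by simp
    then have "1 * \<rho> \<le> (5 / 4) ^ n * \<rho>" using hyp by (intro mult_right_mono) auto
    then have "R / 5 \<le> (5 / 4) ^ n * \<rho>" using True by linarith
    then have "AE x in lborel. x \<in> ball x0 (R / 2) \<longrightarrow> \<delta> ^ (n + 1) * l \<le> u x"
      using hyp le by (intro Suc.IH[of \<rho> l y]) auto
    then show ?thesis using le by (auto elim!: eventually_mono)
  next
    case False
    \<comment> \<open>The centre moves by at most \<rho> towards \<open>x0\<close>, and onto
      \<open>x0\<close> if it is that close.\<close>
    define t where "t = (if dist x0 y \<le> \<rho> then 1 else \<rho> / dist x0 y)"
    define y' where "y' = y + t *\<^sub>R (x0 - y)"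
    have t: "0 \<le> t" "t \<le> 1" "t * dist x0 y \<le> \<rho>" using hyp by (auto simp: t_def divide_le_eq not_le)
    have dy: "dist y y' \<le> \<rho>" using t by (simp add: y'_def dist_norm norm_minus_commute)
    have dy': "dist x0 y' = (1 - t) * dist x0 y"
    proof -
      have "x0 - y' = (1 - t) *\<^sub>R (x0 - y)" by (simp add: y'_def algebra_simps)
      then show ?thesis using t by (simp add: dist_norm)
    qed
    have le_y: "dist x0 y' \<le> dist x0 y" unfolding dy' using t by (intro mult_left_le_one_le) auto
    \<comment> \<open>Enlarging the radius to 5/4 \<rho> raises 4\<rho> by exactly \<rho>, which the
      move of the centre pays for. Once the centre is \<open>x0\<close>, the requirement 5\<rho>
      \<le> R holds because \<rho> < R/5; this fixes the stopping radius.\<close>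
    have next_R: "dist x0 y' + 4 * (5 / 4 * \<rho>) \<le> R"
    proof (cases "dist x0 y \<le> \<rho>")
      case True
      then have "dist x0 y' = 0" unfolding dy' by (simp add: t_def)
      then show ?thesis using False by simp
    next
      case far: False
      then have "dist x0 y' = dist x0 y - \<rho>" unfolding dy'
        using hyp by (auto simp: t_def left_diff_distrib)
      then show ?thesis using hyp by simp
    qed
    \<comment> \<open>The growth lemma is applied in the ball of radius 4\<rho> about the new
      centre. Its conclusion holds in radius 2\<rho>, of which 5/4 \<rho> is kept.\<close>
    have sub: "ball y \<rho> \<subseteq> ball y' (3 / 4 * (4 * \<rho>))"
    proof
      fix z assume "z \<in> ball y \<rho>"
      then have "dist y' z < 2 * \<rho>" using dist_triangle[of y' z y] dy by (auto simp: dist_commute)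
      then show "z \<in> ball y' (3 / 4 * (4 * \<rho>))" using hyp by simp
    qed
    then have "?V * \<rho> ^ DIM('a) \<le> measure lborel {x \<in> ball y' (3 / 4 * (4 * \<rho>)). l \<le> u x}"
      using hyp u by (intro measure_ball_le_AE) auto
    moreover have "?V / (4 * 5 ^ DIM('a)) * (4 * \<rho>) ^ DIM('a) \<le> ?V * \<rho> ^ DIM('a)"
    proof -
      have "(4::real) ^ DIM('a) \<le> 5 ^ DIM('a)" by (intro power_mono) auto
      then have "(4::real) ^ DIM('a) \<le> 4 * 5 ^ DIM('a)" using zero_less_power[of "5::real" "DIM('a)"] by linarith
      then have "4 ^ DIM('a) / (4 * 5 ^ DIM('a)) \<le> (1::real)" by (simp add: divide_le_eq)
      then have "?V * \<rho> ^ DIM('a) * (4 ^ DIM('a) / (4 * 5 ^ DIM('a))) \<le> ?V * \<rho> ^ DIM('a) * 1"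
        using hyp by (intro mult_left_mono) auto
      then show ?thesis by (simp add: power_mult_distrib mult_ac)
    qed
    moreover have "\<kappa> \<le> \<delta> * l"
    proof -
      have "\<delta> ^ (Suc n + 1) * l \<le> \<delta> ^ 1 * l"
        using \<delta> hyp by (intro mult_right_mono power_decreasing) auto
      then show ?thesis using hyp by simp
    qed
    ultimately have "AE x in lborel. x \<in> ball y' (4 * \<rho> / 2) \<longrightarrow> \<delta> * l \<le> u x"
      using hyp le_y by (intro growth) auto
    then have AE': "AE x in lborel. x \<in> ball y' (5 / 4 * \<rho>) \<longrightarrow> \<delta> * l \<le> u x"
    proof (rule eventually_mono)
      fix x assume *: "x \<in> ball y' (4 * \<rho> / 2) \<longrightarrow> \<delta> * l \<le> u x"
      show "x \<in> ball y' (5 / 4 * \<rho>) \<longrightarrow> \<delta> * l \<le> u x"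
      proof
        assume "x \<in> ball y' (5 / 4 * \<rho>)"
        then have "dist y' x < 5 / 4 * \<rho>" by simp
        also have "\<dots> \<le> 4 * \<rho> / 2" using hyp by simp
        finally show "\<delta> * l \<le> u x" using * by simp
      qed
    qed
    have "AE x in lborel. x \<in> ball x0 (R / 2) \<longrightarrow> \<delta> ^ (n + 1) * (\<delta> * l) \<le> u x"
      using hyp AE' next_R le_y \<delta>
      by (intro Suc.IH[of "5 / 4 * \<rho>" "\<delta> * l" y']) (auto simp: mult_ac)
    then show ?thesis by (simp add: mult_ac)
  qed
qed

text \<open>The chain has about log(R/h) steps, each costing the factor \<delta>, and h/R is a power
  of \<sigma>; hence the total cost \<delta>^n is again a power of \<sigma>, up to a constant. The
  Caccioppoli inequality is requested only in the balls and at the levels that the chain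
  meets.\<close>

lemma power_positivity:
  fixes s0 p q \<Lambda> b :: real
  assumes par: "0 < s0" "1 < p" "p \<le> q" "0 \<le> \<Lambda>" "1 \<le> b"
  obtains c0 N where "0 < c0" "0 < N"
    "\<And>s (u :: 'a::euclidean_space \<Rightarrow> real) x0 R M \<sigma>. \<lbrakk>s0 \<le> s; s < 1; u \<in> borel_measurable borel; 0 < R; 0 < M;
       \<And>x. x \<in> ball x0 R \<Longrightarrow> 0 \<le> u x; 0 < \<sigma>; \<sigma> \<le> 1;
       \<And>y \<rho> l. 0 < \<rho> \<Longrightarrow> dist x0 y + \<rho> \<le> R \<Longrightarrow> dist x0 y \<le> (1 - \<sigma> / (2 * real DIM('a))) * R \<Longrightarrow>
         c0 * \<sigma> powr N * M \<le> l \<Longrightarrow> caccioppoli p q s \<Lambda> b u y \<rho> l;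
       \<sigma> * (unit_ball_vol (real DIM('a)) * R ^ DIM('a)) \<le> measure lborel {x \<in> ball x0 R. M \<le> u x}\<rbrakk>
     \<Longrightarrow> AE x in lborel. x \<in> ball x0 (R / 2) \<longrightarrow> c0 * \<sigma> powr N * M \<le> u x"
proof -
  let ?V = "unit_ball_vol (real DIM('a))"
  let ?d = "real DIM('a)"
  have V: "0 < ?V" by simp
  have d: "1 \<le> ?d" using DIM_positive[where 'a='a] by linarith
  have par': "1 \<le> p" "0 \<le> b" "0 \<le> q" using par by auto
  \<comment> \<open>One density for all uses of the growth lemma: 1/4 of a ball of radius h within
    radius 2h at the start, a ball of radius \<rho> within 4\<rho> along the chain, and radius R/5
    within R at the end.\<close>
  define \<sigma>' where "\<sigma>' = ?V / (4 * 5 ^ DIM('a))"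
  have \<sigma>': "0 < \<sigma>'" unfolding \<sigma>'_def using V by (intro divide_pos_pos) auto
  obtain \<delta> where \<delta>: "0 < \<delta>" "\<delta> < 1"
    and growth: "\<And>s (u :: 'a \<Rightarrow> real) x0 R M. \<lbrakk>s0 \<le> s; s < 1; u \<in> borel_measurable borel; 0 < R; 0 < M;
       \<And>x. x \<in> ball x0 R \<Longrightarrow> 0 \<le> u x; \<And>l. \<delta> * M \<le> l \<Longrightarrow> caccioppoli p q s \<Lambda> b u x0 R l;
       \<sigma>' * R ^ DIM('a) \<le> measure lborel {x \<in> ball x0 (3 / 4 * R). M \<le> u x}\<rbrakk>
     \<Longrightarrow> AE x in lborel. x \<in> ball x0 (R / 2) \<longrightarrow> \<delta> * M \<le> u x"
    using growth_lemma[OF par \<sigma>', where 'a = 'a] by blast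
  define K where "K = 2 * ?V + q * \<Lambda>"
  have K: "0 < K" unfolding K_def using V par' par by (intro add_pos_nonneg) auto
  \<comment> \<open>With \<theta> = c1 \<tau>^(b+1), b powers of \<tau> absorb the Caccioppoli loss
    (1/\<tau>)^b and the remaining one compares with \<sigma>. The value of c1 leaves a factor 2 for
    the strict inequality in \<open>hcond\<close>.\<close>
  define c1 where "c1 = min 1 (?d * ?V / (8 * K))"
  have c1: "0 < c1" "c1 \<le> 1" "8 * K * c1 \<le> ?d * ?V"
  proof -
    show "0 < c1" "c1 \<le> 1" using V K d by (auto simp: c1_def)
    have "c1 \<le> ?d * ?V / (8 * K)" by (simp add: c1_def)
    then show "8 * K * c1 \<le> ?d * ?V" using K by (simp add: pos_le_divide_eq mult.commute)
  qed
  \<comment> \<open>The exponent that converts steps into radii: \<delta>^(log_(5/4) x) =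
    x^(-a).\<close>
  define a where "a = - log (5 / 4) \<delta>"
  have a: "0 < a" using \<delta> by (simp add: a_def)
  define N where "N = (b + 1) * (1 / s0) * a"
  have N: "0 < N" unfolding N_def using a par by (intro mult_pos_pos) auto
  \<comment> \<open>Two factors \<delta> come from the first growth step and the end of the chain,
    the third from rounding the number of steps up; the 1/2 comes from the clustering level
    M/2.\<close>
  define c0 where "c0 = \<delta> ^ 3 / 2 * (c1 powr (1 / s0 * a) * (1 / (4 * ?d)) powr N)"
  have c0: "0 < c0" unfolding c0_def using \<delta> c1 d by (intro mult_pos_pos) auto
  show ?thesis
  proof (rule that[OF c0 N])
    fix s R M \<sigma> :: real and u :: "'a \<Rightarrow> real" and x0 :: 'a
    assume s: "s0 \<le> s" "s < 1" and u: "u \<in> borel_measurable borel" and R: "0 < R" and M: "0 < M"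
      and nn: "\<And>x. x \<in> ball x0 R \<Longrightarrow> 0 \<le> u x" and \<sigma>: "0 < \<sigma>" "\<sigma> \<le> 1"
      and caccioppoli: "\<And>y \<rho> l. 0 < \<rho> \<Longrightarrow> dist x0 y + \<rho> \<le> R \<Longrightarrow> dist x0 y \<le> (1 - \<sigma> / (2 * ?d)) * R \<Longrightarrow>
         c0 * \<sigma> powr N * M \<le> l \<Longrightarrow> caccioppoli p q s \<Lambda> b u y \<rho> l"
      and dens: "\<sigma> * (?V * R ^ DIM('a)) \<le> measure lborel {x \<in> ball x0 R. M \<le> u x}"
    define \<tau> where "\<tau> = \<sigma> / (4 * ?d)"
    have \<tau>: "0 < \<tau>" "\<tau> \<le> 1 / 4" "1 - 2 * \<tau> = 1 - \<sigma> / (2 * ?d)"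
    proof -
      show "0 < \<tau>" using \<sigma> d by (simp add: \<tau>_def)
      have "\<sigma> / (4 * ?d) \<le> 1 / (4 * 1)" using \<sigma> d by (intro frac_le) auto
      then show "\<tau> \<le> 1 / 4" by (simp add: \<tau>_def)
    qed (simp add: \<tau>_def)
    define \<kappa> where "\<kappa> = c0 * \<sigma> powr N * M"
    define D where "D = (1 - 2 * \<tau>) * R"
    define \<theta> where "\<theta> = c1 * \<tau> powr (b + 1)"
    \<comment> \<open>The exponent 1/s0 keeps h independent of s, and \<theta> \<le> 1 still gives
      (h/R)^s \<le> \<theta> for all s \<ge> s0.\<close>
    define h where "h = R * \<theta> powr (1 / s0)"
    have \<theta>: "0 < \<theta>" "\<theta> \<le> 1" "\<theta> \<le> \<tau> powr (b + 1)"
    proof -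
      show "0 < \<theta>" using c1 \<tau> by (simp add: \<theta>_def)
      have le1: "\<tau> powr (b + 1) \<le> 1" using \<tau> par by (intro powr_le1) auto
      show le: "\<theta> \<le> \<tau> powr (b + 1)" unfolding \<theta>_def using c1 by (intro mult_left_le_one_le) auto
      show "\<theta> \<le> 1" using le le1 by linarith
    qed
    have s0: "s0 < 1" using s by linarith
    have h: "0 < h" "h \<le> \<tau> * R"
    proof -
      show "0 < h" using R \<theta> by (simp add: h_def)
      have "\<theta> powr (1 / s0) \<le> (\<tau> powr (b + 1)) powr (1 / s0)"
        using \<theta> par by (intro powr_mono2) auto
      also have "\<dots> = \<tau> powr ((b + 1) / s0)" by (simp add: powr_powr)
      also have "\<dots> \<le> \<tau> powr 1"
        using \<tau> par s0 by (intro powr_mono') (auto simp: le_divide_eq)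
      finally show "h \<le> \<tau> * R" using \<tau> R by (simp add: h_def mult.commute)
    qed
    have hcond: "16 * (h / R) powr s * (2 * ?V + q * \<Lambda> * (1 / \<tau>) powr b) < \<sigma> * ?V"
    proof -
      have "(h / R) powr s = \<theta> powr (s / s0)" using R by (simp add: h_def powr_powr)
      also have "\<dots> \<le> \<theta> powr 1" using \<theta> s par by (intro powr_mono') (auto simp: le_divide_eq)
      finally have 1: "(h / R) powr s \<le> \<theta>" using \<theta> by simp
      have "1 \<le> (1 / \<tau>) powr b" using \<tau> par' by (intro ge_one_powr_ge_zero) auto
      then have 2: "2 * ?V + q * \<Lambda> * (1 / \<tau>) powr b \<le> K * (1 / \<tau>) powr b"
        using V by (simp add: K_def distrib_right)
      have "16 * (h / R) powr s * (2 * ?V + q * \<Lambda> * (1 / \<tau>) powr b) \<le> 16 * \<theta> * (K * (1 / \<tau>) powr b)"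
        using 1 2 \<theta> V par par' by (intro mult_mono) auto
      also have "\<dots> = 2 * (8 * K * c1) * \<tau>"
      proof -
        have "\<tau> powr (b + 1) * (1 / \<tau>) powr b = \<tau>"
          using \<tau> by (simp add: powr_add powr_divide)
        then have "16 * c1 * K * (\<tau> powr (b + 1) * (1 / \<tau>) powr b) = 16 * c1 * K * \<tau>" by (simp only:)
        then show ?thesis unfolding \<theta>_def by (simp only: mult_ac)
      qed
      also have "\<dots> \<le> 2 * (?d * ?V) * \<tau>" using c1 \<tau> by (intro mult_right_mono mult_left_mono) auto
      also have "\<dots> < 4 * (?d * ?V) * \<tau>" using d V \<tau> by (intro mult_strict_right_mono) auto
      also have "\<dots> = \<sigma> * ?V" using d by (simp add: \<tau>_def)
      finally show ?thesis .
    qed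
    define n where "n = nat \<lceil>log (5 / 4) (R / h)\<rceil>"
    have Rh: "1 \<le> R / h"
    proof -
      have "\<tau> * R \<le> 1 * R" using \<tau> R by (intro mult_right_mono) auto
      then show ?thesis using h by (simp add: le_divide_eq)
    qed
    then have log0: "0 \<le> log (5 / 4) (R / h)" by simp
    have n1: "R / h \<le> (5 / 4) ^ n"
    proof -
      have "R / h = (5 / 4) powr (log (5 / 4) (R / h))" using Rh by (subst powr_log_cancel) auto
      also have "\<dots> \<le> (5 / 4) powr real n" unfolding n_def by (intro powr_mono) linarith+
      finally show ?thesis by (simp add: powr_realpow)
    qed
    have n2: "real n \<le> log (5 / 4) (R / h) + 1" unfolding n_def using log0 by linarith
    have \<kappa>_le: "\<kappa> \<le> \<delta> ^ (n + 1) * (\<delta> * (M / 2))"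
    proof -
      have "\<delta> powr (log (5 / 4) (R / h)) = (R / h) powr (- a)"
        using \<delta> Rh R h(1) by (simp add: powr_def a_def log_def)
      also have "(R / h) powr (- a) = (\<theta> powr (- 1 / s0)) powr (- a)"
        using R by (simp add: h_def powr_minus_divide)
      also have "(\<theta> powr (- 1 / s0)) powr (- a) = c1 powr (1 / s0 * a) * (1 / (4 * ?d)) powr N * \<sigma> powr N"
      proof -
        have "(\<theta> powr (- 1 / s0)) powr (- a) = \<theta> powr (1 / s0 * a)" by (simp add: powr_powr)
        also have "\<dots> = c1 powr (1 / s0 * a) * \<tau> powr ((b + 1) * (1 / s0 * a))"
          by (simp only: \<theta>_def powr_mult powr_powr)
        also have "(b + 1) * (1 / s0 * a) = N" by (simp add: N_def)
        also have "\<tau> powr N = (1 / (4 * ?d)) powr N * \<sigma> powr N"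
          by (simp add: \<tau>_def powr_mult[symmetric])
        finally show ?thesis by simp
      qed
      finally have "\<delta> ^ 3 * (c1 powr (1 / s0 * a) * (1 / (4 * ?d)) powr N * \<sigma> powr N)
          = \<delta> powr (3 + log (5 / 4) (R / h))"
        using \<delta> powr_realpow[of \<delta> 3] by (simp add: powr_add)
      also have "\<dots> \<le> \<delta> powr (n + 2)" using \<delta> n2 by (intro powr_mono') auto
      also have "\<dots> = \<delta> ^ (n + 2)" using \<delta> powr_realpow[of \<delta> "n + 2"] by (simp add: add.commute)
      finally have "\<delta> ^ 3 * (c1 powr (1 / s0 * a) * (1 / (4 * ?d)) powr N * \<sigma> powr N) * (M / 2) \<le> \<delta> ^ (n + 2) * (M / 2)"
        using M by (intro mult_right_mono) auto
      then show ?thesis by (simp add: \<kappa>_def c0_def mult_ac)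
    qed
    have \<delta>n: "\<delta> ^ (n + 1) \<le> 1" using \<delta> by (intro power_le_one) auto
    have \<kappa>1: "\<kappa> \<le> \<delta> * (M / 2)"
    proof -
      have "\<delta> ^ (n + 1) * (\<delta> * (M / 2)) \<le> 1 * (\<delta> * (M / 2))"
        using \<delta>n \<delta> M by (intro mult_right_mono) auto
      then show ?thesis using \<kappa>_le by linarith
    qed
    have \<kappa>M: "\<kappa> \<le> M"
    proof -
      have "\<delta> * (M / 2) \<le> 1 * (M / 2)" using \<delta> M by (intro mult_right_mono) auto
      then show ?thesis using \<kappa>1 M by linarith
    qed
    have caccioppoli': "caccioppoli p q s \<Lambda> b u y \<rho> l" if "0 < \<rho>" "dist x0 y + \<rho> \<le> R" "dist x0 y \<le> D" "\<kappa> \<le> l" for y \<rho> l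
      using that caccioppoli \<tau>(3) unfolding \<kappa>_def D_def by simp
    have D0: "0 \<le> D" unfolding D_def using \<tau>(1,2) R by (intro mult_nonneg_nonneg) auto
    have "\<exists>x. dist x0 x < (1 - 2 * \<tau>) * R \<and>
      ?V * h ^ DIM('a) / 4 \<le> measure lborel {y \<in> ball x h. M / 2 \<le> u y}"
    proof (rule clustering[OF u par'(1) par(3) _ s(2) par(4) par'(2) R M nn _ \<sigma> \<tau>_def dens h hcond])
      show "caccioppoli p q s \<Lambda> b u x0 R M" using R D0 \<kappa>M by (intro caccioppoli') auto
    qed (use s par in auto)
    then obtain x where x: "dist x0 x < D"
      and xm: "?V * h ^ DIM('a) / 4 \<le> measure lborel {y \<in> ball x h. M / 2 \<le> u y}"
      by (auto simp: D_def)
    have gr: "AE x in lborel. x \<in> ball y (\<rho> / 2) \<longrightarrow> \<delta> * l \<le> u x"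
      if "0 < \<rho>" "0 < l" "dist x0 y + \<rho> \<le> R" "dist x0 y \<le> D" "\<kappa> \<le> \<delta> * l"
        "\<sigma>' * \<rho> ^ DIM('a) \<le> measure lborel {x \<in> ball y (3 / 4 * \<rho>). l \<le> u x}" for y \<rho> l
    proof (rule growth[OF s u that(1,2) _ _ that(6)])
      fix z assume "z \<in> ball y \<rho>"
      then have "dist x0 z < R" using that(3) dist_triangle[of x0 z y] by (auto simp: dist_commute)
      then show "0 \<le> u z" by (intro nn) simp
    next
      fix l' assume "\<delta> * l \<le> l'"
      then show "caccioppoli p q s \<Lambda> b u y \<rho> l'" using that by (intro caccioppoli') auto
    qed
    have hD: "D + 2 * h \<le> R" using h by (simp add: D_def left_diff_distrib)
    have first: "AE z in lborel. z \<in> ball x (2 * h / 2) \<longrightarrow> \<delta> * (M / 2) \<le> u z"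
    proof (rule gr)
      have "(2::real) ^ DIM('a) \<le> 5 ^ DIM('a)" by (intro power_mono) auto
      then have "2 ^ DIM('a) / 5 ^ DIM('a) \<le> (1::real)" by simp
      then have "?V * h ^ DIM('a) / 4 * (2 ^ DIM('a) / 5 ^ DIM('a)) \<le> ?V * h ^ DIM('a) / 4 * 1"
        using h by (intro mult_left_mono) auto
      then have "\<sigma>' * (2 * h) ^ DIM('a) \<le> ?V * h ^ DIM('a) / 4"
        by (simp add: \<sigma>'_def power_mult_distrib mult_ac)
      also note xm
      also have "measure lborel {y \<in> ball x h. M / 2 \<le> u y} \<le> measure lborel {y \<in> ball x (3 / 4 * (2 * h)). M / 2 \<le> u y}"
        using h u by (intro measure_mono_in_ball[of _ _ x "3 / 4 * (2 * h)"]) auto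
      finally show "\<sigma>' * (2 * h) ^ DIM('a) \<le> measure lborel {y \<in> ball x (3 / 4 * (2 * h)). M / 2 \<le> u y}" .
    qed (use h M x hD \<kappa>1 in auto)
    \<comment> \<open>The chain starts with radius h/2 instead of h: its invariant asks for room
      4\<rho>, and only 2h is guaranteed by \<open>hD\<close>.\<close>
    have "AE z in lborel. z \<in> ball x0 (R / 2) \<longrightarrow> \<delta> ^ (n + 1) * (\<delta> * (M / 2)) \<le> u z"
    proof (rule expansion_chain[where \<kappa> = \<kappa> and D = D and \<rho> = "h / 2" and y = x])
      show "AE z in lborel. z \<in> ball x (h / 2) \<longrightarrow> \<delta> * (M / 2) \<le> u z"
        using first by (rule eventually_mono) (use h in auto)
      have "R / 2 = (R / h) * (h / 2)" using h by simp
      also have "\<dots> \<le> (5 / 4) ^ n * (h / 2)" using n1 h by (intro mult_right_mono) auto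
      finally show "R / 5 \<le> (5 / 4) ^ n * (h / 2)" using R by linarith
    qed (use gr \<delta> D0 h x hD M \<kappa>_le u in \<open>auto simp: \<sigma>'_def\<close>)
    then show "AE x in lborel. x \<in> ball x0 (R / 2) \<longrightarrow> c0 * \<sigma> powr N * M \<le> u x"
      by (rule eventually_mono) (use \<kappa>_le in \<open>auto simp: \<kappa>_def\<close>)
  qed
qed

section \<open>Growth functions\<close>

context
  fixes p q :: real and f :: "real \<Rightarrow> real"
  assumes pq: "1 < p" "p \<le> q" and gf: "growth_function p q f"
begin

lemma gf_simps: "f 0 = 0" "f 1 = 1" "\<And>t. 0 \<le> t \<Longrightarrow> 0 \<le> f t"
  using gf by (auto simp: growth_function_def)

lemma gf_pos: "0 < t \<Longrightarrow> 0 < f t"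
  using gf strict_mono_onD[of "{0..}" f 0 t] by (auto simp: growth_function_def)

lemma gf_mono: "0 \<le> a \<Longrightarrow> a \<le> b \<Longrightarrow> f a \<le> f b"
  using gf strict_mono_onD[of "{0..}" f a b] by (cases "a = b") (auto simp: growth_function_def)

lemma gf_bounds: "0 \<le> t \<Longrightarrow> p * f t \<le> t * deriv0 f t" "0 \<le> t \<Longrightarrow> t * deriv0 f t \<le> q * f t"
  using gf by (auto simp: growth_function_def)

lemma gf_has_derivative_within:
  assumes "0 \<le> t"
  shows "(f has_real_derivative deriv0 f t) (at t within {0..})"
proof -
  have "f differentiable (at t within {0..})"
    using gf assms by (auto simp: growth_function_def differentiable_on_def)
  then show ?thesis
    by (simp add: vector_derivative_works deriv0_def has_real_derivative_iff_has_vector_derivative)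
qed

lemma gf_has_derivative:
  assumes "0 < t"
  shows "(f has_real_derivative deriv0 f t) (at t)"
proof -
  have "at t within {0..} = at t"
    using assms by (intro at_within_interior) (simp add: interior_Ici)
  then show ?thesis using gf_has_derivative_within[of t] assms by simp
qed

text \<open>The derivative of f(t) t^(-e) is (t f'(t) - e f(t)) t^(-e-1), whose sign for e = p and e
  = q is the growth condition.\<close>

lemma gf_ratio_mono:
  assumes "0 < a" "a \<le> b"
  shows "f a * a powr (- p) \<le> f b * b powr (- p)" "f b * b powr (- q) \<le> f a * a powr (- q)"
proof -
  have D: "((\<lambda>t. f t * t powr (- e)) has_real_derivative (t * deriv0 f t - e * f t) * t powr (- e - 1)) (at t)"
    if "0 < t" for t e
  proof -
    have "((\<lambda>t. f t * t powr (- e)) has_real_derivative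
        (deriv0 f t * t powr (- e) + ((- e) * t powr (- e - 1)) * f t)) (at t)"
      by (rule DERIV_mult[OF gf_has_derivative[OF that] has_real_derivative_powr[OF that]])
    moreover have "t powr (- e) = t * t powr (- e - 1)" using that by (simp add: powr_diff)
    ultimately show ?thesis by (simp add: algebra_simps)
  qed
  show "f a * a powr (- p) \<le> f b * b powr (- p)"
  proof (rule DERIV_nonneg_imp_nondecreasing[OF assms(2)])
    fix t assume "a \<le> t" "t \<le> b"
    then show "\<exists>y. ((\<lambda>t. f t * t powr (- p)) has_real_derivative y) (at t) \<and> 0 \<le> y"
      using D[of t p] gf_bounds[of t] assms by (intro exI conjI) auto
  qed
  show "f b * b powr (- q) \<le> f a * a powr (- q)"
  proof (rule DERIV_nonpos_imp_nonincreasing[OF assms(2)])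
    fix t assume "a \<le> t" "t \<le> b"
    then show "\<exists>y. ((\<lambda>t. f t * t powr (- q)) has_real_derivative y) (at t) \<and> y \<le> 0"
    proof (intro exI conjI)
      show "((\<lambda>t. f t * t powr (- q)) has_real_derivative (t * deriv0 f t - q * f t) * t powr (- q - 1)) (at t)"
        using \<open>a \<le> t\<close> assms by (intro D) simp
      show "(t * deriv0 f t - q * f t) * t powr (- q - 1) \<le> 0"
        using gf_bounds(2)[of t] \<open>a \<le> t\<close> assms by (intro mult_nonpos_nonneg) auto
    qed
  qed
qed

lemma gf_scale:
  assumes "1 \<le> \<mu>" "0 \<le> t"
  shows "\<mu> powr p * f t \<le> f (\<mu> * t)" "f (\<mu> * t) \<le> \<mu> powr q * f t"
proof -
  have "\<mu> powr p * f t \<le> f (\<mu> * t) \<and> f (\<mu> * t) \<le> \<mu> powr q * f t"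
  proof (cases "t = 0")
    case False
    have t: "0 < t" "0 < \<mu> * t" "t \<le> \<mu> * t" using assms False by auto
    have "f t * t powr (- p) * (\<mu> * t) powr p \<le> f (\<mu> * t) * (\<mu> * t) powr (- p) * (\<mu> * t) powr p"
      using gf_ratio_mono(1)[OF t(1,3)] by (intro mult_right_mono) auto
    moreover have "f (\<mu> * t) * (\<mu> * t) powr (- q) * (\<mu> * t) powr q \<le> f t * t powr (- q) * (\<mu> * t) powr q"
      using gf_ratio_mono(2)[OF t(1,3)] by (intro mult_right_mono) auto
    moreover have "x * (\<mu> * t) powr (- e) * (\<mu> * t) powr e = x" for x e
      using t by (simp add: mult.assoc powr_add[symmetric])
    moreover have "x * t powr (- e) * (\<mu> * t) powr e = \<mu> powr e * x" for x e
      using t by (simp add: powr_mult powr_minus)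
    ultimately show ?thesis by simp
  qed (simp add: gf_simps)
  then show "\<mu> powr p * f t \<le> f (\<mu> * t)" "f (\<mu> * t) \<le> \<mu> powr q * f t" by auto
qed

text \<open>For \<mu> < 1 this is the upper scaling bound applied to the factor 1/\<mu> at \<mu> t,
  which is why q governs small arguments.\<close>

lemma gf_Psi:
  assumes "0 \<le> \<mu>" "0 \<le> t"
  shows "Psi p q \<mu> * f t \<le> f (\<mu> * t)"
proof -
  consider "\<mu> = 0" | "1 \<le> \<mu>" | "0 < \<mu>" "\<mu> < 1" using assms by linarith
  then show ?thesis
  proof cases
    case 1
    then show ?thesis by (simp add: gf_simps)
  next
    case 2
    then show ?thesis using gf_scale(1)[of \<mu> t] assms pq by (simp add: Psi_ge_1)
  next
    case 3
    have "f t \<le> (1 / \<mu>) powr q * f (\<mu> * t)"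
      using gf_scale(2)[of "1 / \<mu>" "\<mu> * t"] 3 assms by simp
    then have "\<mu> powr q * f t \<le> \<mu> powr q * ((1 / \<mu>) powr q * f (\<mu> * t))"
      by (intro mult_left_mono) auto
    also have "\<dots> = f (\<mu> * t)" using 3 by (simp add: powr_divide)
    finally show ?thesis using 3 pq by (simp add: Psi_le_1)
  qed
qed

text \<open>At t = 0 the growth condition reads 0 \<le> 0, so the value is found from the quotient:
  f(t)/t \<le> t^(p-1) on (0,1), and p > 1. As a consequence tail integrands vanish where
  \<open>v\<close> is nonnegative.\<close>

lemma gf_deriv_0: "deriv0 f 0 = 0"
proof -
  have "((\<lambda>t. f t / t) \<longlongrightarrow> 0) (at_right 0)"
  proof (rule tendsto_sandwich)
    have t: "0 \<le> f t / t \<and> f t / t \<le> t powr (p - 1)" if "0 < t" "t < 1" for t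
    proof -
      have "(1 / t) powr p * f t \<le> 1" using gf_scale(1)[of "1 / t" t] that by (simp add: gf_simps)
      then have "f t \<le> t powr p" using that by (simp add: powr_divide divide_le_eq)
      then show ?thesis using that gf_simps(3)[of t] by (simp add: powr_diff divide_right_mono)
    qed
    have ev: "eventually (\<lambda>t::real. 0 < t \<and> t < 1) (at_right 0)"
      unfolding eventually_at_right_field by (intro exI[of _ 1]) auto
    show "eventually (\<lambda>t. 0 \<le> f t / t) (at_right 0)" "eventually (\<lambda>t. f t / t \<le> t powr (p - 1)) (at_right 0)"
      using ev by (eventually_elim, use t in blast)+
    show "((\<lambda>t. t powr (p - 1)) \<longlongrightarrow> 0) (at_right 0)"
      using pq by (auto intro!: tendsto_eq_intros tendsto_zero_powrI[of _ _ _ "p - 1"] simp: eventually_at_right_less eventually_at_filter)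
  qed auto
  then have "(f has_real_derivative 0) (at 0 within {0..})"
    unfolding has_field_derivative_iff at_within_Ici_at_right by (simp add: gf_simps)
  then have "(f has_vector_derivative 0) (at 0 within {0..})"
    by (simp add: has_real_derivative_iff_has_vector_derivative)
  then show ?thesis
    unfolding deriv0_def by (intro vector_derivative_within) (auto simp: at_within_Ici_at_right)
qed

lemma gf_deriv_nonneg: "0 \<le> t \<Longrightarrow> 0 \<le> deriv0 f t"
proof (cases "t = 0")
  case False
  assume "0 \<le> t"
  with False have t: "0 < t" by simp
  have "0 \<le> p * f t" using gf_pos[OF t] pq by simp
  also have "\<dots> \<le> t * deriv0 f t" using t by (intro gf_bounds) simp
  finally show ?thesis using t by (simp add: zero_le_mult_iff)
qed (simp add: gf_deriv_0)

lemma gf_deriv_mono: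
  assumes "0 \<le> a" "a \<le> b"
  shows "deriv0 f a \<le> deriv0 f b"
proof (cases "a = 0 \<or> a = b")
  case True
  then show ?thesis using gf_deriv_nonneg[of b] assms by (auto simp: gf_deriv_0)
next
  case False
  then have ab: "0 < a" "a < b" using assms by auto
  have cv: "convex_on {0..} f" using gf by (simp add: growth_function_def)
  have "deriv0 f a * (b - a) \<le> f b - f a"
    using ab gf_has_derivative_within[of a]
    by (intro convex_on_imp_above_tangent[OF cv]) (auto simp: interior_Ici)
  moreover have "deriv0 f b * (a - b) \<le> f a - f b"
    using ab gf_has_derivative_within[of b]
    by (intro convex_on_imp_above_tangent[OF cv]) (auto simp: interior_Ici)
  ultimately have "deriv0 f a * (b - a) \<le> deriv0 f b * (b - a)" by (simp add: algebra_simps)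
  then show ?thesis using ab by simp
qed

text \<open>f' is comparable to f(t)/t with constants p and q. Passing to f and back costs the
  factor q/p.\<close>

lemma gf_deriv_scale:
  assumes "1 \<le> \<mu>" "0 \<le> t"
  shows "deriv0 f (\<mu> * t) \<le> q / p * \<mu> powr (q - 1) * deriv0 f t"
    "p / q * \<mu> powr (p - 1) * deriv0 f t \<le> deriv0 f (\<mu> * t)"
proof -
  have "deriv0 f (\<mu> * t) \<le> q / p * \<mu> powr (q - 1) * deriv0 f t \<and>
    p / q * \<mu> powr (p - 1) * deriv0 f t \<le> deriv0 f (\<mu> * t)"
  proof (cases "t = 0")
    case False
    have t: "0 < t" "0 < \<mu> * t" "0 < \<mu>" using assms False by auto
    have "\<mu> * t * deriv0 f (\<mu> * t) \<le> q * f (\<mu> * t)" using t by (intro gf_bounds) auto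
    also have "\<dots> \<le> q * (\<mu> powr q * f t)" using assms pq by (intro mult_left_mono gf_scale) auto
    also have "\<dots> \<le> q * (\<mu> powr q * (t * deriv0 f t / p))"
      using gf_bounds(1)[of t] t pq by (intro mult_left_mono) (auto simp: le_divide_eq mult.commute)
    also have "\<dots> = \<mu> * t * (q / p * \<mu> powr (q - 1) * deriv0 f t)"
      using t by (simp add: powr_diff)
    finally have 1: "deriv0 f (\<mu> * t) \<le> q / p * \<mu> powr (q - 1) * deriv0 f t"
      using t by (subst (asm) mult_le_cancel_left_pos) auto
    have "\<mu> * t * (p / q * \<mu> powr (p - 1) * deriv0 f t) = p * (\<mu> powr p * (t * deriv0 f t / q))"
      using t by (simp add: powr_diff)
    also have "\<dots> \<le> p * (\<mu> powr p * f t)"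
      using gf_bounds(2)[of t] t pq by (intro mult_left_mono) (auto simp: divide_le_eq mult.commute)
    also have "\<dots> \<le> p * f (\<mu> * t)" using assms pq by (intro mult_left_mono gf_scale) auto
    also have "\<dots> \<le> \<mu> * t * deriv0 f (\<mu> * t)" using t by (intro gf_bounds) auto
    finally have 2: "p / q * \<mu> powr (p - 1) * deriv0 f t \<le> deriv0 f (\<mu> * t)"
      using t by (subst (asm) mult_le_cancel_left_pos) auto
    from 1 2 show ?thesis by simp
  qed (simp add: gf_deriv_0)
  then show "deriv0 f (\<mu> * t) \<le> q / p * \<mu> powr (q - 1) * deriv0 f t"
    "p / q * \<mu> powr (p - 1) * deriv0 f t \<le> deriv0 f (\<mu> * t)" by auto
qed

lemma gf_deriv_add:
  assumes "0 \<le> a" "0 \<le> b"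
  shows "deriv0 f (a + b) \<le> q / p * 2 powr (q - 1) * (deriv0 f a + deriv0 f b)"
proof -
  define m where "m = max a b"
  have "deriv0 f (a + b) \<le> deriv0 f (2 * m)" using assms by (intro gf_deriv_mono) (auto simp: m_def)
  also have "\<dots> \<le> q / p * 2 powr (q - 1) * deriv0 f m" using assms by (intro gf_deriv_scale) (auto simp: m_def)
  also have "\<dots> \<le> q / p * 2 powr (q - 1) * (deriv0 f a + deriv0 f b)"
    using assms gf_deriv_nonneg pq by (intro mult_left_mono) (auto simp: m_def max_def)
  finally show ?thesis .
qed

end

section \<open>Measurability and the kernel outside a ball\<close>

text \<open>\<open>f\<close> is constrained on [0,\<infinity>) only. Composing with
  \<open>max 0\<close> gives functions monotone on the whole line, hence Borel.\<close>

lemma measurable_gf: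
  assumes "1 < p" "p \<le> q" "growth_function p q f"
  shows "(\<lambda>t. f (max 0 t)) \<in> borel_measurable borel" "(\<lambda>t. deriv0 f (max 0 t)) \<in> borel_measurable borel"
  using gf_mono[OF assms] gf_deriv_mono[OF assms]
  by (auto intro!: borel_measurable_mono monoI)

text \<open>Dyadic decomposition at the radii 2^m r. Bounding each annulus by its outer ball leaves
  a geometric series of ratio 2^(-s), which is controlled uniformly for s \<ge> s0.\<close>

lemma nn_integral_outside_ball:
  fixes x0 :: "'a::euclidean_space"
  assumes "0 < s" "0 < r"
  shows "(\<integral>\<^sup>+y\<in>- ball x0 r. ennreal (1 / norm (y - x0) powr (real DIM('a) + s)) \<partial>lborel)
    \<le> ennreal (unit_ball_vol (real DIM('a)) * 2 ^ DIM('a) / (1 - 2 powr (- s)) / r powr s)"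
proof -
  let ?V = "unit_ball_vol (real DIM('a))"
  let ?d = "real DIM('a)"
  define c where "c m = 1 / (2 ^ m * r) powr (?d + s)" for m :: nat
  have pt: "ennreal (1 / norm (y - x0) powr (?d + s)) * indicator (- ball x0 r) y
     \<le> (\<Sum>m. ennreal (c m) * indicator (ball x0 (2 ^ Suc m * r)) y)" for y
  proof (cases "y \<in> ball x0 r")
    case False
    then have y: "r \<le> norm (y - x0)" by (simp add: dist_norm norm_minus_commute)
    then have "1 \<le> norm (y - x0) / r" using assms by simp
    then obtain m where m: "2 ^ m \<le> norm (y - x0) / r" "norm (y - x0) / r < 2 ^ Suc m"
      using ex_dyadic by blast
    then have m': "2 ^ m * r \<le> norm (y - x0)" "norm (y - x0) < 2 ^ Suc m * r"
      using assms by (simp_all add: le_divide_eq divide_less_eq)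
    have "1 / norm (y - x0) powr (?d + s) \<le> c m"
      unfolding c_def using m' assms y by (intro divide_left_mono powr_mono2 mult_pos_pos) auto
    then have "ennreal (1 / norm (y - x0) powr (?d + s)) \<le> ennreal (c m) * indicator (ball x0 (2 ^ Suc m * r)) y"
      using m' by (auto simp: dist_norm norm_minus_commute intro!: ennreal_leI)
    also have "\<dots> \<le> (\<Sum>m. ennreal (c m) * indicator (ball x0 (2 ^ Suc m * r)) y)"
    proof -
      have "F m \<le> (\<Sum>m. F m)" for F :: "nat \<Rightarrow> ennreal" using sum_le_suminf[of F "{m}"] by simp
      then show ?thesis .
    qed
    finally show ?thesis using False by simp
  qed auto
  have "(\<integral>\<^sup>+y\<in>- ball x0 r. ennreal (1 / norm (y - x0) powr (?d + s)) \<partial>lborel)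
    \<le> (\<integral>\<^sup>+y. (\<Sum>m. ennreal (c m) * indicator (ball x0 (2 ^ Suc m * r)) y) \<partial>lborel)"
    by (intro nn_integral_mono pt)
  also have "\<dots> = (\<Sum>m. ennreal (c m) * emeasure lborel (ball x0 (2 ^ Suc m * r)))"
  proof -
    have "(\<lambda>y. ennreal (c m) * indicator (ball x0 (2 ^ Suc m * r)) y) \<in> borel_measurable lborel" for m
      by (intro borel_measurable_times_ennreal borel_measurable_indicator borel_measurable_const) simp
    then have "(\<integral>\<^sup>+y. (\<Sum>m. ennreal (c m) * indicator (ball x0 (2 ^ Suc m * r)) y) \<partial>lborel)
      = (\<Sum>m. \<integral>\<^sup>+y. ennreal (c m) * indicator (ball x0 (2 ^ Suc m * r)) y \<partial>lborel)"
      by (rule nn_integral_suminf)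
    also have "\<dots> = (\<Sum>m. ennreal (c m) * emeasure lborel (ball x0 (2 ^ Suc m * r)))"
      by (intro suminf_cong nn_integral_cmult_indicator) simp
    finally show ?thesis .
  qed
  also have "\<dots> = (\<Sum>m. ennreal (?V * 2 ^ DIM('a) / r powr s * (2 powr (- s)) ^ m))"
  proof (rule suminf_cong)
    fix m
    have "c m * (?V * (2 ^ Suc m * r) ^ DIM('a)) = ?V * 2 ^ DIM('a) / r powr s * (2 powr (- s)) ^ m"
    proof -
      have "(2 ^ m * r) powr (?d + s) = (2 ^ m * r) ^ DIM('a) * ((2 powr s) ^ m * r powr s)"
      proof -
        have "(2 ^ m :: real) powr s = (2 powr real m) powr s" by (simp add: powr_realpow)
        also have "\<dots> = 2 powr (s * real m)" by (simp add: powr_powr mult.commute)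
        also have "\<dots> = (2 powr s) ^ m" by (simp add: powr_power mult.commute)
        finally have "(2 ^ m * r) powr s = (2 powr s) ^ m * r powr s" by (simp add: powr_mult)
        moreover have "(2 ^ m * r) powr ?d = (2 ^ m * r) ^ DIM('a)" using assms by (intro powr_realpow) simp
        ultimately show ?thesis by (simp only: powr_add)
      qed
      moreover have "(2 ^ Suc m * r) ^ DIM('a) = 2 ^ DIM('a) * (2 ^ m * r) ^ DIM('a)"
        by (simp add: power_mult_distrib)
      moreover have "(2 powr (- s)) ^ m = 1 / (2 powr s) ^ m"
        by (simp add: powr_minus_divide power_one_over)
      ultimately show ?thesis using assms by (simp add: c_def)
    qed
    moreover have "emeasure lborel (ball x0 (2 ^ Suc m * r)) = ennreal (?V * (2 ^ Suc m * r) ^ DIM('a))"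
      using assms by (intro emeasure_ball) auto
    ultimately show "ennreal (c m) * emeasure lborel (ball x0 (2 ^ Suc m * r)) = ennreal (?V * 2 ^ DIM('a) / r powr s * (2 powr (- s)) ^ m)"
      by (simp add: ennreal_mult[symmetric] c_def assms less_imp_le del: power_Suc)
  qed
  also have "\<dots> = ennreal (?V * 2 ^ DIM('a) / r powr s * (1 / (1 - 2 powr (- s))))"
  proof (rule suminf_ennreal_eq)
    show "(\<lambda>m. ?V * 2 ^ DIM('a) / r powr s * (2 powr (- s)) ^ m) sums (?V * 2 ^ DIM('a) / r powr s * (1 / (1 - 2 powr (- s))))"
      using assms by (intro sums_mult geometric_sums) (simp add: powr_less_one)
  qed auto
  finally show ?thesis by (simp add: mult_ac)
qed

section \<open>The Caccioppoli inequality for De Giorgi classes\<close>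

text \<open>The inequality of the class for one ball and one level, unfolded and over
  \<open>lborel\<close>, so that it can be transferred to a Borel representative of
  \<open>u\<close>.\<close>

definition DG_ineq :: "real \<Rightarrow> real \<Rightarrow> real \<Rightarrow> (real \<Rightarrow> real) \<Rightarrow> ('a::euclidean_space \<Rightarrow> real) \<Rightarrow> 'a \<Rightarrow> real \<Rightarrow> real \<Rightarrow> real \<Rightarrow> bool" where
  "DG_ineq q c s f u x0 r R k \<longleftrightarrow>
     ennreal (1 - s) * (\<integral>\<^sup>+x\<in>ball x0 r. (\<integral>\<^sup>+y\<in>ball x0 r.
        ennreal (f (\<bar>neg_part (u x - k) - neg_part (u y - k)\<bar> / norm (x - y) powr s) / norm (x - y) ^ DIM('a)) \<partial>lborel) \<partial>lborel)
     + ennreal (1 - s) * (\<integral>\<^sup>+x\<in>ball x0 r. (\<integral>\<^sup>+y\<in>{y. u y > k}.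
          ennreal (deriv0 f (pos_part (u y - k) / norm (x - y) powr s) * (neg_part (u x - k) / norm (x - y) powr s)
             / norm (x - y) ^ DIM('a)) \<partial>lborel) \<partial>lborel)
     \<le> ennreal (c * (R / (R - r)) powr q) * (\<integral>\<^sup>+x\<in>ball x0 R. ennreal (f \<bar>neg_part (u x - k) / R powr s\<bar>) \<partial>lborel)
       + ennreal (c * (R / (R - r)) powr (real DIM('a) + s * q)) *
         (\<integral>\<^sup>+x\<in>ball x0 R. ennreal (neg_part (u x - k)) \<partial>lborel) * ennreal (1 - s) *
         (\<integral>\<^sup>+y\<in>- ball x0 r. ennreal (deriv0 f (neg_part (u y - k) / norm (y - x0) powr s)
             / norm (y - x0) powr (real DIM('a) + s)) \<partial>lborel)"

text \<open>Null sets enter through each variable of the iterated integrals separately: the inner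
  integral is compared for a frozen value of the outer variable, then the outer one. The
  representative can later be chosen Borel and nonnegative everywhere in the ball.\<close>

lemma De_Giorgi_minus_imp_DG_ineq:
  assumes u: "u \<in> De_Giorgi_minus \<Omega> q c s f" and "x0 \<in> \<Omega>" "0 < r" "r < R" "ereal R \<le> edist_set x0 (frontier \<Omega>)"
    and ae: "AE x in lborel. u x = v x"
  shows "DG_ineq q c s f v x0 r R k"
proof -
  have "DG_ineq q c s f u x0 r R k"
    using u assms(2-5) unfolding De_Giorgi_minus_def DG_ineq_def Let_def modular_W_def modular_L_def
    by (simp only: mem_Collect_eq nn_integral_completion)
  moreover have "(\<integral>\<^sup>+x\<in>A. (\<integral>\<^sup>+y\<in>B. F (u x) (u y) x y \<partial>lborel) \<partial>lborel) = (\<integral>\<^sup>+x\<in>A. (\<integral>\<^sup>+y\<in>B. F (v x) (v y) x y \<partial>lborel) \<partial>lborel)"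
    for F :: "real \<Rightarrow> real \<Rightarrow> 'a \<Rightarrow> 'a \<Rightarrow> ennreal" and A B
  proof (rule nn_integral_cong_AE)
    have inner: "(\<integral>\<^sup>+y\<in>B. F a (u y) x y \<partial>lborel) = (\<integral>\<^sup>+y\<in>B. F a (v y) x y \<partial>lborel)" for a x
      by (rule nn_integral_cong_AE) (use ae in eventually_elim, simp)
    show "AE x in lborel. (\<integral>\<^sup>+y\<in>B. F (u x) (u y) x y \<partial>lborel) * indicator A x
      = (\<integral>\<^sup>+y\<in>B. F (v x) (v y) x y \<partial>lborel) * indicator A x"
      using ae by eventually_elim (simp add: inner)
  qed
  from this[of "\<lambda>a b x y. ennreal (f (\<bar>neg_part (a - k) - neg_part (b - k)\<bar> / norm (x - y) powr s) / norm (x - y) ^ DIM('a))"]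
  have "(\<integral>\<^sup>+x\<in>A. (\<integral>\<^sup>+y\<in>B. ennreal (f (\<bar>neg_part (u x - k) - neg_part (u y - k)\<bar> / norm (x - y) powr s) / norm (x - y) ^ DIM('a)) \<partial>lborel) \<partial>lborel)
     = (\<integral>\<^sup>+x\<in>A. (\<integral>\<^sup>+y\<in>B. ennreal (f (\<bar>neg_part (v x - k) - neg_part (v y - k)\<bar> / norm (x - y) powr s) / norm (x - y) ^ DIM('a)) \<partial>lborel) \<partial>lborel)"
    for A B .
  moreover have "(\<integral>\<^sup>+x\<in>A. (\<integral>\<^sup>+y\<in>{y. u y > k}. F (u x) (u y) x y \<partial>lborel) \<partial>lborel) = (\<integral>\<^sup>+x\<in>A. (\<integral>\<^sup>+y\<in>{y. v y > k}. F (v x) (v y) x y \<partial>lborel) \<partial>lborel)"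
    for F :: "real \<Rightarrow> real \<Rightarrow> 'a \<Rightarrow> 'a \<Rightarrow> ennreal" and A
  proof (rule nn_integral_cong_AE)
    have inner: "(\<integral>\<^sup>+y\<in>{y. u y > k}. F a (u y) x y \<partial>lborel) = (\<integral>\<^sup>+y\<in>{y. v y > k}. F a (v y) x y \<partial>lborel)" for a x
      by (rule nn_integral_cong_AE) (use ae in eventually_elim, simp add: indicator_def)
    show "AE x in lborel. (\<integral>\<^sup>+y\<in>{y. u y > k}. F (u x) (u y) x y \<partial>lborel) * indicator A x
      = (\<integral>\<^sup>+y\<in>{y. v y > k}. F (v x) (v y) x y \<partial>lborel) * indicator A x"
      using ae by eventually_elim (simp add: inner)
  qed
  from this[of "\<lambda>a b x y. ennreal (deriv0 f (pos_part (b - k) / norm (x - y) powr s) * (neg_part (a - k) / norm (x - y) powr s)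
             / norm (x - y) ^ DIM('a))"]
  have "(\<integral>\<^sup>+x\<in>A. (\<integral>\<^sup>+y\<in>{y. u y > k}.
          ennreal (deriv0 f (pos_part (u y - k) / norm (x - y) powr s) * (neg_part (u x - k) / norm (x - y) powr s)
             / norm (x - y) ^ DIM('a)) \<partial>lborel) \<partial>lborel)
      = (\<integral>\<^sup>+x\<in>A. (\<integral>\<^sup>+y\<in>{y. v y > k}.
          ennreal (deriv0 f (pos_part (v y - k) / norm (x - y) powr s) * (neg_part (v x - k) / norm (x - y) powr s)
             / norm (x - y) ^ DIM('a)) \<partial>lborel) \<partial>lborel)" for A .
  moreover have 1: "(\<integral>\<^sup>+x\<in>A. F (u x) x \<partial>lborel) = (\<integral>\<^sup>+x\<in>A. F (v x) x \<partial>lborel)"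
    for F :: "real \<Rightarrow> 'a \<Rightarrow> ennreal" and A
    by (rule nn_integral_cong_AE) (use ae in eventually_elim, simp)
  ultimately show ?thesis
    unfolding DG_ineq_def
      1[of "\<lambda>a x. ennreal (f \<bar>neg_part (a - k) / R powr s\<bar>)"]
      1[of "\<lambda>a x. ennreal (neg_part (a - k))"]
      1[of "\<lambda>a y. ennreal (deriv0 f (neg_part (a - k) / norm (y - x0) powr s) / norm (y - x0) powr (real DIM('a) + s))"]
    by simp
qed

lemma le_edist_frontier:
  assumes "open \<Omega>" "ball x0 R \<subseteq> \<Omega>"
  shows "ereal R \<le> edist_set x0 (frontier \<Omega>)"
  unfolding edist_set_def
proof (rule INF_greatest)
  fix z assume "z \<in> frontier \<Omega>"
  then have "z \<notin> \<Omega>" using assms by (simp add: frontier_def interior_open)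
  then have "z \<notin> ball x0 R" using assms by auto
  then show "ereal R \<le> ereal (dist x0 z)" by simp
qed

text \<open>The integral inside \<open>Tail\<close> for the negative part, without the prefactor
  (1-s) r^s and without the inverse of f'.\<close>

definition tail_integral :: "(real \<Rightarrow> real) \<Rightarrow> real \<Rightarrow> ('a::euclidean_space \<Rightarrow> real) \<Rightarrow> 'a \<Rightarrow> real \<Rightarrow> ennreal" where
  "tail_integral g s v x0 r = (\<integral>\<^sup>+y\<in>- ball x0 r.
     ennreal (g (neg_part (v y) / norm (y - x0) powr s) / norm (y - x0) powr (real DIM('a) + s)) \<partial>lborel)"

text \<open>The constant in f'(2t) \<le> D f'(t), that is, \<open>gf_deriv_scale\<close> with \<mu>
  = 2.\<close>

definition doubling :: "real \<Rightarrow> real \<Rightarrow> real" where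
  "doubling p q = q / p * 2 powr (q - 1)"

definition tail_const :: "nat \<Rightarrow> real \<Rightarrow> real \<Rightarrow> real \<Rightarrow> real" where
  "tail_const d s0 p q = doubling p q * (2 * doubling p q * (unit_ball_vol (real d) * 2 ^ d / (1 - 2 powr (- s0))) + 1)"

lemma doubling_pos: "1 < p \<Longrightarrow> p \<le> q \<Longrightarrow> 0 < doubling p q"
  by (simp add: doubling_def)

lemma tail_const_nonneg:
  assumes "1 < p" "p \<le> q" "0 < s0"
  shows "0 \<le> tail_const d s0 p q"
proof -
  have "2 powr (- s0) < 1" using assms by (simp add: powr_less_one)
  then show ?thesis using doubling_pos[OF assms(1,2)]
    unfolding tail_const_def by (intro mult_nonneg_nonneg add_nonneg_nonneg divide_nonneg_pos) auto
qed

lemma borel_measurable_tail_integrand: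
  fixes v :: "'a::euclidean_space \<Rightarrow> real"
  assumes "1 < p" "p \<le> q" "growth_function p q f" and [measurable]: "v \<in> borel_measurable borel"
  shows "(\<lambda>y. deriv0 f (neg_part (v y) / norm (y - x0) powr s)) \<in> borel_measurable borel"
proof -
  have "deriv0 f (neg_part (v y) / norm (y - x0) powr s)
      = deriv0 f (max 0 (neg_part (v y) / norm (y - x0) powr s))" for y
    by (simp add: neg_part_def max_def)
  moreover have "(\<lambda>y. deriv0 f (max 0 (neg_part (v y) / norm (y - x0) powr s))) \<in> borel_measurable borel"
    unfolding neg_part_def by (intro measurable_compose[OF _ measurable_gf(2)[OF assms(1-3)]]) measurable
  ultimately show ?thesis by simp
qed

text \<open>Since (v-k)_- \<le> k + v_-, quasi-additivity of f' splits the integrand. The constant k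
  integrates against the kernel to a multiple of f'(k/r^s)/r^s; the part with v_- is the tail, which
  the hypothesis \<open>tail\<close> makes subordinate to the level.\<close>

lemma level_tail_bound:
  fixes v :: "'a::euclidean_space \<Rightarrow> real"
  assumes pq: "1 < p" "p \<le> q" and gf: "growth_function p q f" and s: "0 < s0" "s0 \<le> s" "s < 1"
    and mv [measurable]: "v \<in> borel_measurable borel" and R: "0 < R" and k: "0 < k"
    and nn: "\<And>x. x \<in> ball x0 R \<Longrightarrow> 0 \<le> v x"
    and tail: "ennreal (1 - s) * tail_integral (deriv0 f) s v x0 R \<le> ennreal (deriv0 f (k / R powr s) / R powr s)"
    and r: "R / 2 \<le> r" "r < R"
  shows "ennreal (1 - s) * (\<integral>\<^sup>+y\<in>- ball x0 r. ennreal (deriv0 f (neg_part (v y - k) / norm (y - x0) powr s)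
             / norm (y - x0) powr (real DIM('a) + s)) \<partial>lborel)
    \<le> ennreal (tail_const DIM('a) s0 p q * (deriv0 f (k / R powr s) / R powr s))"
proof -
  let ?g = "deriv0 f"
  let ?D = "doubling p q"
  let ?e = "real DIM('a) + s"
  let ?W = "unit_ball_vol (real DIM('a)) * 2 ^ DIM('a)"
  define K where "K = ?W / (1 - 2 powr (- s0))"
  note gnn = gf_deriv_nonneg[OF pq gf] and gmono = gf_deriv_mono[OF pq gf] and g0 = gf_deriv_0[OF pq gf]
  have D: "0 < ?D" using pq by (rule doubling_pos)
  have r0: "0 < r" using r R by linarith
  have s0lt: "2 powr (- s0) < 1" using s by (simp add: powr_less_one)
  have K0: "0 \<le> K" using s0lt by (simp add: K_def)
  note borel_measurable_tail_integrand[OF pq gf mv, measurable]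
  have pt: "ennreal (?g (neg_part (v y - k) / norm (y - x0) powr s) / norm (y - x0) powr ?e) * indicator (- ball x0 r) y
     \<le> ennreal (?D * ?g (k / r powr s)) * (ennreal (1 / norm (y - x0) powr ?e) * indicator (- ball x0 r) y)
       + ennreal ?D * (ennreal (?g (neg_part (v y) / norm (y - x0) powr s) / norm (y - x0) powr ?e) * indicator (- ball x0 R) y)" for y
  proof (cases "y \<in> ball x0 r")
    case False
    let ?n = "norm (y - x0)"
    have n: "r \<le> ?n" using False by (simp add: dist_norm norm_minus_commute)
    then have n0: "0 < ?n" using r0 by linarith
    have "?g (neg_part (v y - k) / ?n powr s) \<le> ?g (k / ?n powr s + neg_part (v y) / ?n powr s)"
      using k by (intro gmono) (auto simp: neg_part_def add_divide_distrib[symmetric] intro!: divide_right_mono)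
    also have "\<dots> \<le> ?D * (?g (k / ?n powr s) + ?g (neg_part (v y) / ?n powr s))"
      unfolding doubling_def using k by (intro gf_deriv_add[OF pq gf]) (auto simp: neg_part_def)
    also have "\<dots> \<le> ?D * (?g (k / r powr s) + ?g (neg_part (v y) / ?n powr s))"
    proof -
      have "r powr s \<le> ?n powr s" using n r0 s by (intro powr_mono2) auto
      then have "k / ?n powr s \<le> k / r powr s" using k r0 n0 by (intro divide_left_mono) auto
      then show ?thesis using k D by (intro mult_left_mono add_right_mono gmono) auto
    qed
    finally have 1: "?g (neg_part (v y - k) / ?n powr s) / ?n powr ?e
       \<le> ?D * (?g (k / r powr s) + ?g (neg_part (v y) / ?n powr s)) / ?n powr ?e"
      by (intro divide_right_mono) auto
    have g1: "0 \<le> ?g (k / r powr s)" "0 \<le> ?g (neg_part (v y) / ?n powr s)"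
      using k by (auto intro!: gnn simp: neg_part_def)
    have "ennreal (?g (neg_part (v y - k) / ?n powr s) / ?n powr ?e)
       \<le> ennreal (?D * ?g (k / r powr s) * (1 / ?n powr ?e) + ?D * (?g (neg_part (v y) / ?n powr s) / ?n powr ?e))"
      using 1 by (intro ennreal_leI) (simp add: distrib_left add_divide_distrib)
    also have "\<dots> = ennreal (?D * ?g (k / r powr s)) * ennreal (1 / ?n powr ?e)
        + ennreal ?D * ennreal (?g (neg_part (v y) / ?n powr s) / ?n powr ?e)"
      using D g1 by (subst ennreal_plus) (auto simp: ennreal_mult[symmetric])
    \<comment> \<open>Between the two balls \<open>v\<close> is nonnegative and f'(0) = 0, so the
      complement of the small ball may be replaced by that of \<open>ball x0 R\<close>.\<close>
    also have "ennreal (?g (neg_part (v y) / ?n powr s) / ?n powr ?e)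
      = ennreal (?g (neg_part (v y) / ?n powr s) / ?n powr ?e) * indicator (- ball x0 R) y"
      using nn[of y] g0 by (cases "y \<in> ball x0 R") (auto simp: neg_part_def)
    finally show ?thesis using False by simp
  qed auto
  have "(\<integral>\<^sup>+y\<in>- ball x0 r. ennreal (?g (neg_part (v y - k) / norm (y - x0) powr s) / norm (y - x0) powr ?e) \<partial>lborel)
     \<le> (\<integral>\<^sup>+y. ennreal (?D * ?g (k / r powr s)) * (ennreal (1 / norm (y - x0) powr ?e) * indicator (- ball x0 r) y)
       + ennreal ?D * (ennreal (?g (neg_part (v y) / norm (y - x0) powr s) / norm (y - x0) powr ?e) * indicator (- ball x0 R) y) \<partial>lborel)"
    by (intro nn_integral_mono pt)
  also have "\<dots> = ennreal (?D * ?g (k / r powr s)) * (\<integral>\<^sup>+y\<in>- ball x0 r. ennreal (1 / norm (y - x0) powr ?e) \<partial>lborel)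
      + ennreal ?D * tail_integral ?g s v x0 R"
    unfolding tail_integral_def by (subst nn_integral_add, measurable) (simp add: nn_integral_cmult)
  also have "\<dots> \<le> ennreal (?D * ?g (k / r powr s)) * ennreal (K / r powr s) + ennreal ?D * tail_integral ?g s v x0 R"
  proof (intro add_right_mono mult_left_mono)
    have "(\<integral>\<^sup>+y\<in>- ball x0 r. ennreal (1 / norm (y - x0) powr ?e) \<partial>lborel) \<le> ennreal (?W / (1 - 2 powr (- s)) / r powr s)"
      using s r0 by (intro nn_integral_outside_ball) auto
    also have "\<dots> \<le> ennreal (K / r powr s)"
    proof (intro ennreal_leI divide_right_mono)
      have "2 powr (- s) \<le> 2 powr (- s0)" using s by (intro powr_mono) auto
      moreover from this have "2 powr (- s) < 1" using s0lt by linarith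
      ultimately show "?W / (1 - 2 powr (- s)) \<le> K" unfolding K_def using s0lt
        by (intro divide_left_mono mult_pos_pos) (simp_all del: powr_le_cancel_iff)
    qed auto
    finally show "(\<integral>\<^sup>+y\<in>- ball x0 r. ennreal (1 / norm (y - x0) powr ?e) \<partial>lborel) \<le> ennreal (K / r powr s)" .
  qed auto
  finally have "ennreal (1 - s) * (\<integral>\<^sup>+y\<in>- ball x0 r. ennreal (?g (neg_part (v y - k) / norm (y - x0) powr s) / norm (y - x0) powr ?e) \<partial>lborel)
     \<le> ennreal (1 - s) * (ennreal (?D * ?g (k / r powr s)) * ennreal (K / r powr s) + ennreal ?D * tail_integral ?g s v x0 R)"
    by (rule mult_left_mono) simp
  also have "\<dots> = ennreal (1 - s) * ennreal (?D * ?g (k / r powr s) * (K / r powr s)) + ennreal ?D * (ennreal (1 - s) * tail_integral ?g s v x0 R)"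
  proof -
    have "ennreal (?D * ?g (k / r powr s)) * ennreal (K / r powr s) = ennreal (?D * ?g (k / r powr s) * (K / r powr s))"
      using D gnn[of "k / r powr s"] k K0 by (intro ennreal_mult[symmetric]) auto
    then show ?thesis by (simp only: distrib_left mult.left_commute)
  qed
  also have "\<dots> \<le> 1 * ennreal (?D * (?D * ?g (k / R powr s)) * (2 * K / R powr s)) + ennreal ?D * ennreal (?g (k / R powr s) / R powr s)"
  proof (intro add_mono mult_mono mult_left_mono tail ennreal_leI)
    have Rr: "R powr s \<le> 2 * r powr s"
    proof -
      have "R powr s \<le> (2 * r) powr s" using r R s by (intro powr_mono2) auto
      also have "\<dots> = 2 powr s * r powr s" by (rule powr_mult)
      also have "\<dots> \<le> 2 powr 1 * r powr s" using s by (intro mult_right_mono powr_mono) auto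
      finally show ?thesis by simp
    qed
    have "k / r powr s \<le> 2 * (k / R powr s)"
      using Rr k r0 R by (simp add: field_simps)
    then have "?g (k / r powr s) \<le> ?g (2 * (k / R powr s))" using k by (intro gmono) auto
    also have "\<dots> \<le> ?D * ?g (k / R powr s)"
      unfolding doubling_def using k by (intro gf_deriv_scale[OF pq gf]) auto
    finally show "?g (k / r powr s) \<le> ?D * ?g (k / R powr s)" .
    have "K * R powr s \<le> K * (2 * r powr s)" using Rr K0 by (rule mult_left_mono)
    then show "K / r powr s \<le> 2 * K / R powr s" using r0 R by (simp add: field_simps)
  qed (use D K0 s gnn k in auto)
  also have "\<dots> = ennreal (tail_const DIM('a) s0 p q * (?g (k / R powr s) / R powr s))"
  proof -
    have g1: "0 \<le> ?g (k / R powr s)" using k by (intro gnn) simp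
    have "tail_const DIM('a) s0 p q * (?g (k / R powr s) / R powr s)
      = ?D * (?D * ?g (k / R powr s)) * (2 * K / R powr s) + ?D * (?g (k / R powr s) / R powr s)"
      unfolding tail_const_def K_def[symmetric] by (simp add: algebra_simps)
    then show ?thesis using D K0 g1 by (simp add: ennreal_mult[symmetric] flip: ennreal_plus)
  qed
  finally show ?thesis .
qed

definition caccioppoli_const :: "nat \<Rightarrow> real \<Rightarrow> real \<Rightarrow> real \<Rightarrow> real \<Rightarrow> real" where
  "caccioppoli_const d s0 p q c = c * (2 powr q + q * tail_const d s0 p q)"

text \<open>Both terms on the right of the De Giorgi inequality are at most a constant times
  f(k/R^s) |{v < k}|, the nonlocal one because k f'(k/R^s)/R^s \<le> q f(k/R^s). Both terms on the
  left dominate f(k/R^s) times \<open>energy\<close> and \<open>cross\<close>. The positive number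
  f(k/R^s) then cancels, and no trace of \<open>f\<close> remains.\<close>

lemma DG_ineq_imp_caccioppoli:
  fixes v :: "'a::euclidean_space \<Rightarrow> real"
  assumes pq: "1 < p" "p \<le> q" and gf: "growth_function p q f" and s: "0 < s0" "s0 \<le> s" "s < 1" and c: "0 \<le> c"
    and mv [measurable]: "v \<in> borel_measurable borel" and R: "0 < R" and k: "0 < k"
    and nn: "\<And>x. x \<in> ball x0 R \<Longrightarrow> 0 \<le> v x"
    and DG: "\<And>r r'. 0 < r \<Longrightarrow> r < r' \<Longrightarrow> r' \<le> R \<Longrightarrow> DG_ineq q c s f v x0 r r' k"
    and tail: "ennreal (1 - s) * tail_integral (deriv0 f) s v x0 R \<le> ennreal (deriv0 f (k / R powr s) / R powr s)"
  shows "caccioppoli p q s (caccioppoli_const DIM('a) s0 p q c) (real DIM('a) + q) v x0 R k"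
  unfolding caccioppoli_def
proof (intro allI impI)
  fix r r' :: real assume "R / 2 \<le> r \<and> r < r' \<and> r' \<le> R"
  then have r: "R / 2 \<le> r" "r < r'" "r' \<le> R" by auto
  let ?g = "deriv0 f"
  let ?F = "f (k / R powr s)"
  let ?G = "?g (k / R powr s) / R powr s"
  let ?T = "tail_const DIM('a) s0 p q"
  let ?d = "real DIM('a)"
  let ?S = "{x \<in> ball x0 r'. v x < k}"
  let ?M1 = "\<integral>\<^sup>+x\<in>ball x0 r'. ennreal (f \<bar>neg_part (v x - k) / r' powr s\<bar>) \<partial>lborel"
  let ?M2 = "\<integral>\<^sup>+x\<in>ball x0 r'. ennreal (neg_part (v x - k)) \<partial>lborel"
  let ?M3 = "\<integral>\<^sup>+y\<in>- ball x0 r. ennreal (?g (neg_part (v y - k) / norm (y - x0) powr s)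
             / norm (y - x0) powr (?d + s)) \<partial>lborel"
  let ?D = "\<lambda>x y. \<bar>neg_part (v x - k) - neg_part (v y - k)\<bar>"
  let ?f = "\<lambda>x y. f (\<bar>neg_part (v x - k) - neg_part (v y - k)\<bar> / norm (x - y) powr s) / norm (x - y) ^ DIM('a)"
  let ?h = "\<lambda>x y. ?g (pos_part (v y - k) / norm (x - y) powr s) * (neg_part (v x - k) / norm (x - y) powr s)
             / norm (x - y) ^ DIM('a)"
  let ?W = "\<lambda>x y. \<bar>max (k - v x) 0 / k - max (k - v y) 0 / k\<bar>"
  let ?P = "\<lambda>x y. Psi p q (\<bar>max (k - v x) 0 / k - max (k - v y) 0 / k\<bar> * (R / norm (x - y)) powr s)"
  define A where "A = emeasure lborel ?S"
  \<comment> \<open>The exponents q and d + sq are both at most d + q, and the ratio of radii is at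
    least 1, so one power serves for both terms and for all s.\<close>
  define X where "X = (R / (r' - r)) powr (?d + q)"
  note gnn = gf_deriv_nonneg[OF pq gf] and fmono = gf_mono[OF pq gf] and f0 = gf_simps[OF pq gf]
  have r0: "0 < r" "0 < r'" using r R by linarith+
  have F: "0 < ?F" using k R by (intro gf_pos[OF pq gf]) simp
  have G0: "0 \<le> ?G" using k by (intro divide_nonneg_nonneg gnn) auto
  have T0: "0 \<le> ?T" using pq s by (intro tail_const_nonneg) auto
  have X0: "0 \<le> X" by (simp add: X_def)
  have kG: "k * ?G \<le> q * ?F" using gf_bounds(2)[OF pq gf, of "k / R powr s"] k by simp
  have mT [measurable]: "?S \<in> sets borel" by measurable
  have Xle: "(r' / (r' - r)) powr e \<le> X" if "0 \<le> e" "e \<le> ?d + q" for e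
  proof -
    have "(r' / (r' - r)) powr e \<le> (R / (r' - r)) powr e"
      using that r r0 by (intro powr_mono2 divide_right_mono) auto
    also have "\<dots> \<le> X" unfolding X_def using that r R r0 by (intro powr_mono) (auto simp: le_divide_eq)
    finally show ?thesis .
  qed
  have I1: "?M1 \<le> ennreal (2 powr q * ?F) * A"
  proof -
    have "ennreal (f \<bar>neg_part (v x - k) / r' powr s\<bar>) * indicator (ball x0 r') x
        \<le> ennreal (2 powr q * ?F) * indicator ?S x" for x
    proof (cases "x \<in> ball x0 r'")
      case True
      show ?thesis
      proof (cases "v x < k")
        case vk: True
        have "0 \<le> v x" using True r by (intro nn) auto
        then have w: "\<bar>neg_part (v x - k) / r' powr s\<bar> \<le> 2 * (k / R powr s)"
        proof -
          have "R powr s \<le> (2 * r') powr s" using r R s by (intro powr_mono2) auto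
          also have "\<dots> = 2 powr s * r' powr s" by (rule powr_mult)
          also have "\<dots> \<le> 2 powr 1 * r' powr s" using s by (intro mult_right_mono powr_mono) auto
          finally have "R powr s \<le> 2 * r' powr s" by simp
          then have "k * R powr s \<le> k * (2 * r' powr s)" using k by (intro mult_left_mono) auto
          then have "k / r' powr s \<le> 2 * (k / R powr s)" using r0 R by (simp add: field_simps)
          moreover have "neg_part (v x - k) / r' powr s \<le> k / r' powr s"
            using \<open>0 \<le> v x\<close> vk by (intro divide_right_mono) (auto simp: neg_part_def)
          moreover have "0 \<le> neg_part (v x - k) / r' powr s" by (simp add: neg_part_def)
          ultimately show ?thesis by linarith
        qed
        have "f \<bar>neg_part (v x - k) / r' powr s\<bar> \<le> f (2 * (k / R powr s))" by (intro fmono w) auto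
        also have "\<dots> \<le> 2 powr q * ?F" using k by (intro gf_scale[OF pq gf]) auto
        finally show ?thesis using True vk by (auto intro!: ennreal_leI)
      next
        case False
        then have "neg_part (v x - k) = 0" by (simp add: neg_part_def)
        then show ?thesis by (simp add: f0)
      qed
    qed auto
    then have "?M1
      \<le> (\<integral>\<^sup>+x. ennreal (2 powr q * ?F) * indicator ?S x \<partial>lborel)"
      by (rule nn_integral_mono)
    also have "\<dots> = ennreal (2 powr q * ?F) * A"
      unfolding A_def by (rule nn_integral_cmult_indicator) simp
    finally show ?thesis .
  qed
  have I2: "?M2 \<le> ennreal k * A"
  proof -
    have "ennreal (neg_part (v x - k)) * indicator (ball x0 r') x
        \<le> ennreal k * indicator ?S x" for x
      using nn[of x] r by (auto simp: neg_part_def indicator_def max_def intro!: ennreal_leI)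
    then have "?M2
      \<le> (\<integral>\<^sup>+x. ennreal k * indicator ?S x \<partial>lborel)"
      by (rule nn_integral_mono)
    also have "\<dots> = ennreal k * A"
      unfolding A_def by (rule nn_integral_cmult_indicator) simp
    finally show ?thesis .
  qed
  have I3: "ennreal (1 - s) * ?M3 \<le> ennreal (?T * ?G)"
    using r by (intro level_tail_bound[OF pq gf s mv R k nn tail]) auto
  let ?E1 = "ennreal (1 - s) * (\<integral>\<^sup>+x\<in>ball x0 r. (\<integral>\<^sup>+y\<in>ball x0 r.
        ennreal (?f x y) \<partial>lborel) \<partial>lborel)"
  let ?E2 = "ennreal (1 - s) * (\<integral>\<^sup>+x\<in>ball x0 r. (\<integral>\<^sup>+y\<in>{y. v y > k}.
          ennreal (?h x y) \<partial>lborel) \<partial>lborel)"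
  have "?E1 + ?E2 \<le> ennreal (c * (r' / (r' - r)) powr q) * ?M1
       + ennreal (c * (r' / (r' - r)) powr (?d + s * q)) *
         ?M2 * (ennreal (1 - s) *
         ?M3)"
    using DG[OF r0(1) r(2,3)] unfolding DG_ineq_def by (simp only: mult.assoc)
  also have "\<dots> \<le> ennreal (c * X) * (ennreal (2 powr q * ?F) * A) + ennreal (c * X) * (ennreal k * A) * ennreal (?T * ?G)"
  proof (rule add_mono)
    have sq: "0 \<le> s * q" "s * q \<le> q" using s pq by (auto intro: mult_left_le_one_le)
    have X1: "ennreal (c * (r' / (r' - r)) powr q) \<le> ennreal (c * X)"
      using c pq by (intro ennreal_leI mult_left_mono Xle) auto
    have X2: "ennreal (c * (r' / (r' - r)) powr (?d + s * q)) \<le> ennreal (c * X)"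
      using c sq by (intro ennreal_leI mult_left_mono Xle) auto
    show "ennreal (c * (r' / (r' - r)) powr q) * ?M1
      \<le> ennreal (c * X) * (ennreal (2 powr q * ?F) * A)"
      by (rule mult_mono[OF X1 I1]) auto
    show "ennreal (c * (r' / (r' - r)) powr (?d + s * q)) *
         ?M2 * (ennreal (1 - s) *
         ?M3) \<le> ennreal (c * X) * (ennreal k * A) * ennreal (?T * ?G)"
      by (rule mult_mono[OF mult_mono[OF X2 I2] I3]) auto
  qed
  also have "\<dots> = ennreal (c * X * (2 powr q * ?F) + c * X * (?T * (k * ?G))) * A"
  proof -
    have eq: "ennreal (c * X * (2 powr q * ?F) + c * X * (?T * (k * ?G)))
      = ennreal (c * X) * ennreal (2 powr q * ?F) + ennreal (c * X) * ennreal k * ennreal (?T * ?G)"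
    proof -
      have "ennreal (c * X) * ennreal k * ennreal (?T * ?G) = ennreal (c * X * (?T * (k * ?G)))"
      proof -
        have "ennreal a * ennreal k * ennreal (t * g) = ennreal (a * (t * (k * g)))"
          if "0 \<le> a" "0 \<le> t" "0 \<le> g" for a t g
          using that k by (simp add: ennreal_mult mult_ac)
        from this[OF _ T0 G0] show ?thesis using c X0 by simp
      qed
      moreover have "ennreal (c * X) * ennreal (2 powr q * ?F) = ennreal (c * X * (2 powr q * ?F))"
        using c X0 F by (intro ennreal_mult[symmetric]) auto
      ultimately show ?thesis
        using c X0 k T0 G0 F by (simp only:) (intro ennreal_plus mult_nonneg_nonneg, auto)
    qed
    show ?thesis unfolding eq by (simp only: distrib_left distrib_right mult_ac)
  qed
  also have "\<dots> \<le> ennreal (?F * (caccioppoli_const DIM('a) s0 p q c * X)) * A"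
  proof (intro mult_right_mono ennreal_leI)
    have "c * X * (?T * (k * ?G)) \<le> c * X * (?T * (q * ?F))"
      using c X0 T0 by (intro mult_left_mono kG) auto
    then show "c * X * (2 powr q * ?F) + c * X * (?T * (k * ?G)) \<le> ?F * (caccioppoli_const DIM('a) s0 p q c * X)"
      unfolding caccioppoli_const_def by (simp add: algebra_simps)
  qed auto
  also have "\<dots> = ennreal ?F * (ennreal (caccioppoli_const DIM('a) s0 p q c * X) * A)"
    using F X0 c T0 pq by (simp add: ennreal_mult caccioppoli_const_def mult.assoc)
  finally have main: "?E1 + ?E2 \<le> ennreal ?F * (ennreal (caccioppoli_const DIM('a) s0 p q c * X) * A)" .
  \<comment> \<open>\<open>gf_Psi\<close> with the level as unit: a/n^s is the multiple (a/k)(R/n)^s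
    of k/R^s.\<close>
  have fP: "Psi p q (a / k * (R / n) powr s) * ?F \<le> f (a / n powr s)" if "0 \<le> a" "0 \<le> n" for a n
  proof -
    have "Psi p q (a / k * (R / n) powr s) * ?F \<le> f (a / k * (R / n) powr s * (k / R powr s))"
      using that k by (intro gf_Psi[OF pq gf]) auto
    also have "a / k * (R / n) powr s * (k / R powr s) = a / n powr s"
      using that k R by (simp add: powr_divide)
    finally show ?thesis .
  qed
  define G where "G = ball x0 r"
  have [measurable]: "G \<in> sets borel" by (simp add: G_def)
  have E1: "ennreal ?F * energy p q s R (ball x0 r) (\<lambda>x. max (k - v x) 0 / k) \<le> ?E1"
  proof -
    let ?e = "\<lambda>x y. indicator (ball x0 r) x * indicator (ball x0 r) y *
     ennreal (?P x y / norm (x - y) ^ DIM('a))"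
    have pt: "ennreal ?F * ?e x y \<le> ennreal (?f x y)
        * indicator (ball x0 r) y * indicator (ball x0 r) x" for x y
    proof -
      have "?W x y = ?D x y / k"
        using k by (simp add: neg_part_def diff_divide_distrib[symmetric])
      then have "?P x y * ?F
         \<le> f (?D x y / norm (x - y) powr s)"
        using fP[of "?D x y" "norm (x - y)"] by simp
      then have "?F * (?P x y / norm (x - y) ^ DIM('a))
         \<le> ?f x y"
        by (simp add: divide_right_mono mult.commute)
      then have "ennreal (?F * (?P x y / norm (x - y) ^ DIM('a)))
         \<le> ennreal (?f x y)"
        by (rule ennreal_leI)
      then have "ennreal ?F * ennreal (?P x y / norm (x - y) ^ DIM('a))
         \<le> ennreal (?f x y)"
        using F by (subst (asm) ennreal_mult) auto
      then show ?thesis by (auto simp: indicator_def)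
    qed
    have "ennreal ?F * energy p q s R (ball x0 r) (\<lambda>x. max (k - v x) 0 / k)
      = ennreal (1 - s) * (\<integral>\<^sup>+x. (\<integral>\<^sup>+y. ennreal ?F * ?e x y \<partial>lborel) \<partial>lborel)"
      unfolding energy_def G_def[symmetric] by (simp add: nn_integral_cmult mult.left_commute)
    also have "\<dots> \<le> ennreal (1 - s) * (\<integral>\<^sup>+x. (\<integral>\<^sup>+y. ennreal (?f x y)
        * indicator (ball x0 r) y * indicator (ball x0 r) x \<partial>lborel) \<partial>lborel)"
      by (intro mult_left_mono nn_integral_mono pt) auto
    also have "\<dots> = ?E1"
      by (intro arg_cong2[where f = "(*)"] refl nn_integral_cong) (auto simp: indicator_def)
    finally show ?thesis .
  qed
  have E2: "ennreal ?F * cross p q s R (ball x0 r) v k \<le> ?E2"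
  proof -
    let ?e = "\<lambda>x y. indicator (ball x0 r) x * indicator (ball x0 r) y *
     (if k < v y then ennreal (Psi p q ((v y - k) / k * (R / norm (x - y)) powr s) *
        (max (k - v x) 0 / (v y - k)) / norm (x - y) ^ DIM('a)) else 0)"
    have pt: "ennreal ?F * ?e x y \<le> ennreal (?h x y) * indicator {y. v y > k} y * indicator (ball x0 r) x" for x y
    proof (cases "x \<in> ball x0 r \<and> y \<in> ball x0 r \<and> k < v y \<and> x \<noteq> y")
      case True
      let ?n = "norm (x - y)" and ?b = "v y - k" and ?w = "max (k - v x) 0"
      have n: "0 < ?n" and b: "0 < ?b" using True by auto
      have "Psi p q (?b / k * (R / ?n) powr s) * ?F \<le> f (?b / ?n powr s)" using b by (intro fP) auto
      \<comment> \<open>f(t) \<le> t f'(t), from p \<ge> 1; multiplied by w/b it turns the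
        difference quotient of v - k into that of (v-k)_-.\<close>
      also have "\<dots> \<le> ?b / ?n powr s * ?g (?b / ?n powr s)"
        using gf_bounds(1)[OF pq gf, of "?b / ?n powr s"] f0(3)[of "?b / ?n powr s"] pq b
          mult_right_mono[of 1 p "f (?b / ?n powr s)"] by simp
      finally have "Psi p q (?b / k * (R / ?n) powr s) * ?F * (?w / ?b) \<le> ?b / ?n powr s * ?g (?b / ?n powr s) * (?w / ?b)"
        using b by (intro mult_right_mono) auto
      also have "\<dots> = ?g (?b / ?n powr s) * (?w / ?n powr s)" using b by simp
      finally have "?F * (Psi p q (?b / k * (R / ?n) powr s) * (?w / ?b)) \<le> ?g (?b / ?n powr s) * (?w / ?n powr s)"
        by (simp only: mult_ac)
      then have "?F * (Psi p q (?b / k * (R / ?n) powr s) * (?w / ?b) / ?n ^ DIM('a))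
          \<le> ?g (?b / ?n powr s) * (?w / ?n powr s) / ?n ^ DIM('a)"
        using divide_right_mono[of _ _ "?n ^ DIM('a)"] by fastforce
      then have "ennreal (?F * (Psi p q (?b / k * (R / ?n) powr s) * (?w / ?b) / ?n ^ DIM('a)))
          \<le> ennreal (?g (?b / ?n powr s) * (?w / ?n powr s) / ?n ^ DIM('a))"
        by (rule ennreal_leI)
      then have "ennreal ?F * ennreal (Psi p q (?b / k * (R / ?n) powr s) * (?w / ?b) / ?n ^ DIM('a))
          \<le> ennreal (?g (?b / ?n powr s) * (?w / ?n powr s) / ?n ^ DIM('a))"
        using F b by (subst (asm) ennreal_mult) auto
      moreover have "pos_part ?b = ?b" "neg_part (v x - k) = ?w" using b by (auto simp: pos_part_def neg_part_def)
      ultimately show ?thesis using True by simp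
    qed (auto simp: indicator_def)
    have "ennreal ?F * cross p q s R (ball x0 r) v k
      = ennreal (1 - s) * (\<integral>\<^sup>+x. (\<integral>\<^sup>+y. ennreal ?F * ?e x y \<partial>lborel) \<partial>lborel)"
      unfolding cross_def G_def[symmetric] by (simp add: nn_integral_cmult mult.left_commute)
    also have "\<dots> \<le> ennreal (1 - s) * (\<integral>\<^sup>+x. (\<integral>\<^sup>+y. ennreal (?h x y) * indicator {y. v y > k} y * indicator (ball x0 r) x \<partial>lborel) \<partial>lborel)"
      by (intro mult_left_mono nn_integral_mono pt) auto
    also have "\<dots> = ?E2"
      by (intro arg_cong2[where f = "(*)"] refl nn_integral_cong) (auto simp: indicator_def)
    finally show ?thesis .
  qed
  have cancel: "a \<le> b" if "ennreal ?F * a \<le> ennreal ?F * b" for a b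
    using that F by (subst (asm) ennreal_mult_le_mult_iff) auto
  show "energy p q s R (ball x0 r) (\<lambda>x. max (k - v x) 0 / k)
       \<le> ennreal (caccioppoli_const DIM('a) s0 p q c * (R / (r' - r)) powr (?d + q)) * emeasure lborel ?S \<and>
     cross p q s R (ball x0 r) v k
       \<le> ennreal (caccioppoli_const DIM('a) s0 p q c * (R / (r' - r)) powr (?d + q)) * emeasure lborel ?S"
    unfolding A_def[symmetric] X_def[symmetric]
  proof
    have le: "?E1 \<le> ?E1 + ?E2" "?E2 \<le> ?E1 + ?E2" by (auto intro: add_increasing add_increasing2)
    show "energy p q s R (ball x0 r) (\<lambda>x. max (k - v x) 0 / k) \<le> ennreal (caccioppoli_const DIM('a) s0 p q c * X) * A"
      "cross p q s R (ball x0 r) v k \<le> ennreal (caccioppoli_const DIM('a) s0 p q c * X) * A"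
      by (rule cancel[OF order_trans[OF E1 order_trans[OF le(1) main]]],
          rule cancel[OF order_trans[OF E2 order_trans[OF le(2) main]]])
  qed
qed

section \<open>Tails, decay of the distribution function, and the theorem\<close>

text \<open>The strict inequality provides an actual element of the set below t, since the infimum
  itself might not be attained; monotonicity carries the bound up to t.\<close>

lemma gen_inverse_less_imp:
  assumes "gen_inverse g Y < ennreal t" and mono: "\<And>a b. 0 \<le> a \<Longrightarrow> a \<le> b \<Longrightarrow> g a \<le> g b"
  shows "Y \<le> ennreal (g t)"
proof -
  obtain t' where t': "0 \<le> t'" "Y \<le> ennreal (g t')" "ennreal t' < ennreal t"
    using assms(1) unfolding gen_inverse_def Inf_less_iff by auto
  then have "t' \<le> t" by (simp add: ennreal_less_iff)
  then show ?thesis using t' mono[of t' t] by (meson ennreal_leI order_trans)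
qed

text \<open>v_- lives outside \<open>ball x0 R\<close>, where moving the centre changes distances by
  at most the factor 1/\<eta>; kernel and f' together lose \<eta>^(-(d+sq)). The loss is absorbed by
  raising the level: f'(L t0) \<ge> (p/q) L^(p-1) f'(t0), and p > 1 makes a suitable L
  available.\<close>

lemma subball_tail:
  fixes v :: "'a::euclidean_space \<Rightarrow> real"
  assumes pq: "1 < p" "p \<le> q" and gf: "growth_function p q f" and s: "0 < s" "s < 1"
    and mv [measurable]: "v \<in> borel_measurable borel" and R: "0 < R"
    and nn: "\<And>x. x \<in> ball x0 R \<Longrightarrow> 0 \<le> v x"
    and t0: "0 \<le> t0" "ennreal ((1 - s) * R powr s) * tail_integral (deriv0 f) s v x0 R \<le> ennreal (deriv0 f t0)"
    and \<eta>: "0 < \<eta>" "\<eta> \<le> 1" and y: "dist x0 y + \<rho> \<le> R" "dist x0 y \<le> (1 - \<eta>) * R" and \<rho>: "0 < \<rho>"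
    and L: "1 \<le> L" "q / p * (1 / \<eta>) powr (real DIM('a) + q) \<le> p / q * L powr (p - 1)"
    and k: "L * t0 \<le> k / R powr s" "0 < k"
  shows "ennreal (1 - s) * tail_integral (deriv0 f) s v y \<rho> \<le> ennreal (deriv0 f (k / \<rho> powr s) / \<rho> powr s)"
proof -
  let ?g = "deriv0 f"
  let ?d = "real DIM('a)"
  define H where "H = q / p * (1 / \<eta>) powr (?d + q)"
  note gnn = gf_deriv_nonneg[OF pq gf] and gmono = gf_deriv_mono[OF pq gf] and g0 = gf_deriv_0[OF pq gf]
  have H0: "0 \<le> H" using pq by (simp add: H_def)
  have \<rho>R: "\<rho> \<le> R" using y zero_le_dist[of x0 y] by linarith
  have pt: "ennreal (?g (neg_part (v z) / norm (z - y) powr s) / norm (z - y) powr (?d + s)) * indicator (- ball y \<rho>) z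
     \<le> ennreal H * (ennreal (?g (neg_part (v z) / norm (z - x0) powr s) / norm (z - x0) powr (?d + s)) * indicator (- ball x0 R) z)" for z
  proof (cases "z \<in> ball x0 R")
    case True
    then have "neg_part (v z) = 0" using nn[of z] by (simp add: neg_part_def)
    then show ?thesis by (simp add: g0)
  next
    case False
    let ?n = "norm (z - y)" and ?m = "norm (z - x0)" and ?a = "neg_part (v z)"
    have m: "R \<le> ?m" using False by (simp add: dist_norm norm_minus_commute)
    have a: "0 \<le> ?a" by (simp add: neg_part_def)
    have "?m \<le> ?n + dist x0 y"
      using norm_triangle_ineq[of "z - y" "y - x0"] by (simp add: dist_norm norm_minus_commute)
    moreover have "(1 - \<eta>) * R \<le> (1 - \<eta>) * ?m" using m \<eta> by (intro mult_left_mono) auto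
    \<comment> \<open>|z-y| \<ge> |z-x0| - (1-\<eta>)R, and R \<le> |z-x0| outside the ball.\<close>
    ultimately have n: "\<eta> * ?m \<le> ?n" using y by (simp add: left_diff_distrib)
    have m0: "0 < ?m" using m R by linarith
    have \<eta>m: "0 < \<eta> * ?m" using m0 \<eta> by (intro mult_pos_pos) auto
    have pos: "0 < ?m" "0 < \<eta> * ?m" "0 < ?n" using m0 \<eta>m order.strict_trans2[OF \<eta>m n] by blast+
    have pw: "1 / ?n powr e \<le> (1 / \<eta>) powr e * (1 / ?m powr e)" if "0 \<le> e" for e
    proof -
      have "(\<eta> * ?m) powr e \<le> ?n powr e" using pos n that by (intro powr_mono2) auto
      then have "1 / ?n powr e \<le> 1 / (\<eta> * ?m) powr e" using pos \<eta> by (intro divide_left_mono mult_pos_pos) auto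
      also have "\<dots> = (1 / \<eta>) powr e * (1 / ?m powr e)" using pos \<eta> by (simp add: powr_mult powr_divide)
      finally show ?thesis .
    qed
    have \<eta>1: "1 \<le> (1 / \<eta>) powr s" using \<eta> s by (intro ge_one_powr_ge_zero) auto
    have "?a / ?n powr s \<le> (1 / \<eta>) powr s * (?a / ?m powr s)"
      using mult_left_mono[OF pw[of s] a] s by (simp add: mult_ac)
    then have "?g (?a / ?n powr s) \<le> ?g ((1 / \<eta>) powr s * (?a / ?m powr s))"
      using a by (intro gmono) auto
    also have "\<dots> \<le> q / p * ((1 / \<eta>) powr s) powr (q - 1) * ?g (?a / ?m powr s)"
      using a \<eta>1 by (intro gf_deriv_scale[OF pq gf]) auto
    finally have "?g (?a / ?n powr s) * (1 / ?n powr (?d + s))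
       \<le> (q / p * ((1 / \<eta>) powr s) powr (q - 1) * ?g (?a / ?m powr s)) * ((1 / \<eta>) powr (?d + s) * (1 / ?m powr (?d + s)))"
      using a gnn[of "?a / ?m powr s"] pq s by (intro mult_mono pw) auto
    also have "\<dots> = q / p * (1 / \<eta>) powr (?d + s * q) * (?g (?a / ?m powr s) / ?m powr (?d + s))"
    proof -
      have "((1 / \<eta>) powr s) powr (q - 1) * (1 / \<eta>) powr (?d + s) = (1 / \<eta>) powr (?d + s * q)"
        by (simp add: powr_powr powr_add[symmetric] algebra_simps)
      then show ?thesis by simp
    qed
    also have "\<dots> \<le> H * (?g (?a / ?m powr s) / ?m powr (?d + s))"
    proof -
      have "s * q \<le> 1 * q" using s pq by (intro mult_right_mono) auto
      then have "(1 / \<eta>) powr (?d + s * q) \<le> (1 / \<eta>) powr (?d + q)"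
        using \<eta> by (intro powr_mono) auto
      then show ?thesis unfolding H_def using a gnn[of "?a / ?m powr s"] pq
        by (intro mult_right_mono mult_left_mono) auto
    qed
    finally have "ennreal (?g (?a / ?n powr s) / ?n powr (?d + s)) \<le> ennreal (H * (?g (?a / ?m powr s) / ?m powr (?d + s)))"
      by (intro ennreal_leI) simp
    also have "\<dots> = ennreal H * ennreal (?g (?a / ?m powr s) / ?m powr (?d + s))"
      using H0 a gnn[of "?a / ?m powr s"] by (intro ennreal_mult) auto
    finally show ?thesis using False by (auto simp: indicator_def)
  qed
  note borel_measurable_tail_integrand[OF pq gf mv, measurable]
  have "tail_integral ?g s v y \<rho> \<le> ennreal H * tail_integral ?g s v x0 R"
    unfolding tail_integral_def by (subst nn_integral_cmult[symmetric], measurable) (intro nn_integral_mono pt)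
  then have "ennreal (1 - s) * tail_integral ?g s v y \<rho> \<le> ennreal (1 - s) * (ennreal H * tail_integral ?g s v x0 R)"
    by (rule mult_left_mono) simp
  also have "\<dots> = ennreal (H / R powr s) * (ennreal ((1 - s) * R powr s) * tail_integral ?g s v x0 R)"
  proof -
    have "ennreal (H / R powr s) * ennreal ((1 - s) * R powr s) = ennreal (1 - s) * ennreal H"
      using H0 s R by (simp add: ennreal_mult[symmetric])
    then show ?thesis by (simp only: mult.assoc[symmetric])
  qed
  also have "\<dots> \<le> ennreal (H / R powr s) * ennreal (?g t0)" by (intro mult_left_mono t0) auto
  also have "\<dots> = ennreal (H * ?g t0 / R powr s)"
    using H0 gnn[OF t0(1)] by (simp add: ennreal_mult[symmetric])
  also have "\<dots> \<le> ennreal (?g (k / \<rho> powr s) / \<rho> powr s)"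
  proof (intro ennreal_leI frac_le)
    have "H * ?g t0 \<le> p / q * L powr (p - 1) * ?g t0" unfolding H_def using L gnn[OF t0(1)] by (intro mult_right_mono) auto
    also have "\<dots> \<le> ?g (L * t0)" using L t0 by (intro gf_deriv_scale[OF pq gf]) auto
    also have "\<dots> \<le> ?g (k / R powr s)" using L t0 k by (intro gmono) auto
    also have "\<dots> \<le> ?g (k / \<rho> powr s)"
      using k \<rho> \<rho>R R s by (intro gmono divide_left_mono powr_mono2) auto
    finally show "H * ?g t0 \<le> ?g (k / \<rho> powr s)" .
    show "0 \<le> ?g (k / \<rho> powr s)" using k by (intro gnn) auto
    show "\<rho> powr s \<le> R powr s" using \<rho> \<rho>R s by (intro powr_mono2) auto
  qed (use \<rho> in auto)
  finally show ?thesis .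
qed

text \<open>\<open>power_positivity\<close> with its Caccioppoli hypothesis discharged. The centres
  there are at distance \<eta> R with \<eta> = \<sigma>/(2d) from the boundary, so the tail must lie
  below the final level by a factor L of order \<sigma>^(-e); this raises the exponent from N0 to N0
  + e.\<close>

lemma positivity_or_tail:
  fixes s0 p q c :: real
  assumes par: "0 < s0" "s0 < 1" "1 < p" "p \<le> q" "0 < c"
  obtains c2 N where "0 < c2" "0 < N"
    "\<And>s (\<Omega> :: 'a::euclidean_space set) f u v x0 R M \<sigma>. \<lbrakk>s0 \<le> s; s < 1; open \<Omega>; growth_function p q f;
       u \<in> De_Giorgi_minus \<Omega> q c s f; AE x in lborel. u x = v x; v \<in> borel_measurable borel;
       0 < R; ball x0 R \<subseteq> \<Omega>; \<And>x. x \<in> ball x0 R \<Longrightarrow> 0 \<le> v x; 0 < M; 0 < \<sigma>; \<sigma> \<le> 1;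
       \<sigma> * (unit_ball_vol (real DIM('a)) * R ^ DIM('a)) \<le> measure lborel {x \<in> ball x0 R. M \<le> v x};
       gen_inverse (deriv0 f) (ennreal ((1 - s) * R powr s) * tail_integral (deriv0 f) s v x0 R)
         < ennreal (c2 * \<sigma> powr N * (M / R powr s))\<rbrakk>
     \<Longrightarrow> AE x in lborel. x \<in> ball x0 (R / 2) \<longrightarrow> c2 * \<sigma> powr N * M \<le> v x"
proof -
  let ?d = "real DIM('a)"
  have d: "1 \<le> ?d" using DIM_positive[where 'a='a] by linarith
  define \<Lambda> where "\<Lambda> = caccioppoli_const DIM('a) s0 p q c"
  have \<Lambda>: "0 \<le> \<Lambda>"
    unfolding \<Lambda>_def caccioppoli_const_def using par tail_const_nonneg[OF par(3,4,1)]
    by (intro mult_nonneg_nonneg add_nonneg_nonneg) auto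
  have b: "1 \<le> ?d + q" using d par by linarith
  obtain c0 N0 where c0: "0 < c0" "0 < N0"
    and pos: "\<And>s (u :: 'a \<Rightarrow> real) x0 R M \<sigma>. \<lbrakk>s0 \<le> s; s < 1; u \<in> borel_measurable borel; 0 < R; 0 < M;
       \<And>x. x \<in> ball x0 R \<Longrightarrow> 0 \<le> u x; 0 < \<sigma>; \<sigma> \<le> 1;
       \<And>y \<rho> l. 0 < \<rho> \<Longrightarrow> dist x0 y + \<rho> \<le> R \<Longrightarrow> dist x0 y \<le> (1 - \<sigma> / (2 * ?d)) * R \<Longrightarrow>
         c0 * \<sigma> powr N0 * M \<le> l \<Longrightarrow> caccioppoli p q s \<Lambda> (?d + q) u y \<rho> l;
       \<sigma> * (unit_ball_vol ?d * R ^ DIM('a)) \<le> measure lborel {x \<in> ball x0 R. M \<le> u x}\<rbrakk>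
     \<Longrightarrow> AE x in lborel. x \<in> ball x0 (R / 2) \<longrightarrow> c0 * \<sigma> powr N0 * M \<le> u x"
    using power_positivity[OF par(1,3,4) \<Lambda> b, where 'a = 'a] by blast
  \<comment> \<open>e and L0 solve (q/p) \<eta>^(-(d+q)) = (p/q) L^(p-1) for L = L0 \<sigma>^(-e),
    the condition of \<open>subball_tail\<close> with equality.\<close>
  define e where "e = (?d + q) / (p - 1)"
  define L0 where "L0 = (q / p) powr (2 / (p - 1)) * (2 * ?d) powr e"
  have e: "0 < e" using par d by (simp add: e_def add_pos_pos)
  have L0: "1 \<le> L0"
  proof -
    have "1 \<le> (q / p) powr (2 / (p - 1))" using par by (intro ge_one_powr_ge_zero) auto
    moreover have "1 \<le> 2 * ?d" using d by linarith
    then have "1 \<le> (2 * ?d) powr e" using e by (intro ge_one_powr_ge_zero) auto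
    ultimately show ?thesis unfolding L0_def using mult_mono[of 1 _ 1] by fastforce
  qed
  show ?thesis
  proof (rule that[of "c0 / L0" "N0 + e"])
    show "0 < c0 / L0" "0 < N0 + e" using c0 L0 e by auto
    fix s R M \<sigma> :: real and \<Omega> :: "'a set" and f and u v :: "'a \<Rightarrow> real" and x0 :: 'a
    assume s: "s0 \<le> s" "s < 1" and \<Omega>: "open \<Omega>" and gf: "growth_function p q f"
      and u: "u \<in> De_Giorgi_minus \<Omega> q c s f" and ae: "AE x in lborel. u x = v x" and mv: "v \<in> borel_measurable borel"
      and R: "0 < R" and sub: "ball x0 R \<subseteq> \<Omega>" and nn: "\<And>x. x \<in> ball x0 R \<Longrightarrow> 0 \<le> v x"
      and M: "0 < M" and \<sigma>: "0 < \<sigma>" "\<sigma> \<le> 1"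
      and dens: "\<sigma> * (unit_ball_vol ?d * R ^ DIM('a)) \<le> measure lborel {x \<in> ball x0 R. M \<le> v x}"
      and T: "gen_inverse (deriv0 f) (ennreal ((1 - s) * R powr s) * tail_integral (deriv0 f) s v x0 R)
         < ennreal (c0 / L0 * \<sigma> powr (N0 + e) * (M / R powr s))"
    define \<kappa> where "\<kappa> = c0 * \<sigma> powr N0 * M"
    define L where "L = L0 * \<sigma> powr (- e)"
    define \<eta> where "\<eta> = \<sigma> / (2 * ?d)"
    \<comment> \<open>The threshold for the tail, chosen so that L t0 = \<kappa>/R^s: every level
      from \<kappa> upwards dominates the tail in all subballs that occur.\<close>
    define t0 where "t0 = c0 / L0 * \<sigma> powr (N0 + e) * (M / R powr s)"
    have "\<sigma> \<le> 2 * ?d" using \<sigma> d by linarith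
    then have \<eta>: "0 < \<eta>" "\<eta> \<le> 1" using \<sigma> by (auto simp: \<eta>_def divide_le_eq)
    have \<sigma>e: "1 \<le> \<sigma> powr (- e)" using \<sigma> e powr_mono'[of "- e" 0 \<sigma>] by simp
    have L1: "1 \<le> L" unfolding L_def using L0 \<sigma>e mult_mono[of 1 L0 1 "\<sigma> powr (- e)"] by simp
    have Lp: "q / p * (1 / \<eta>) powr (?d + q) \<le> p / q * L powr (p - 1)"
    proof -
      have L_eq: "L = (q / p) powr (2 / (p - 1)) * (1 / \<eta>) powr e"
        using \<sigma> d by (simp add: L_def L0_def \<eta>_def powr_divide powr_minus_divide)
      then have "L powr (p - 1) = (q / p) powr 2 * (1 / \<eta>) powr (?d + q)"
      proof -
        have "p - 1 \<noteq> 0" using par by simp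
        moreover have "x / r * r = x" if "r \<noteq> 0" for x r :: real using that by simp
        ultimately have "2 / (p - 1) * (p - 1) = 2" "e * (p - 1) = ?d + q"
          unfolding e_def by blast+
        then show ?thesis using L_eq by (simp only: powr_mult powr_powr)
      qed
      also have "(q / p) powr 2 = (q / p) * (q / p)" using par powr_realpow[of "q / p" 2] by (simp add: power2_eq_square)
      finally show ?thesis using par by simp
    qed
    have Lt0: "L * t0 = \<kappa> / R powr s"
      using L0 \<sigma> by (simp add: L_def t0_def \<kappa>_def powr_add powr_minus)
    have t0: "0 \<le> t0" using c0 L0 M by (simp add: t0_def)
    have Yt0: "ennreal ((1 - s) * R powr s) * tail_integral (deriv0 f) s v x0 R \<le> ennreal (deriv0 f t0)"
      using T gf_deriv_mono[OF par(3,4) gf] unfolding t0_def[symmetric] by (rule gen_inverse_less_imp)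
    have \<kappa>: "0 < \<kappa>" using c0 \<sigma> M by (simp add: \<kappa>_def)
    have "AE x in lborel. x \<in> ball x0 (R / 2) \<longrightarrow> c0 * \<sigma> powr N0 * M \<le> v x"
    proof (rule pos[OF s mv R M nn \<sigma> _ dens])
      fix y \<rho> l
      assume y: "0 < \<rho>" "dist x0 y + \<rho> \<le> R" "dist x0 y \<le> (1 - \<sigma> / (2 * ?d)) * R" and l: "c0 * \<sigma> powr N0 * M \<le> l"
      have suby: "ball y \<rho> \<subseteq> ball x0 R"
      proof
        fix z assume "z \<in> ball y \<rho>"
        then show "z \<in> ball x0 R" using y dist_triangle[of x0 z y] by (auto simp: dist_commute)
      qed
      have l\<kappa>: "\<kappa> \<le> l" using l by (simp add: \<kappa>_def)
      show "caccioppoli p q s \<Lambda> (?d + q) v y \<rho> l"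
        unfolding \<Lambda>_def
      proof (rule DG_ineq_imp_caccioppoli[OF par(3,4) gf par(1) s _ mv y(1)])
        show "0 \<le> c" using par by simp
        show "0 < l" using \<kappa> l\<kappa> by linarith
        show "0 \<le> v x" if "x \<in> ball y \<rho>" for x using that suby nn by blast
        show "DG_ineq q c s f v y r r' l" if "0 < r" "r < r'" "r' \<le> \<rho>" for r r'
        proof (rule De_Giorgi_minus_imp_DG_ineq[OF u _ that(1,2) _ ae])
          show "y \<in> \<Omega>" using y(1) suby sub centre_in_ball[of y \<rho>] by blast
          have "ereal \<rho> \<le> edist_set y (frontier \<Omega>)" using \<Omega> suby sub by (intro le_edist_frontier) auto
          then show "ereal r' \<le> edist_set y (frontier \<Omega>)" using that(3) order_trans ereal_less_eq(3) by blast
        qed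
        have "L * t0 \<le> l / R powr s" unfolding Lt0 using l\<kappa> by (intro divide_right_mono) auto
        then show "ennreal (1 - s) * tail_integral (deriv0 f) s v y \<rho> \<le> ennreal (deriv0 f (l / \<rho> powr s) / \<rho> powr s)"
          using par s y \<kappa> l\<kappa> unfolding \<eta>_def[symmetric]
          by (intro subball_tail[OF par(3,4) gf _ _ mv R nn t0 Yt0 \<eta> y(2) _ y(1) L1 Lp]) auto
      qed
    qed
    then show "AE x in lborel. x \<in> ball x0 (R / 2) \<longrightarrow> c0 / L0 * \<sigma> powr (N0 + e) * M \<le> v x"
    proof (rule eventually_mono)
      fix x assume *: "x \<in> ball x0 (R / 2) \<longrightarrow> c0 * \<sigma> powr N0 * M \<le> v x"
      \<comment> \<open>The lower bound is weakened to the number that also bounds the tail, so that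
        a single quantity governs both alternatives.\<close>
      have "c0 / L0 * \<sigma> powr (N0 + e) * M \<le> c0 / 1 * \<sigma> powr N0 * M"
        using c0 L0 \<sigma> e M by (intro mult_mono mult_right_mono divide_left_mono powr_mono') auto
      then show "x \<in> ball x0 (R / 2) \<longrightarrow> c0 / L0 * \<sigma> powr (N0 + e) * M \<le> v x" using * by auto
    qed
  qed
qed

section \<open>From decay of the distribution function to the integral\<close>

lemma le_essinf_on:
  fixes w :: "'a::euclidean_space \<Rightarrow> real"
  assumes "w \<in> borel_measurable lebesgue" "A \<in> sets lebesgue" "AE x in lebesgue. x \<in> A \<longrightarrow> \<kappa> \<le> w x"
  shows "ereal \<kappa> \<le> essinf_on A w"
proof -
  have "esssup (restrict_space lebesgue A) (\<lambda>x. ereal (- w x)) \<le> ereal (- \<kappa>)"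
  proof (rule esssup_I)
    show "(\<lambda>x. ereal (- w x)) \<in> borel_measurable (restrict_space lebesgue A)"
      using assms(1) by (intro measurable_restrict_space1) simp
    show "AE x in restrict_space lebesgue A. ereal (- w x) \<le> ereal (- \<kappa>)"
      using assms(2,3) by (subst AE_restrict_space_iff) auto
  qed
  then have "- ereal (- \<kappa>) \<le> - esssup (restrict_space lebesgue A) (\<lambda>x. ereal (- w x))"
    by (simp only: ereal_minus_le_minus)
  then show ?thesis by (simp add: essinf_on_def)
qed

text \<open>Where 2^j \<mu> \<le> w < 2^(j+1) \<mu>, the upper growth bound gives f(w)^(a/q) \<le>
  2^(a(j+1)) f(\<mu>)^(a/q). The decay rate 2a is twice the growth rate a, so a geometric series of
  ratio 2^(-a) remains.\<close>

lemma dyadic_integral_bound: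
  fixes w :: "'a::euclidean_space \<Rightarrow> real" and f :: "real \<Rightarrow> real" and a K \<mu> :: real
  assumes [measurable]: "w \<in> borel_measurable borel" "B \<in> sets borel"
    and pq: "1 < p" "p \<le> q" and gf: "growth_function p q f"
    and w: "\<And>x. x \<in> B \<Longrightarrow> 0 \<le> w x" and \<mu>: "0 < \<mu>" and a: "0 < a" and K: "0 \<le> K"
    and decay: "\<And>j :: nat. emeasure lborel {x \<in> B. 2 ^ j * \<mu> \<le> w x} \<le> ennreal (K * 2 powr (- 2 * a * j)) * emeasure lborel B"
  shows "(\<integral>\<^sup>+x\<in>B. ennreal (f (w x) powr (a / q)) \<partial>lborel)
    \<le> ennreal (1 + K * 2 powr a / (1 - 2 powr (- a))) * ennreal (f \<mu> powr (a / q)) * emeasure lborel B"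
proof -
  let ?\<epsilon> = "a / q"
  define G where "G j = {x \<in> B. 2 ^ j * \<mu> \<le> w x}" for j :: nat
  define c where "c j = 2 powr (a * (real j + 1))" for j :: nat
  have [measurable]: "G j \<in> sets borel" for j unfolding G_def by measurable
  have F: "0 \<le> f \<mu>" using gf_simps(3)[OF pq gf] \<mu> by simp
  have \<epsilon>: "0 < ?\<epsilon>" using a pq by simp
  have pt: "ennreal (f (w x) powr ?\<epsilon>) * indicator B x
     \<le> ennreal (f \<mu> powr ?\<epsilon>) * (indicator B x + (\<Sum>j. ennreal (c j) * indicator (G j) x))" for x
  proof (cases "x \<in> B")
    case True
    show ?thesis
    proof (cases "w x \<le> \<mu>")
      case le: True
      have "f (w x) powr ?\<epsilon> \<le> f \<mu> powr ?\<epsilon>"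
        using True w[of x] le \<epsilon> gf_simps(3)[OF pq gf] by (intro powr_mono2 gf_mono[OF pq gf]) auto
      then have "ennreal (f (w x) powr ?\<epsilon>) \<le> ennreal (f \<mu> powr ?\<epsilon>) * 1" by (simp add: ennreal_leI)
      also have "\<dots> \<le> ennreal (f \<mu> powr ?\<epsilon>) * (indicator B x + (\<Sum>j. ennreal (c j) * indicator (G j) x))"
        using True by (intro mult_left_mono) auto
      finally show ?thesis using True by simp
    next
      case False
      then have "1 \<le> w x / \<mu>" using \<mu> by simp
      then obtain j where j: "2 ^ j \<le> w x / \<mu>" "w x / \<mu> < 2 ^ Suc j"
        using ex_dyadic by blast
      have xG: "x \<in> G j" using j \<mu> True by (simp add: G_def le_divide_eq)
      have "f (w x) = f (w x / \<mu> * \<mu>)" using \<mu> by simp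
      also have "\<dots> \<le> (w x / \<mu>) powr q * f \<mu>"
        using \<open>1 \<le> w x / \<mu>\<close> \<mu> by (intro gf_scale[OF pq gf]) auto
      finally have "f (w x) powr ?\<epsilon> \<le> ((w x / \<mu>) powr q * f \<mu>) powr ?\<epsilon>"
        using True w[of x] \<epsilon> gf_simps(3)[OF pq gf] by (intro powr_mono2) auto
      also have "\<dots> = (w x / \<mu>) powr a * f \<mu> powr ?\<epsilon>" using pq by (simp add: powr_mult powr_powr)
      also have "\<dots> \<le> c j * f \<mu> powr ?\<epsilon>"
      proof (rule mult_right_mono)
        have "(w x / \<mu>) powr a \<le> (2 ^ Suc j) powr a"
          using j \<open>1 \<le> w x / \<mu>\<close> a by (intro powr_mono2) auto
        also have "(2 ^ Suc j :: real) = 2 powr (real j + 1)" using powr_realpow[of 2 "Suc j"] by (simp add: add.commute)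
        finally show "(w x / \<mu>) powr a \<le> c j" by (simp add: c_def powr_powr mult.commute)
      qed simp
      finally have "ennreal (f (w x) powr ?\<epsilon>) \<le> ennreal (f \<mu> powr ?\<epsilon> * c j)"
        by (intro ennreal_leI) (simp add: mult.commute)
      also have "\<dots> = ennreal (f \<mu> powr ?\<epsilon>) * (ennreal (c j) * indicator (G j) x)"
        using xG by (simp add: ennreal_mult c_def)
      also have "\<dots> \<le> ennreal (f \<mu> powr ?\<epsilon>) * (indicator B x + (\<Sum>j. ennreal (c j) * indicator (G j) x))"
      proof (rule mult_left_mono)
        have "F j \<le> (\<Sum>j. F j)" for F :: "nat \<Rightarrow> ennreal" using sum_le_suminf[of F "{j}"] by simp
        then have "ennreal (c j) * indicator (G j) x \<le> (\<Sum>j. ennreal (c j) * indicator (G j) x)" .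
        then show "ennreal (c j) * indicator (G j) x \<le> indicator B x + (\<Sum>j. ennreal (c j) * indicator (G j) x)"
          by (rule add_increasing[rotated]) simp
      qed simp
      finally show ?thesis using True by simp
    qed
  qed auto
  have "(\<integral>\<^sup>+x\<in>B. ennreal (f (w x) powr ?\<epsilon>) \<partial>lborel)
     \<le> (\<integral>\<^sup>+x. ennreal (f \<mu> powr ?\<epsilon>) * (indicator B x + (\<Sum>j. ennreal (c j) * indicator (G j) x)) \<partial>lborel)"
    by (intro nn_integral_mono pt)
  also have "\<dots> = ennreal (f \<mu> powr ?\<epsilon>) * (emeasure lborel B + (\<Sum>j. ennreal (c j) * emeasure lborel (G j)))"
    by (simp add: nn_integral_cmult nn_integral_add nn_integral_suminf)
  also have "\<dots> \<le> ennreal (f \<mu> powr ?\<epsilon>) * (emeasure lborel B + ennreal (K * 2 powr a / (1 - 2 powr (- a))) * emeasure lborel B)"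
  proof (intro mult_left_mono add_left_mono)
    have "(\<Sum>j. ennreal (c j) * emeasure lborel (G j))
      \<le> (\<Sum>j. ennreal (K * 2 powr a * (2 powr (- a)) ^ j) * emeasure lborel B)"
    proof (rule suminf_le)
      fix j :: nat
      have "ennreal (c j) * emeasure lborel (G j) \<le> ennreal (c j) * (ennreal (K * 2 powr (- 2 * a * j)) * emeasure lborel B)"
        unfolding G_def by (intro mult_left_mono decay) auto
      also have "\<dots> = ennreal (c j * (K * 2 powr (- 2 * a * j))) * emeasure lborel B"
        using K by (subst ennreal_mult) (auto simp: c_def mult.assoc)
      also have "c j * (K * 2 powr (- 2 * a * j)) = K * 2 powr a * (2 powr (- a)) ^ j"
      proof -
        have "c j * 2 powr (- 2 * a * j) = 2 powr (a + (- a) * real j)"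
          unfolding c_def by (simp add: powr_add[symmetric] algebra_simps)
        also have "\<dots> = 2 powr a * (2 powr (- a)) ^ j" by (simp only: powr_add) (simp add: powr_power mult.commute)
        finally show ?thesis by (simp only: mult_ac)
      qed
      finally show "ennreal (c j) * emeasure lborel (G j) \<le> ennreal (K * 2 powr a * (2 powr (- a)) ^ j) * emeasure lborel B" .
    qed auto
    also have "\<dots> = (\<Sum>j. ennreal (K * 2 powr a * (2 powr (- a)) ^ j)) * emeasure lborel B"
      by (rule ennreal_suminf_multc)
    also have "(\<Sum>j. ennreal (K * 2 powr a * (2 powr (- a)) ^ j)) = ennreal (K * 2 powr a * (1 / (1 - 2 powr (- a))))"
    proof (rule suminf_ennreal_eq)
      show "(\<lambda>j. K * 2 powr a * (2 powr (- a)) ^ j) sums (K * 2 powr a * (1 / (1 - 2 powr (- a))))"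
        using a by (intro sums_mult geometric_sums) (simp add: powr_less_one)
    qed (use K in auto)
    finally show "(\<Sum>j. ennreal (c j) * emeasure lborel (G j)) \<le> ennreal (K * 2 powr a / (1 - 2 powr (- a))) * emeasure lborel B"
      by simp
  qed auto
  also have "\<dots> = ennreal (1 + K * 2 powr a / (1 - 2 powr (- a))) * ennreal (f \<mu> powr ?\<epsilon>) * emeasure lborel B"
  proof -
    have "0 \<le> K * 2 powr a / (1 - 2 powr (- a))"
      using K a by (intro divide_nonneg_pos) (auto simp: powr_less_one)
    then have "ennreal (1 + K * 2 powr a / (1 - 2 powr (- a))) = 1 + ennreal (K * 2 powr a / (1 - 2 powr (- a)))"
      by (simp add: ennreal_plus)
    then show ?thesis by (simp only: distrib_left distrib_right mult_1 mult_ac)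
  qed
  finally show ?thesis .
qed

lemma emeasure_lebesgue_eq_lborel:
  assumes [measurable]: "A \<in> sets borel"
  shows "emeasure lebesgue A = emeasure lborel A"
proof -
  have "emeasure lebesgue A = (\<integral>\<^sup>+x. indicator A x \<partial>lebesgue)"
    by (rule nn_integral_indicator[symmetric]) simp
  also have "\<dots> = (\<integral>\<^sup>+x. indicator A x \<partial>lborel)" by (rule nn_integral_completion)
  finally show ?thesis by simp
qed

text \<open>Let m be the larger of the infimum and the tail term. If \<sigma> is the density of {w
  \<ge> t}, then either the tail or the infimum is at least c2 \<sigma>^N t, so c2 \<sigma>^N t
  \<le> m in both cases. This is the decay that \<open>dyadic_integral_bound\<close> integrates,
  starting from \<mu> = m.\<close>

theorem theorem4p1:
  fixes s0 p q c :: real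
  assumes "0 < s0" "s0 < 1" "1 < p" "p \<le> q" "0 < c"
  shows "\<exists>C \<epsilon> :: real. 0 < C \<and> 0 < \<epsilon> \<and> \<epsilon> < 1 \<and>
    (\<forall>s (\<Omega> :: 'a::euclidean_space set) f u x0 R.
       s0 \<le> s \<and> s < 1 \<and> open \<Omega> \<and> growth_function p q f \<and>
       u \<in> De_Giorgi_minus \<Omega> q c s f \<and> 0 < R \<and> ball x0 R \<subseteq> \<Omega> \<and>
       (AE x in lebesgue. x \<in> ball x0 R \<longrightarrow> 0 \<le> u x) \<longrightarrow>
         (\<integral>\<^sup>+x\<in>ball x0 R. ennreal (f (u x / R powr s) powr \<epsilon>) \<partial>lebesgue)
           / emeasure lebesgue (ball x0 R)
         \<le> ennreal C * fpow f \<epsilon> (e2ennreal (essinf_on (ball x0 (R / 2)) (\<lambda>x. u x / R powr s)))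
           + ennreal C * fpow f \<epsilon> (Tail (deriv0 f) s (\<lambda>x. neg_part (u x)) x0 R / ennreal (R powr s)))"
proof -
  let ?V = "unit_ball_vol (real DIM('a))"
  have pq: "1 < p" "p \<le> q" by fact+
  obtain c2 N where cN: "0 < c2" "0 < N"
    and pos: "\<And>s (\<Omega> :: 'a set) f u v x0 R M \<sigma>. \<lbrakk>s0 \<le> s; s < 1; open \<Omega>; growth_function p q f;
       u \<in> De_Giorgi_minus \<Omega> q c s f; AE x in lborel. u x = v x; v \<in> borel_measurable borel;
       0 < R; ball x0 R \<subseteq> \<Omega>; \<And>x. x \<in> ball x0 R \<Longrightarrow> 0 \<le> v x; 0 < M; 0 < \<sigma>; \<sigma> \<le> 1;
       \<sigma> * (?V * R ^ DIM('a)) \<le> measure lborel {x \<in> ball x0 R. M \<le> v x};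
       gen_inverse (deriv0 f) (ennreal ((1 - s) * R powr s) * tail_integral (deriv0 f) s v x0 R)
         < ennreal (c2 * \<sigma> powr N * (M / R powr s))\<rbrakk>
     \<Longrightarrow> AE x in lborel. x \<in> ball x0 (R / 2) \<longrightarrow> c2 * \<sigma> powr N * M \<le> v x"
    using positivity_or_tail[OF assms, where 'a = 'a] by blast
  \<comment> \<open>2a \<le> 1/N matches the decay rate of the distribution function, and a \<le>
    1/2 keeps \<epsilon> = a/q below 1.\<close>
  define a where "a = min (1 / (2 * N)) (1 / 2)"
  define \<epsilon> where "\<epsilon> = a / q"
  define K where "K = c2 powr (- 1 / N)"
  define C where "C = 1 + K * 2 powr a / (1 - 2 powr (- a))"
  have a: "0 < a" "2 * a \<le> 1 / N" "a < 1" using cN by (auto simp: a_def min_def)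
  have K: "0 \<le> K" by (simp add: K_def)
  have \<epsilon>: "0 < \<epsilon>" "\<epsilon> < 1" using a pq by (auto simp: \<epsilon>_def divide_less_eq)
  have C: "0 < C"
  proof -
    have "0 \<le> K * 2 powr a / (1 - 2 powr (- a))"
      using K a by (intro divide_nonneg_pos) (auto simp: powr_less_one)
    then show ?thesis by (simp add: C_def)
  qed
  show ?thesis
  proof (rule exI[of _ C], rule exI[of _ \<epsilon>], intro conjI allI impI C \<epsilon>)
    fix s R :: real and \<Omega> :: "'a set" and f and u :: "'a \<Rightarrow> real" and x0 :: 'a
    assume H: "s0 \<le> s \<and> s < 1 \<and> open \<Omega> \<and> growth_function p q f \<and>
       u \<in> De_Giorgi_minus \<Omega> q c s f \<and> 0 < R \<and> ball x0 R \<subseteq> \<Omega> \<and>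
       (AE x in lebesgue. x \<in> ball x0 R \<longrightarrow> 0 \<le> u x)"
    then have s: "s0 \<le> s" "s < 1" and \<Omega>: "open \<Omega>" and gf: "growth_function p q f"
      and u: "u \<in> De_Giorgi_minus \<Omega> q c s f" and R: "0 < R" and sub: "ball x0 R \<subseteq> \<Omega>"
      and nn: "AE x in lborel. x \<in> ball x0 R \<longrightarrow> 0 \<le> u x"
      by (auto simp: AE_completion_iff)
    have mu: "u \<in> borel_measurable lebesgue"
      using u by (simp add: De_Giorgi_minus_def space_V_def)
    obtain u' where u': "u' \<in> borel_measurable lborel" "AE x in lborel. u x = u' x"
      using completion_ex_borel_measurable_real[OF mu] by blast
    have [measurable]: "u' \<in> borel_measurable borel" using u' by simp
    \<comment> \<open>A Borel version of \<open>u\<close>, corrected on a null set so that it is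
      nonnegative at every point of the ball.\<close>
    define v where "v x = (if dist x0 x < R then max 0 (u' x) else u' x)" for x
    have mv [measurable]: "v \<in> borel_measurable borel" unfolding v_def by measurable
    have vn: "0 \<le> v x" if "x \<in> ball x0 R" for x using that by (simp add: v_def)
    have ae: "AE x in lborel. u x = v x"
      using nn u'(2) by eventually_elim (auto simp: v_def)
    define Rs where "Rs = R powr s"
    have Rs: "0 < Rs" using R by (simp add: Rs_def)
    define w where "w x = v x / Rs" for x
    have [measurable]: "w \<in> borel_measurable borel" unfolding w_def by measurable
    define B where "B = ball x0 R"
    have [measurable]: "B \<in> sets borel" by (simp add: B_def)
    have eB: "emeasure lborel B = ennreal (?V * R ^ DIM('a))"
      unfolding B_def using R by (simp add: emeasure_ball)
    have VR: "0 < ?V * R ^ DIM('a)" using R by simp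
    define T where "T = Tail (deriv0 f) s (\<lambda>x. neg_part (u x)) x0 R / ennreal Rs"
    define I where "I = e2ennreal (essinf_on (ball x0 (R / 2)) (\<lambda>x. u x / Rs))"
    have T_eq: "T = gen_inverse (deriv0 f) (ennreal ((1 - s) * R powr s) * tail_integral (deriv0 f) s v x0 R)"
    proof -
      have "(\<integral>\<^sup>+y\<in>- ball x0 R. ennreal (deriv0 f (\<bar>neg_part (u y)\<bar> / norm (y - x0) powr s)
               / norm (y - x0) powr (real DIM('a) + s)) \<partial>lebesgue)
        = tail_integral (deriv0 f) s v x0 R"
        unfolding tail_integral_def nn_integral_completion
        by (rule nn_integral_cong_AE) (use ae in eventually_elim, simp add: neg_part_def)
      then show ?thesis
        using Rs unfolding T_def Tail_def Rs_def[symmetric]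
        by (subst mult.commute) (simp add: ennreal_mult_divide_eq)
    qed
    define m where "m = max I T"
    \<comment> \<open>Dichotomy: a tail below c2 \<sigma>^N t allows the positivity estimate and
      bounds the infimum; otherwise the tail itself is the bound.\<close>
    have key: "ennreal (c2 * \<sigma> powr N * t) \<le> m"
      if t: "0 < t" and \<sigma>: "0 < \<sigma>" "\<sigma> \<le> 1" and dens: "\<sigma> * (?V * R ^ DIM('a)) \<le> measure lborel {x \<in> B. t \<le> w x}" for t \<sigma>
    proof (cases "T < ennreal (c2 * \<sigma> powr N * t)")
      case True
      have "AE x in lborel. x \<in> ball x0 (R / 2) \<longrightarrow> c2 * \<sigma> powr N * (t * Rs) \<le> v x"
      proof (rule pos[OF s \<Omega> gf u ae mv R sub vn _ \<sigma>])
        show "0 < t * Rs" using t Rs by simp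
        show "\<sigma> * (?V * R ^ DIM('a)) \<le> measure lborel {x \<in> ball x0 R. t * Rs \<le> v x}"
          using dens Rs by (simp add: B_def w_def pos_le_divide_eq)
        show "gen_inverse (deriv0 f) (ennreal ((1 - s) * R powr s) * tail_integral (deriv0 f) s v x0 R)
         < ennreal (c2 * \<sigma> powr N * (t * Rs / R powr s))"
          using True Rs unfolding T_eq Rs_def[symmetric] by simp
      qed
      then have "AE x in lborel. x \<in> ball x0 (R / 2) \<longrightarrow> c2 * \<sigma> powr N * t \<le> u x / Rs"
        using ae by eventually_elim (use Rs in \<open>auto simp: pos_le_divide_eq mult.assoc\<close>)
      then have "ereal (c2 * \<sigma> powr N * t) \<le> essinf_on (ball x0 (R / 2)) (\<lambda>x. u x / Rs)"
        using mu by (intro le_essinf_on) (auto simp: AE_completion_iff)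
      then have "e2ennreal (ereal (c2 * \<sigma> powr N * t)) \<le> I" unfolding I_def by (rule e2ennreal_mono)
      then show ?thesis by (simp add: m_def le_max_iff_disj)
    next
      case False
      then show ?thesis by (simp add: m_def le_max_iff_disj not_less)
    qed
    let ?J = "\<integral>\<^sup>+x\<in>B. ennreal (f (w x) powr \<epsilon>) \<partial>lborel"
    have main: "?J \<le> ennreal C * fpow f \<epsilon> m * emeasure lborel B"
    proof (cases "m = \<infinity>")
      case True
      then have "fpow f \<epsilon> m = \<infinity>" by (simp add: fpow_def)
      moreover have "emeasure lborel B \<noteq> 0" using VR unfolding eB by (simp only: ennreal_eq_0_iff not_le)
      ultimately show ?thesis using C by (simp add: ennreal_mult_top ennreal_top_mult)
    next
      case fin: False
      define \<mu> where "\<mu> = enn2real m"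
      have m\<mu>: "m = ennreal \<mu>" using fin by (simp add: \<mu>_def ennreal_enn2real_if)
      have \<mu>0: "0 \<le> \<mu>" by (simp add: \<mu>_def)
      have fm: "fpow f \<epsilon> m = ennreal (f \<mu> powr \<epsilon>)" using fin by (simp add: fpow_def \<mu>_def)
      define \<sigma> where "\<sigma> t = measure lborel {x \<in> B. t \<le> w x} / (?V * R ^ DIM('a))" for t
      have \<sigma>V: "measure lborel {x \<in> B. t \<le> w x} = \<sigma> t * (?V * R ^ DIM('a))" for t
      proof -
        have "x = x / y * y" if "0 < y" for x y :: real using that by simp
        then show ?thesis using VR unfolding \<sigma>_def by blast
      qed
      have \<sigma>01: "0 \<le> \<sigma> t" "\<sigma> t \<le> 1" for t
      proof -
        show "0 \<le> \<sigma> t" unfolding \<sigma>_def using VR by (intro divide_nonneg_pos) auto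
        have "measure lborel {x \<in> B. t \<le> w x} \<le> measure lborel (ball x0 R)"
          by (intro measure_mono_in_ball[of _ _ x0 R]) (auto simp: B_def)
        then show "\<sigma> t \<le> 1" unfolding \<sigma>_def using VR R by (simp add: content_ball)
      qed
      have key': "c2 * \<sigma> t powr N * t \<le> \<mu>" if "0 < t" for t
      proof (cases "\<sigma> t = 0")
        case True
        then show ?thesis using \<mu>0 by simp
      next
        case False
        then have "0 < \<sigma> t" using \<sigma>01(1)[of t] by linarith
        then have "ennreal (c2 * \<sigma> t powr N * t) \<le> ennreal \<mu>"
          using that \<sigma>01(2)[of t] \<sigma>V[of t] unfolding m\<mu>[symmetric] by (intro key) auto
        then show ?thesis using \<mu>0 by simp
      qed
      have em: "emeasure lborel {x \<in> B. t \<le> w x} = ennreal (\<sigma> t) * emeasure lborel B" for t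
      proof -
        have "emeasure lborel {x \<in> B. t \<le> w x} = ennreal (\<sigma> t * (?V * R ^ DIM('a)))"
          unfolding \<sigma>V[symmetric] by (rule emeasure_in_ball[of _ x0 R]) (auto simp: B_def)
        then show ?thesis using \<sigma>01(1)[of t] VR unfolding eB by (simp add: ennreal_mult)
      qed
      show ?thesis
      proof (cases "\<mu> = 0")
        \<comment> \<open>A dyadic decomposition cannot start at \<mu> = 0. In this case
          \<open>key'\<close> forces every set {w \<ge> 1/(n+1)} to be null, so w = 0 almost
          everywhere in the ball and the integral vanishes.\<close>
        case True
        have z: "AE x in lborel. x \<notin> {x \<in> B. 1 / real (Suc n) \<le> w x}" for n
        proof (rule AE_not_in)
          have "\<sigma> (1 / real (Suc n)) = 0"
          proof (rule ccontr)
            assume "\<sigma> (1 / real (Suc n)) \<noteq> 0"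
            then have "0 < c2 * \<sigma> (1 / real (Suc n)) powr N * (1 / real (Suc n))"
              using cN by (intro mult_pos_pos) auto
            then show False using key'[of "1 / real (Suc n)"] True by simp
          qed
          then show "{x \<in> B. 1 / real (Suc n) \<le> w x} \<in> null_sets lborel"
            using em[of "1 / real (Suc n)"] by (auto simp: null_sets_def)
        qed
        have "AE x in lborel. ennreal (f (w x) powr \<epsilon>) * indicator B x = 0"
        proof -
          have "AE x in lborel. \<forall>n. x \<notin> {x \<in> B. 1 / real (Suc n) \<le> w x}"
            using z by (subst AE_all_countable) blast
          then show ?thesis
          proof eventually_elim
            case (elim x)
            show ?case
            proof (cases "x \<in> B")
              case True
              have "\<not> 0 < w x"
              proof
                assume "0 < w x"
                then obtain n where "inverse (real (Suc n)) < w x" using reals_Archimedean by blast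
                then show False using elim True by (auto simp: inverse_eq_divide dest!: spec[of _ n])
              qed
              moreover have "0 \<le> w x" using vn[of x] True Rs by (simp add: w_def B_def)
              ultimately have "w x = 0" by simp
              then show ?thesis by (simp add: gf_simps[OF pq gf])
            qed simp
          qed
        qed
        then have "?J = 0" by (subst nn_integral_cong_AE[where v = "\<lambda>_. 0"]) auto
        then show ?thesis by simp
      next
        case False
        with \<mu>0 have \<mu>: "0 < \<mu>" by simp
        \<comment> \<open>\<open>key'\<close> at t = 2^j \<mu>: solving c2 \<sigma>^N 2^j \<le> 1
          for \<sigma> gives the constant K = c2^(-1/N) and the rate 2^(-j/N).\<close>
        have decay: "emeasure lborel {x \<in> B. 2 ^ j * \<mu> \<le> w x} \<le> ennreal (K * 2 powr (- 2 * a * j)) * emeasure lborel B" for j :: nat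
        proof -
          let ?\<sigma> = "\<sigma> (2 ^ j * \<mu>)"
          have "c2 * ?\<sigma> powr N * 2 ^ j * \<mu> \<le> 1 * \<mu>" using key'[of "2 ^ j * \<mu>"] \<mu> by (simp add: mult.assoc)
          then have "c2 * ?\<sigma> powr N * 2 ^ j \<le> 1" using \<mu> by (rule mult_right_le_imp_le)
          then have "?\<sigma> powr N \<le> 1 / (c2 * 2 ^ j)"
            using cN by (subst pos_le_divide_eq) (auto simp: mult_ac)
          then have "(?\<sigma> powr N) powr (1 / N) \<le> (1 / (c2 * 2 ^ j)) powr (1 / N)"
            using cN by (intro powr_mono2) auto
          moreover have "(?\<sigma> powr N) powr (1 / N) = ?\<sigma>" using cN \<sigma>01(1) by (simp add: powr_powr)
          moreover have "(1 / (c2 * 2 ^ j)) powr (1 / N) = K * 2 powr (- (1 / N) * j)"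
          proof -
            have "1 / (c2 * 2 ^ j) = c2 powr (- 1) * 2 powr (- real j)"
              using cN by (simp add: powr_minus_divide powr_realpow)
            then have "(1 / (c2 * 2 ^ j)) powr (1 / N) = (c2 powr (- 1)) powr (1 / N) * (2 powr (- real j)) powr (1 / N)"
              by (simp only: powr_mult)
            also have "\<dots> = K * 2 powr (- (1 / N) * j)"
              by (simp only: K_def powr_powr) (simp add: mult.commute)
            finally show ?thesis .
          qed
          ultimately have "?\<sigma> \<le> K * 2 powr (- (1 / N) * j)" by simp
          also have "\<dots> \<le> K * 2 powr (- 2 * a * j)"
          proof (intro mult_left_mono powr_mono K)
            have "2 * a * real j \<le> 1 / N * real j" using a by (intro mult_right_mono) auto
            then show "- (1 / N) * real j \<le> - 2 * a * real j" by simp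
          qed simp
          finally show ?thesis unfolding em by (intro mult_right_mono ennreal_leI) auto
        qed
        have w0: "0 \<le> w x" if "x \<in> B" for x using vn[of x] that Rs by (simp add: w_def B_def)
        show ?thesis
          unfolding fm unfolding C_def \<epsilon>_def
          by (rule dyadic_integral_bound[OF _ _ pq gf w0 \<mu> a(1) K decay]) measurable
      qed
    qed
    have J_eq: "(\<integral>\<^sup>+x\<in>ball x0 R. ennreal (f (u x / R powr s) powr \<epsilon>) \<partial>lebesgue) = ?J"
      unfolding nn_integral_completion B_def w_def Rs_def
      by (rule nn_integral_cong_AE) (use ae in eventually_elim, simp)
    have "?J / emeasure lborel B \<le> ennreal C * fpow f \<epsilon> m"
    proof -
      have "?J / emeasure lborel B \<le> ennreal C * fpow f \<epsilon> m * emeasure lborel B / emeasure lborel B"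
        by (rule divide_right_mono_ennreal[OF main])
      also have "\<dots> = ennreal C * fpow f \<epsilon> m"
        using VR unfolding eB by (intro ennreal_mult_divide_eq) (simp_all only: ennreal_eq_0_iff not_le ennreal_neq_top not_False_eq_True)
      finally show ?thesis .
    qed
    also have "\<dots> \<le> ennreal C * (fpow f \<epsilon> I + fpow f \<epsilon> T)"
      unfolding m_def max_def by (intro mult_left_mono) (auto intro: add_increasing add_increasing2)
    also have "\<dots> = ennreal C * fpow f \<epsilon> I + ennreal C * fpow f \<epsilon> T" by (rule distrib_left)
    finally show "(\<integral>\<^sup>+x\<in>ball x0 R. ennreal (f (u x / R powr s) powr \<epsilon>) \<partial>lebesgue)
           / emeasure lebesgue (ball x0 R)
         \<le> ennreal C * fpow f \<epsilon> (e2ennreal (essinf_on (ball x0 (R / 2)) (\<lambda>x. u x / R powr s)))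
           + ennreal C * fpow f \<epsilon> (Tail (deriv0 f) s (\<lambda>x. neg_part (u x)) x0 R / ennreal (R powr s))"
      unfolding J_eq I_def T_def Rs_def B_def by (simp add: emeasure_lebesgue_eq_lborel)
  qed
qed

end
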